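(* Let $u$ be a minimizer of $\mathfrak{F}(v)=\int_\Omega F(X,v,\nabla v)\,dX$ over $W^{1,p}_\phi(\Omega)$. Then $$\operatorname{div}\left(\mathcal{A}(X,\nabla u)\right)-mf(X)u^{m-1}\chi_{\{u>0\}}\ge 0\quad\text{in }\Omega$$ in the sense of distributions. In particular, it defines a Radon measure $$\Lambda:=\operatorname{div}\left(\mathcal{A}(X,\nabla u)\right)-mf(X)u^{m-1}\chi_{\{u>0\}}.$$ Furthermore, the support of $\Lambda$ is contained in $\partial\{u>0\}$.
   Context: Setting. $\Omega\subset\mathbb{R}^n$ is a bounded smooth domain, $2\le p<n$, and $\phi\in W^{1,p}(\Omega)$ is a bounded nonnegative function. $W^{1,p}_\phi(\Omega)$ is the set of functions in $W^{1,p}(\Omega)$ with trace value $\phi$ on $\partial\Omega$. The kernel $F:\Omega\times\mathbb{R}\times\mathbb{R}^n\to\mathbb{R}$ has the form $F(X,u,\xi)=G(X,\xi)+g(X,u)$, where: (1) for all $\xi\in\mathbb{R}^n$ the map $X\mapsto G(X,\xi)$ is continuous; (2) there is $\lambda>0$ with $\lambda|\xi|^p\le G(X,\xi)\le\lambda^{-1}|\xi|^p$; (3) for almost all $X\in\Omega$ the map $\xi\mapsto G(X,\xi)$ is strictly convex, differentiable, and $G(X,t\xi)=|t|^pG(X,\xi)$ for all $t\in\mathbb{R}$, $\xi\in\mathbb{R}^n$; (4) $g(X,u)=f(X)(u^+)^m+Q(X)\chi_{\{u>0\}}$ with $1\le m<p$, $f$ measurable with $-K\le f\le K$ for some $K>0$,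 and $Q\in C^{0,\beta}$ with $0<\epsilon<Q<\epsilon^{-1}$ for some $\epsilon>0$. A minimizer of $\mathfrak{F}$ is $u\in W^{1,p}_\phi(\Omega)$ with $\mathfrak{F}(u)\le\mathfrak{F}(v)$ for all $v\in W^{1,p}_\phi(\Omega)$. Minimizers are nonnegative and have a continuous representative in $\Omega$, with which $u$ is identified. Notation: $\mathcal{A}(X,\xi):=\nabla_\xi G(X,\xi)$. *)

theory Defs
  imports "HOL-Analysis.Analysis"
begin

section \<open>Smooth functions, test functions, smooth domains\<close>

primrec C_k :: "nat \<Rightarrow> ('a::euclidean_space \<Rightarrow> real) \<Rightarrow> bool" where
  "C_k 0 f \<longleftrightarrow> continuous_on UNIV f"
| "C_k (Suc k) f \<longleftrightarrow> (\<forall>x. f differentiable (at x)) \<and>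
     (\<forall>h. C_k k (\<lambda>x. frechet_derivative f (at x) h))"

definition smooth :: "('a::euclidean_space \<Rightarrow> real) \<Rightarrow> bool" where
  "smooth f \<longleftrightarrow> (\<forall>k. C_k k f)"

definition gradient :: "('a::euclidean_space \<Rightarrow> real) \<Rightarrow> 'a \<Rightarrow> 'a" where
  "gradient f x = (THE D. GDERIV f x :> D)"

definition test_functions :: "'a::euclidean_space set \<Rightarrow> ('a \<Rightarrow> real) set" where
  "test_functions \<Omega> = {\<psi>. smooth \<psi> \<and> compact (closure {x. \<psi> x \<noteq> 0})
     \<and> closure {x. \<psi> x \<noteq> 0} \<subseteq> \<Omega>}"

text \<open>Near each boundary point the set is, in suitable orthonormal coordinates, the region above
  the graph of a smooth function of the other \<open>n - 1\<close> coordinates. The vertical axis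
  is spanned by \<open>\<nu>\<close>, and \<open>\<gamma>\<close> is only evaluated on the hyperplane orthogonal to \<open>\<nu>\<close>.\<close>

definition smooth_boundary :: "'a::euclidean_space set \<Rightarrow> bool" where
  "smooth_boundary \<Omega> \<longleftrightarrow> (\<forall>x\<^sub>0 \<in> frontier \<Omega>. \<exists>r>0. \<exists>\<nu> \<gamma>. norm \<nu> = 1 \<and> smooth \<gamma> \<and>
     \<Omega> \<inter> ball x\<^sub>0 r = {x \<in> ball x\<^sub>0 r. x \<bullet> \<nu> > \<gamma> (x - (x \<bullet> \<nu>) *\<^sub>R \<nu>)})"

definition bounded_smooth_domain :: "'a::euclidean_space set \<Rightarrow> bool" where
  "bounded_smooth_domain \<Omega> \<longleftrightarrow>
     \<Omega> \<noteq> {} \<and> open \<Omega> \<and> connected \<Omega> \<and> bounded \<Omega> \<and> smooth_boundary \<Omega>"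

definition strictly_convex_on :: "'a::real_vector set \<Rightarrow> ('a \<Rightarrow> real) \<Rightarrow> bool" where
  "strictly_convex_on S f \<longleftrightarrow> convex S \<and> (\<forall>x\<in>S. \<forall>y\<in>S. \<forall>t. x \<noteq> y \<and> 0 < t \<and> t < 1 \<longrightarrow>
     f ((1 - t) *\<^sub>R x + t *\<^sub>R y) < (1 - t) * f x + t * f y)"

definition holder_continuous_on :: "real \<Rightarrow> 'a::metric_space set \<Rightarrow> ('a \<Rightarrow> real) \<Rightarrow> bool" where
  "holder_continuous_on \<beta> S f \<longleftrightarrow>
     (\<exists>C. \<forall>x\<in>S. \<forall>y\<in>S. \<bar>f x - f y\<bar> \<le> C * dist x y powr \<beta>)"

section \<open>Sobolev functions\<close>

definition Lp_on :: "real \<Rightarrow> 'a measure \<Rightarrow> ('a \<Rightarrow> 'b::euclidean_space) \<Rightarrow> bool" where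
  "Lp_on p M f \<longleftrightarrow> f \<in> borel_measurable M \<and> integrable M (\<lambda>x. norm (f x) powr p)"

definition Lp_tendsto :: "real \<Rightarrow> 'a measure \<Rightarrow> (nat \<Rightarrow> 'a \<Rightarrow> 'b::euclidean_space) \<Rightarrow> ('a \<Rightarrow> 'b) \<Rightarrow> bool" where
  "Lp_tendsto p M w f \<longleftrightarrow> (\<lambda>k. \<integral>\<^sup>+x. ennreal (norm (w k x - f x) powr p) \<partial>M) \<longlonglongrightarrow> 0"

definition locally_integrable :: "'a::euclidean_space set \<Rightarrow> ('a \<Rightarrow> 'b::euclidean_space) \<Rightarrow> bool" where
  "locally_integrable \<Omega> f \<longleftrightarrow> f \<in> borel_measurable (lebesgue_on \<Omega>) \<and>
     (\<forall>K. compact K \<and> K \<subseteq> \<Omega> \<longrightarrow> integrable (lebesgue_on K) f)"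

definition has_weak_gradient :: "'a::euclidean_space set \<Rightarrow> ('a \<Rightarrow> real) \<Rightarrow> ('a \<Rightarrow> 'a) \<Rightarrow> bool" where
  "has_weak_gradient \<Omega> u V \<longleftrightarrow> locally_integrable \<Omega> u \<and> locally_integrable \<Omega> V \<and>
     (\<forall>\<psi> \<in> test_functions \<Omega>. \<forall>b\<in>Basis.
        (LINT x|lebesgue_on \<Omega>. u x * (gradient \<psi> x \<bullet> b)) = - (LINT x|lebesgue_on \<Omega>. (V x \<bullet> b) * \<psi> x))"

text \<open>Unique up to a null set on open \<open>\<Omega>\<close>, so integrals of it do not depend on the choice.\<close>

definition weak_gradient :: "'a::euclidean_space set \<Rightarrow> ('a \<Rightarrow> real) \<Rightarrow> 'a \<Rightarrow> 'a" where
  "weak_gradient \<Omega> u = (SOME V. has_weak_gradient \<Omega> u V)"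

definition W1p :: "'a::euclidean_space set \<Rightarrow> real \<Rightarrow> ('a \<Rightarrow> real) set" where
  "W1p \<Omega> p = {u. Lp_on p (lebesgue_on \<Omega>) u \<and>
     (\<exists>V. has_weak_gradient \<Omega> u V \<and> Lp_on p (lebesgue_on \<Omega>) V)}"

section \<open>Traces\<close>

text \<open>The \<open>d\<close>-dimensional Hausdorff (outer) measure, for \<open>d \<ge> 1\<close>, normalised so that it agrees
  with \<open>d\<close>-dimensional volume. It is a metric outer measure, hence countably additive on Borel sets.\<close>

definition hausdorff_outer :: "nat \<Rightarrow> 'a::euclidean_space set \<Rightarrow> ennreal" where
  "hausdorff_outer d A = (SUP \<delta>\<in>{0<..}.
     INF C\<in>{C :: nat \<Rightarrow> 'a set. A \<subseteq> (\<Union>i. C i) \<and> (\<forall>i. bounded (C i) \<and> diameter (C i) \<le> \<delta>)}.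
       (\<Sum>i. ennreal (unit_ball_vol (real d) * (diameter (C i) / 2) ^ d)))"

definition surface_measure :: "'a::euclidean_space set \<Rightarrow> 'a measure" where
  "surface_measure \<Omega> =
     restrict_space (measure_of UNIV (sets borel) (hausdorff_outer (DIM('a) - 1))) (frontier \<Omega>)"

text \<open>The trace of \<open>u\<close> is the limit in \<open>L\<^sup>p(\<partial>\<Omega>)\<close> of the boundary values of smooth functions
  (up to the boundary) approximating \<open>u\<close> in \<open>W\<^sup>1\<^sup>,\<^sup>p(\<Omega>)\<close>. On a bounded smooth domain every \<open>u\<close>
  in \<open>W\<^sup>1\<^sup>,\<^sup>p(\<Omega>)\<close> has exactly one trace, up to null sets, by the trace theorem.\<close>

definition has_trace :: "'a::euclidean_space set \<Rightarrow> real \<Rightarrow> ('a \<Rightarrow> real) \<Rightarrow> ('a \<Rightarrow> real) \<Rightarrow> bool" where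
  "has_trace \<Omega> p u h \<longleftrightarrow> Lp_on p (surface_measure \<Omega>) h \<and>
     (\<exists>w :: nat \<Rightarrow> 'a \<Rightarrow> real. (\<forall>k. smooth (w k)) \<and>
        Lp_tendsto p (lebesgue_on \<Omega>) w u \<and>
        Lp_tendsto p (lebesgue_on \<Omega>) (\<lambda>k. gradient (w k)) (weak_gradient \<Omega> u) \<and>
        Lp_tendsto p (surface_measure \<Omega>) w h)"

definition W1p_bdry :: "'a::euclidean_space set \<Rightarrow> real \<Rightarrow> ('a \<Rightarrow> real) \<Rightarrow> ('a \<Rightarrow> real) set" where
  "W1p_bdry \<Omega> p \<phi> = {v \<in> W1p \<Omega> p. \<exists>h. has_trace \<Omega> p \<phi> h \<and> has_trace \<Omega> p v h}"

section \<open>The functional and its minimizers\<close>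

definition energy :: "'a::euclidean_space set \<Rightarrow> ('a \<Rightarrow> real \<Rightarrow> 'a \<Rightarrow> real) \<Rightarrow> ('a \<Rightarrow> real) \<Rightarrow> real" where
  "energy \<Omega> F v = (LINT X|lebesgue_on \<Omega>. F X (v X) (weak_gradient \<Omega> v X))"

definition is_minimizer ::
  "'a::euclidean_space set \<Rightarrow> real \<Rightarrow> ('a \<Rightarrow> real) \<Rightarrow> ('a \<Rightarrow> real \<Rightarrow> 'a \<Rightarrow> real) \<Rightarrow> ('a \<Rightarrow> real) \<Rightarrow> bool" where
  "is_minimizer \<Omega> p \<phi> F u \<longleftrightarrow>
     u \<in> W1p_bdry \<Omega> p \<phi> \<and> (\<forall>v \<in> W1p_bdry \<Omega> p \<phi>. energy \<Omega> F u \<le> energy \<Omega> F v)"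

section \<open>Distributions and Radon measures\<close>

definition distr_of_fun :: "'a::euclidean_space set \<Rightarrow> ('a \<Rightarrow> real) \<Rightarrow> ('a \<Rightarrow> real) \<Rightarrow> real" where
  "distr_of_fun \<Omega> h \<psi> = (LINT X|lebesgue_on \<Omega>. h X * \<psi> X)"

definition distr_div :: "'a::euclidean_space set \<Rightarrow> ('a \<Rightarrow> 'a) \<Rightarrow> ('a \<Rightarrow> real) \<Rightarrow> real" where
  "distr_div \<Omega> V \<psi> = - (LINT X|lebesgue_on \<Omega>. V X \<bullet> gradient \<psi> X)"

definition distr_nonneg :: "'a::euclidean_space set \<Rightarrow> (('a \<Rightarrow> real) \<Rightarrow> real) \<Rightarrow> bool" where
  "distr_nonneg \<Omega> T \<longleftrightarrow> (\<forall>\<psi> \<in> test_functions \<Omega>. (\<forall>x. 0 \<le> \<psi> x) \<longrightarrow> 0 \<le> T \<psi>)"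

definition radon_measure_on :: "'a::euclidean_space set \<Rightarrow> 'a measure \<Rightarrow> bool" where
  "radon_measure_on \<Omega> \<mu> \<longleftrightarrow> space \<mu> = \<Omega> \<and> sets \<mu> = sets (restrict_space borel \<Omega>) \<and>
     (\<forall>K. compact K \<and> K \<subseteq> \<Omega> \<longrightarrow> emeasure \<mu> K < \<infinity>) \<and>
     (\<forall>B \<in> sets \<mu>. emeasure \<mu> B = (SUP K\<in>{K. compact K \<and> K \<subseteq> B}. emeasure \<mu> K))"

definition distr_is_measure :: "'a::euclidean_space set \<Rightarrow> (('a \<Rightarrow> real) \<Rightarrow> real) \<Rightarrow> 'a measure \<Rightarrow> bool" where
  "distr_is_measure \<Omega> T \<mu> \<longleftrightarrow> (\<forall>\<psi> \<in> test_functions \<Omega>. T \<psi> = (LINT X|\<mu>. \<psi> X))"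

definition measure_support :: "'a::topological_space measure \<Rightarrow> 'a set" where
  "measure_support \<mu> = {x \<in> space \<mu>. \<forall>U. open U \<and> x \<in> U \<longrightarrow> emeasure \<mu> (U \<inter> space \<mu>) > 0}"

end

theory Submission
  imports Defs
begin

text \<open>
  The sign of the distribution comes from pushing the minimizer down. Let \<open>\<psi> \<ge> 0\<close> be a test
  function and \<open>s > 0\<close>. Replacing \<open>u\<close> by \<open>u - s * \<psi>\<close> keeps the trace, can only shrink the set
  where \<open>Q\<close> is paid, and changes the remaining part of the energy by
  \<open>s * (- \<integral> \<A> \<bullet> \<nabla>\<psi> - \<integral> m * f * u\<^sup>m\<^sup>-\<^sup>1 * \<psi>)\<close> to first order, with the last integral over
  \<open>{u > 0}\<close>. This is \<open>s * \<Lambda> \<psi>\<close>, and minimality makes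
  it nonnegative. The same computation gives \<open>variational_inequality\<close> for every direction
  \<open>\<psi> * \<theta>(u)\<close> that does not make nonpositive values of \<open>u\<close> positive.

  A nonnegative distribution is a Radon measure, by a Riesz construction carried out directly on
  test functions (\<open>positive_distribution_representation\<close>). The infimum of \<open>\<Sum>i. T \<psi>\<^sub>i\<close> over the
  sequences of nonnegative test functions whose sum dominates a function is an upper integral whose
  countable subadditivity costs nothing. Balls are measurable for the resulting outer measure
  because their indicators are increasing limits of test functions. A Dini argument shows that
  the upper integral agrees with \<open>T\<close> on nonnegative test functions. Uniqueness uses the same
  approximation of indicators of finite intersections of balls.

  For the support it is enough that \<open>\<Lambda> \<psi> \<le> 0\<close> for nonnegative \<open>\<psi>\<close> supported in \<open>{u > 0}\<close> or in the
  interior of \<open>{u \<le> 0}\<close>. In the first case \<open>u + s * \<psi>\<close> pays no additional \<open>Q\<close>. In the second case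
  the competitor has to stay nonpositive, so the direction is \<open>\<psi> * \<theta>(u)\<close> with
  \<open>\<theta>(u) = u\<^sup>2 / (u\<^sup>2 + d\<^sup>2)\<close>, which vanishes to second order where \<open>u = 0\<close>. The term
  \<open>\<psi> * \<theta>'(u) * (\<A> \<bullet> \<nabla>u)\<close> is nonpositive because \<open>\<A> \<bullet> \<nabla>u \<ge> 0\<close> by convexity and \<open>\<theta>'\<close> is nonpositive
  on nonpositive numbers. As \<open>d\<close> tends to \<open>0\<close>, \<open>\<theta>(u)\<close> tends to \<open>1\<close> off \<open>{u = 0}\<close>, and \<open>\<nabla>u = 0\<close> almost
  everywhere on \<open>{u = 0}\<close>.

  The approximating sequence of smooth functions that comes with the trace of \<open>u\<close> makes these
  competitors admissible: \<open>w\<^sub>k + s * \<psi> * \<theta>(w\<^sub>k)\<close> is smooth, has the boundary values of \<open>w\<^sub>k\<close>, and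
  converges to \<open>u + s * \<psi> * \<theta>(u)\<close> in \<open>W\<^sup>1\<^sup>,\<^sup>p\<close>, which also yields the product and chain rules for weak
  gradients (\<open>W1p_bdry_perturbation\<close>).
\<close>

section \<open>Calculus of smooth functions\<close>

lemma C_k_Suc_imp: "C_k (Suc k) f \<Longrightarrow> C_k k f"
proof (induction k arbitrary: f)
  case 0
  then show ?case
    by (auto simp: continuous_on_eq_continuous_at intro: differentiable_imp_continuous_within)
next
  case (Suc k)
  then show ?case by (metis C_k.simps(2))
qed

lemma C_k_continuous: "C_k k f \<Longrightarrow> continuous_on UNIV f"
proof (induction k)
  case (Suc k)
  then show ?case using C_k_Suc_imp by blast
qed simp

lemma C_k_SucI:
  assumes "\<And>x. (f has_derivative f' x) (at x)" "\<And>h. C_k k (\<lambda>x. f' x h)"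
  shows "C_k (Suc k) f"
proof -
  have "frechet_derivative f (at x) = f' x" for x
    using assms(1)[of x] by (simp add: frechet_derivative_at[symmetric])
  then show ?thesis using assms by (auto simp: differentiable_def)
qed

lemma C_k_Suc_derivative:
  assumes "C_k (Suc k) f"
  shows "(f has_derivative frechet_derivative f (at x)) (at x)"
  using assms by (simp add: frechet_derivative_works)

lemma C_k_const: "C_k k (\<lambda>x. c)"
proof (induction k arbitrary: c)
  case (Suc k)
  show ?case by (rule C_k_SucI[where f'="\<lambda>x h. 0"]) (auto intro: Suc)
qed simp

lemma C_k_inner: "C_k k (\<lambda>x. x \<bullet> a)"
proof (cases k)
  case 0 then show ?thesis by (auto intro: continuous_intros)
next
  case (Suc j)
  show ?thesis unfolding Suc
    by (rule C_k_SucI[where f'="\<lambda>x h. h \<bullet> a"]) (auto intro!: derivative_eq_intros C_k_const)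
qed

lemma C_k_add: "C_k k f \<Longrightarrow> C_k k g \<Longrightarrow> C_k k (\<lambda>x. f x + g x)"
proof (induction k arbitrary: f g)
  case 0 then show ?case by (auto intro: continuous_intros)
next
  case (Suc k)
  show ?case
    by (rule C_k_SucI, rule has_derivative_add[OF C_k_Suc_derivative[OF Suc.prems(1)] C_k_Suc_derivative[OF Suc.prems(2)]])
      (use Suc in auto)
qed

lemma C_k_mult: "C_k k f \<Longrightarrow> C_k k g \<Longrightarrow> C_k k (\<lambda>x. f x * g x)"
proof (induction k arbitrary: f g)
  case 0 then show ?case by (auto intro: continuous_intros)
next
  case (Suc k)
  show ?case
    by (rule C_k_SucI, rule has_derivative_mult[OF C_k_Suc_derivative[OF Suc.prems(1)] C_k_Suc_derivative[OF Suc.prems(2)]])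
      (intro C_k_add Suc.IH C_k_Suc_imp[OF Suc.prems(1)] C_k_Suc_imp[OF Suc.prems(2)], use Suc.prems in auto)
qed

lemma C_k_inverse: "C_k k f \<Longrightarrow> (\<And>x. f x \<noteq> 0) \<Longrightarrow> C_k k (\<lambda>x. inverse (f x))"
proof (induction k arbitrary: f)
  case 0 then show ?case by (auto intro: continuous_intros)
next
  case (Suc k)
  have 1: "C_k k (\<lambda>x. inverse (f x))" using Suc C_k_Suc_imp by blast
  have "C_k k (\<lambda>x. (-1) * (inverse (f x) * frechet_derivative f (at x) h * inverse (f x)))" for h
    by (intro C_k_mult C_k_const 1) (use Suc.prems in auto)
  then have 2: "C_k k (\<lambda>x. - (inverse (f x) * frechet_derivative f (at x) h * inverse (f x)))" for h by simp
  show ?case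
    by (rule C_k_SucI, rule Deriv.has_derivative_inverse[OF Suc.prems(2) C_k_Suc_derivative[OF Suc.prems(1)]]) (rule 2)
qed

lemma C_k_compose:
  fixes \<theta> :: "real \<Rightarrow> real"
  shows "C_k k \<theta> \<Longrightarrow> C_k k f \<Longrightarrow> C_k k (\<lambda>x. \<theta> (f x))"
proof (induction k arbitrary: \<theta> f)
  case 0 then show ?case using continuous_on_compose2[of UNIV \<theta> UNIV f] by simp
next
  case (Suc k)
  have lin: "frechet_derivative \<theta> (at s) h = h * frechet_derivative \<theta> (at s) 1" for s h
    using linear_cmul[OF has_derivative_linear[OF C_k_Suc_derivative[OF Suc.prems(1)]], of s h 1] by simp
  show ?case
  proof (rule C_k_SucI)
    show "((\<lambda>x. \<theta> (f x)) has_derivative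
       (\<lambda>h. frechet_derivative \<theta> (at (f x)) (frechet_derivative f (at x) h))) (at x)" for x
      using has_derivative_compose[OF C_k_Suc_derivative[OF Suc.prems(2)] C_k_Suc_derivative[OF Suc.prems(1)]] .
    fix h
    have "C_k k (\<lambda>x. frechet_derivative f (at x) h * frechet_derivative \<theta> (at (f x)) 1)"
      using Suc.prems Suc.IH[of "\<lambda>s. frechet_derivative \<theta> (at s) 1" f] C_k_Suc_imp[OF Suc.prems(2)]
      by (intro C_k_mult) auto
    then show "C_k k (\<lambda>x. frechet_derivative \<theta> (at (f x)) (frechet_derivative f (at x) h))"
      by (subst lin)
  qed
qed

lemma smooth_const: "smooth (\<lambda>x. c)"
  and smooth_inner: "smooth (\<lambda>x. x \<bullet> a)"
  and smooth_add: "smooth f \<Longrightarrow> smooth g \<Longrightarrow> smooth (\<lambda>x. f x + g x)"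
  and smooth_mult: "smooth f \<Longrightarrow> smooth g \<Longrightarrow> smooth (\<lambda>x. f x * g x)"
  and smooth_inverse: "smooth f \<Longrightarrow> (\<And>x. f x \<noteq> 0) \<Longrightarrow> smooth (\<lambda>x. inverse (f x))"
  and smooth_compose: "smooth \<theta> \<Longrightarrow> smooth f \<Longrightarrow> smooth (\<lambda>x. \<theta> (f x))"
  by (auto simp: smooth_def intro: C_k_const C_k_inner C_k_add C_k_mult C_k_inverse C_k_compose)

lemma smooth_cmult: "smooth f \<Longrightarrow> smooth (\<lambda>x. c * f x)"
  by (intro smooth_mult smooth_const)

lemma smooth_diff: "smooth f \<Longrightarrow> smooth g \<Longrightarrow> smooth (\<lambda>x. f x - g x)"
  using smooth_add[of f "\<lambda>x. (-1) * g x"] smooth_cmult[of g "-1"] by simp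

lemma smooth_power: "smooth f \<Longrightarrow> smooth (\<lambda>x. f x ^ n)"
  by (induction n) (auto intro: smooth_const smooth_mult)

lemma smooth_sum: "(\<And>i. i \<in> I \<Longrightarrow> smooth (f i)) \<Longrightarrow> smooth (\<lambda>x. \<Sum>i\<in>I. f i x)"
  by (induction I rule: infinite_finite_induct) (auto intro: smooth_const smooth_add)

lemma smooth_prod: "(\<And>i. i \<in> I \<Longrightarrow> smooth (f i)) \<Longrightarrow> smooth (\<lambda>x. \<Prod>i\<in>I. f i x)"
  by (induction I rule: infinite_finite_induct) (auto intro: smooth_const smooth_mult)

lemma smooth_continuous: "smooth f \<Longrightarrow> continuous_on UNIV f"
  unfolding smooth_def using C_k_continuous by blast

lemma smooth_borel: "smooth f \<Longrightarrow> f \<in> borel_measurable borel"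
  by (intro borel_measurable_continuous_onI smooth_continuous)

lemma smooth_has_derivative: "smooth f \<Longrightarrow> (f has_derivative frechet_derivative f (at x)) (at x)"
  unfolding smooth_def using C_k_Suc_derivative by blast

lemma smooth_frechet: "smooth f \<Longrightarrow> smooth (\<lambda>x. frechet_derivative f (at x) h)"
  unfolding smooth_def by (metis C_k.simps(2))

lemma gradient_eqI: "GDERIV f x :> D \<Longrightarrow> gradient f x = D"
  unfolding gradient_def gderiv_def
proof (rule the_equality)
  fix D' assume D: "(f has_derivative (\<lambda>h. h \<bullet> D)) (at x)" and "(f has_derivative (\<lambda>h. h \<bullet> D')) (at x)"
  then have "(\<lambda>h. h \<bullet> D') = (\<lambda>h. h \<bullet> D)" using has_derivative_unique by blast
  then show "D' = D" by (metis vector_eq_ldot inner_commute)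
qed

lemma gradient_differentiable:
  fixes f :: "'a::euclidean_space \<Rightarrow> real"
  assumes "f differentiable (at x)" shows "GDERIV f x :> gradient f x"
proof -
  let ?D = "frechet_derivative f (at x)" 
  have d: "(f has_derivative ?D) (at x)" using assms by (simp add: frechet_derivative_works)
  let ?g = "\<Sum>b\<in>Basis. ?D b *\<^sub>R b"
  have "?D h = h \<bullet> ?g" for h
  proof -
    have "?D h = (\<Sum>b\<in>Basis. (h \<bullet> b) *\<^sub>R ?D b)"
      using Linear_Algebra.linear_componentwise[OF has_derivative_linear[OF d], of h 1] by simp
    then show ?thesis by (simp add: inner_sum_right mult.commute)
  qed
  then have "GDERIV f x :> ?g" using d unfolding gderiv_def by (metis (no_types, lifting) ext)
  then show ?thesis using gradient_eqI by metis
qed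

lemma gradient_smooth:
  assumes "smooth f" shows "GDERIV f x :> gradient f x"
    "gradient f x \<bullet> h = frechet_derivative f (at x) h"
proof -
  have "f differentiable (at x)" using smooth_has_derivative[OF assms] differentiable_def by blast
  then show g: "GDERIV f x :> gradient f x" by (rule gradient_differentiable)
  have "(\<lambda>h. h \<bullet> gradient f x) = frechet_derivative f (at x)"
    using g smooth_has_derivative[OF assms] unfolding gderiv_def by (rule has_derivative_unique)
  then show "gradient f x \<bullet> h = frechet_derivative f (at x) h" by (metis inner_commute)
qed

lemma smooth_gradient_component: "smooth f \<Longrightarrow> smooth (\<lambda>x. gradient f x \<bullet> h)"
  by (simp add: gradient_smooth smooth_frechet)

lemma continuous_gradient: "smooth f \<Longrightarrow> continuous_on UNIV (gradient f)"
  by (subst continuous_on_componentwise) (auto intro: smooth_continuous smooth_gradient_component)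

lemma gradient_borel: "smooth f \<Longrightarrow> gradient f \<in> borel_measurable borel"
  by (intro borel_measurable_continuous_onI continuous_gradient)

lemma gradient_add: "smooth f \<Longrightarrow> smooth g \<Longrightarrow> gradient (\<lambda>x. f x + g x) x = gradient f x + gradient g x"
  by (intro gradient_eqI GDERIV_add gradient_smooth)

lemma gradient_mult: "smooth f \<Longrightarrow> smooth g \<Longrightarrow>
  gradient (\<lambda>x. f x * g x) x = f x *\<^sub>R gradient g x + g x *\<^sub>R gradient f x"
  by (intro gradient_eqI GDERIV_mult gradient_smooth)

lemma gradient_const: "gradient (\<lambda>x. c) x = 0"
  by (intro gradient_eqI GDERIV_const)

lemma gradient_cmult: "smooth f \<Longrightarrow> gradient (\<lambda>x. c * f x) x = c *\<^sub>R gradient f x"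
  by (simp add: gradient_mult smooth_const gradient_const)

lemma gradient_compose:
  fixes \<theta> :: "real \<Rightarrow> real"
  assumes "smooth f" "\<And>s. (\<theta> has_field_derivative \<theta>' s) (at s)"
  shows "gradient (\<lambda>x. \<theta> (f x)) x = \<theta>' (f x) *\<^sub>R gradient f x"
  by (intro gradient_eqI GDERIV_DERIV_compose gradient_smooth assms)

text \<open>The derivatives of \<open>exp (- 1 / s)\<close> are linear combinations of these functions, so the
  whole family is shown to be smooth at once.\<close>

definition flat :: "nat \<Rightarrow> real \<Rightarrow> real" where
  "flat k s = (if s > 0 then exp (- (1 / s)) / s ^ k else 0)"

text \<open>Applied with \<open>k + 1\<close> in place of \<open>k\<close>, this is the limit of the difference quotient of
  \<open>flat k\<close> at \<open>0\<close>.\<close>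

lemma flat_tendsto_0: "((\<lambda>s. flat k s) \<longlongrightarrow> 0) (at_right 0)"
proof -
  have "((\<lambda>x::real. x ^ k / exp x) \<longlongrightarrow> 0) at_top" by (rule tendsto_power_div_exp_0)
  then have "((\<lambda>s::real. inverse s ^ k / exp (inverse s)) \<longlongrightarrow> 0) (at_right 0)"
    using filterlim_compose filterlim_inverse_at_top_right by blast
  then show ?thesis
    by (rule Lim_transform_eventually)
      (auto simp: eventually_at flat_def exp_minus field_simps power_one_over intro!: exI[of _ 1])
qed

lemma flat_has_derivative:
  "(flat k has_field_derivative flat (k + 2) s - real k * flat (k + 1) s) (at s)"
proof -
  consider "s > 0" | "s < 0" | "s = 0" by linarith
  then show ?thesis
  proof cases
    case 1
    have "((\<lambda>s. exp (- (1 / s)) / s ^ k) has_field_derivative flat (k + 2) s - real k * flat (k + 1) s) (at s)"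
    proof -
      have "((\<lambda>s. exp (- inverse s) * inverse s ^ k) has_field_derivative
          exp (- inverse s) * inverse s ^ (k + 2) - real k * (exp (- inverse s) * inverse s ^ (k + 1))) (at s)"
      proof -
        have inv: "(inverse has_field_derivative - (inverse s ^ 2)) (at s)"
          using 1 DERIV_inverse[of s UNIV] by (simp add: numeral_2_eq_2)
        have e: "((\<lambda>s. exp (- inverse s)) has_field_derivative exp (- inverse s) * - (- (inverse s ^ 2))) (at s)"
          by (intro DERIV_fun_exp DERIV_minus inv)
        show ?thesis
          by (rule DERIV_cong[OF DERIV_mult[OF e DERIV_power[OF inv]]])
            (cases k; simp add: algebra_simps power2_eq_square)
      qed
      then show ?thesis using 1 by (simp add: flat_def divide_inverse power_inverse)
    qed
    moreover have "eventually (\<lambda>t. t \<in> {0<..}) (nhds s)" using 1 by (intro eventually_nhds_in_open) auto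
    ultimately show ?thesis
      by (subst DERIV_cong_ev[OF refl _ refl, where g="\<lambda>s. exp (- (1 / s)) / s ^ k"])
        (auto elim!: eventually_mono simp: flat_def)
  next
    case 2
    moreover have "eventually (\<lambda>t. t \<in> {..<0}) (nhds s)" using 2 by (intro eventually_nhds_in_open) auto
    ultimately show ?thesis
      by (subst DERIV_cong_ev[OF refl _ refl, where g="\<lambda>s. 0"])
        (auto elim!: eventually_mono simp: flat_def)
  next
    case 3
    have "((\<lambda>h. flat k h / h) \<longlongrightarrow> 0) (at 0)"
    proof (subst filterlim_at_split, intro conjI)
      show "((\<lambda>h. flat k h / h) \<longlongrightarrow> 0) (at_left 0)"
        by (rule Lim_transform_eventually[OF tendsto_const]) (auto simp: eventually_at flat_def intro!: exI[of _ 1])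
      show "((\<lambda>h. flat k h / h) \<longlongrightarrow> 0) (at_right 0)"
        by (rule Lim_transform_eventually[OF flat_tendsto_0[of "Suc k"]]) 
          (auto simp: eventually_at flat_def field_simps intro!: exI[of _ 1])
    qed
    then show ?thesis using 3 by (simp add: DERIV_def flat_def)
  qed
qed

lemma smooth_flat: "smooth (flat k)"
proof -
  have "C_k j (flat k)" for j
  proof (induction j arbitrary: k)
    case 0
    show ?case using flat_has_derivative by (auto simp: continuous_on_eq_continuous_at intro: DERIV_isCont)
  next
    case (Suc j)
    show ?case
    proof (rule C_k_SucI)
      show "(flat k has_derivative (*) (flat (k + 2) s - real k * flat (k + 1) s)) (at s)" for s
        using flat_has_derivative[of k s] unfolding has_field_derivative_def .
      fix h
      have "C_k j (\<lambda>s. (flat (k + 2) s + (- real k) * flat (k + 1) s) * h)"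
        by (intro C_k_mult C_k_add C_k_const Suc)
      then show "C_k j (\<lambda>s. (flat (k + 2) s - real k * flat (k + 1) s) * h)" by simp
    qed
  qed
  then show ?thesis unfolding smooth_def by blast
qed

text \<open>Values stay strictly below \<open>1\<close>, so that powers of \<open>1 - bump c r\<close> tend to \<open>0\<close> exactly on
  the ball.\<close>

definition bump :: "'a::euclidean_space \<Rightarrow> real \<Rightarrow> 'a \<Rightarrow> real" where
  "bump c r x = flat 0 (r\<^sup>2 - (norm (x - c))\<^sup>2)"

lemma smooth_bump: "smooth (bump c r)"
proof -
  have "(norm (x - c))\<^sup>2 = (\<Sum>b\<in>Basis. (x \<bullet> b - c \<bullet> b)\<^sup>2)" for x
    unfolding power2_norm_eq_inner
    by (subst euclidean_inner) (simp add: inner_diff_left power2_eq_square)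
  then have "bump c r = (\<lambda>x. flat 0 (r\<^sup>2 - (\<Sum>b\<in>Basis. (x \<bullet> b - c \<bullet> b)\<^sup>2)))"
    unfolding bump_def by presburger
  then show ?thesis
    by (auto intro!: smooth_compose[OF smooth_flat] smooth_diff smooth_const smooth_sum smooth_power smooth_inner)
qed

lemma bump_bounds: "0 \<le> bump c r x" "bump c r x < 1"
  by (auto simp: bump_def flat_def)

lemma bump_pos_iff:
  assumes "0 < r" shows "0 < bump c r x \<longleftrightarrow> x \<in> ball c r"
proof -
  have "0 < bump c r x \<longleftrightarrow> (norm (x - c))\<^sup>2 < r\<^sup>2" by (simp add: bump_def flat_def)
  also have "\<dots> \<longleftrightarrow> norm (x - c) < r"
  proof -
    have "r \<le> norm (x - c) \<longleftrightarrow> r\<^sup>2 \<le> (norm (x - c))\<^sup>2"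
      using assms abs_le_square_iff[of r "norm (x - c)"] by (metis abs_norm_cancel abs_of_pos)
    then show ?thesis by (meson not_le)
  qed
  also have "\<dots> \<longleftrightarrow> x \<in> ball c r" unfolding mem_ball dist_norm norm_minus_commute[of x c] ..
  finally show ?thesis .
qed

section \<open>Test functions and integration by parts\<close>

lemma test_functionI:
  assumes "smooth \<psi>" "compact C" "C \<subseteq> \<Omega>" "\<And>x. x \<notin> C \<Longrightarrow> \<psi> x = 0"
  shows "\<psi> \<in> test_functions \<Omega>"
proof -
  have "closure {x. \<psi> x \<noteq> 0} \<subseteq> C"
    using assms by (intro closure_minimal compact_imp_closed) auto
  moreover have "closure {x. \<psi> x \<noteq> 0} = C \<inter> closure {x. \<psi> x \<noteq> 0}" using calculation by (rule inf_absorb2[symmetric])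
  then have "compact (closure {x. \<psi> x \<noteq> 0})"
    using compact_Int_closed[OF assms(2) closed_closure, of "{x. \<psi> x \<noteq> 0}"] by argo
  ultimately show ?thesis using assms(1,3) unfolding test_functions_def by simp
qed

lemma test_functionE:
  assumes "\<psi> \<in> test_functions \<Omega>"
  obtains C B where "smooth \<psi>" "compact C" "C \<subseteq> \<Omega>" "\<And>x. x \<notin> C \<Longrightarrow> \<psi> x = 0"
    "\<And>x. x \<notin> C \<Longrightarrow> gradient \<psi> x = 0" "0 \<le> B" "\<And>x. \<bar>\<psi> x\<bar> \<le> B" "\<And>x. norm (gradient \<psi> x) \<le> B"
proof -
  define C where "C = closure {x. \<psi> x \<noteq> 0}"
  have C: "compact C" "C \<subseteq> \<Omega>" and s: "smooth \<psi>" using assms by (auto simp: test_functions_def C_def)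
  have z: "\<psi> x = 0" if "x \<notin> C" for x
    using that closure_subset[of "{x. \<psi> x \<noteq> 0}"] unfolding C_def by blast
  have gz: "gradient \<psi> x = 0" if "x \<notin> C" for x
  proof (rule gradient_eqI)
    have "eventually (\<lambda>y. y \<in> - C) (nhds x)"
      using that C(1) by (intro eventually_nhds_in_open) (auto simp: compact_imp_closed open_Compl)
    then have ev: "eventually (\<lambda>y. 0 = \<psi> y) (at x)"
      by (auto simp: eventually_at_filter elim!: eventually_mono dest: z)
    have "((\<lambda>y. 0::real) has_derivative (\<lambda>h. h \<bullet> 0)) (at x)" by simp
    from has_derivative_transform_eventually[OF this ev] show "GDERIV \<psi> x :> 0"
      using z[OF that] by (simp add: gderiv_def)
  qed
  have "bounded (\<psi> ` C)" "bounded (gradient \<psi> ` C)"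
    using s C(1) by (auto intro!: compact_imp_bounded compact_continuous_image
        continuous_on_subset[OF smooth_continuous] continuous_on_subset[OF continuous_gradient])
  then obtain B1 B2 where B: "\<And>x. x \<in> C \<Longrightarrow> norm (\<psi> x) \<le> B1" "\<And>x. x \<in> C \<Longrightarrow> norm (gradient \<psi> x) \<le> B2"
    unfolding bounded_iff by blast
  have "\<bar>\<psi> x\<bar> \<le> max 0 (max B1 B2)" "norm (gradient \<psi> x) \<le> max 0 (max B1 B2)" for x
    using B[of x] z[of x] gz[of x] by (cases "x \<in> C"; force)+
  then show ?thesis using that[of C "max 0 (max B1 B2)"] s C z gz by simp
qed

lemma test_add: "\<psi> \<in> test_functions \<Omega> \<Longrightarrow> \<eta> \<in> test_functions \<Omega> \<Longrightarrow> (\<lambda>x. \<psi> x + \<eta> x) \<in> test_functions \<Omega>"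
  apply (elim test_functionE)
  subgoal for C B C' B' by (rule test_functionI[where C="C \<union> C'"]) (auto intro: smooth_add)
  done

lemma test_smooth: "\<psi> \<in> test_functions \<Omega> \<Longrightarrow> smooth \<psi>"
  by (simp add: test_functions_def)

lemma test_mult: "\<psi> \<in> test_functions \<Omega> \<Longrightarrow> smooth f \<Longrightarrow> (\<lambda>x. f x * \<psi> x) \<in> test_functions \<Omega>"
  apply (elim test_functionE)
  subgoal for C B by (rule test_functionI[where C="C"]) (auto intro: smooth_mult)
  done

lemma test_cmult: "\<psi> \<in> test_functions \<Omega> \<Longrightarrow> (\<lambda>x. c * \<psi> x) \<in> test_functions \<Omega>"
  by (intro test_mult smooth_const)

lemma test_zero: "(\<lambda>x. 0) \<in> test_functions \<Omega>"
  by (rule test_functionI[where C="{}"]) (auto intro: smooth_const)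

lemma test_diff: "\<psi> \<in> test_functions \<Omega> \<Longrightarrow> \<eta> \<in> test_functions \<Omega> \<Longrightarrow> (\<lambda>x. \<psi> x - \<eta> x) \<in> test_functions \<Omega>"
  using test_add[of \<psi> \<Omega> "\<lambda>x. (-1) * \<eta> x"] test_cmult[of \<eta> \<Omega> "-1"] by simp

lemma test_sum: "(\<And>i. i \<in> I \<Longrightarrow> f i \<in> test_functions \<Omega>) \<Longrightarrow> (\<lambda>x. \<Sum>i\<in>I. f i x) \<in> test_functions \<Omega>"
  by (induction I rule: infinite_finite_induct) (auto intro: test_zero test_add)

lemma test_off: "\<psi> \<in> test_functions \<Omega> \<Longrightarrow> x \<notin> \<Omega> \<Longrightarrow> \<psi> x = 0"
  by (elim test_functionE) auto

lemma test_mono: "\<psi> \<in> test_functions U \<Longrightarrow> U \<subseteq> \<Omega> \<Longrightarrow> \<psi> \<in> test_functions \<Omega>"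
  by (auto simp: test_functions_def)

lemma bump_test: "0 < r \<Longrightarrow> cball c r \<subseteq> \<Omega> \<Longrightarrow> bump c r \<in> test_functions \<Omega>"
proof (rule test_functionI[where C="cball c r"])
  fix x assume "0 < r" "x \<notin> cball c r"
  then show "bump c r x = 0" using bump_pos_iff[of r c x] bump_bounds(1)[of c r x] by force
qed (auto intro: smooth_bump)

text \<open>Sums of bumps replace exact cutoff functions: dominating a compact set is all that the
  positivity arguments below require.\<close>

lemma compact_dominated_by_bumps:
  fixes K :: "'a::euclidean_space set"
  assumes "compact K" "K \<subseteq> \<Omega>" "open \<Omega>"
  obtains I :: "('a \<times> real) set" and C where "finite I" "\<And>c r. (c, r) \<in> I \<Longrightarrow> 0 < r \<and> cball c r \<subseteq> \<Omega>" "0 \<le> C"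
    "\<And>x. x \<in> K \<Longrightarrow> 1 \<le> C * (\<Sum>(c,r)\<in>I. bump c r x)"
proof -
  have "\<exists>r>0. cball x r \<subseteq> \<Omega>" if "x \<in> K" for x using that assms open_contains_cball by blast
  then obtain \<rho> where \<rho>: "\<And>x. x \<in> K \<Longrightarrow> 0 < \<rho> x \<and> cball x (\<rho> x) \<subseteq> \<Omega>" by metis
  have "K \<subseteq> (\<Union>x\<in>K. ball x (\<rho> x))" using \<rho> by force
  from compactE_image[OF \<open>compact K\<close> _ this]
  obtain F where F: "F \<subseteq> K" "finite F" "K \<subseteq> (\<Union>x\<in>F. ball x (\<rho> x))" by auto
  define I where "I = (\<lambda>x. (x, \<rho> x)) ` F"
  define s where "s x = (\<Sum>(c,r)\<in>I. bump c r x)" for x :: 'a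
  have fin: "finite I" using F by (simp add: I_def)
  have pos: "0 < s x" if x: "x \<in> K" for x
  proof -
    obtain y where y: "y \<in> F" "x \<in> ball y (\<rho> y)" using F(3) x by blast
    then have "0 < bump y (\<rho> y) x" using bump_pos_iff \<rho> F by blast
    then show ?thesis unfolding s_def
      by (intro sum_pos2[OF fin, of "(y, \<rho> y)"]) (use y in \<open>auto simp: I_def bump_bounds\<close>)
  qed
  have cont: "continuous_on K s"
    unfolding s_def split_def
    by (intro continuous_on_sum continuous_on_subset[OF smooth_continuous[OF smooth_bump]]) auto
  have "\<exists>C\<ge>0. \<forall>x\<in>K. 1 \<le> C * s x"
  proof (cases "K = {}")
    case False
    obtain z where "z \<in> K" "\<And>y. y \<in> K \<Longrightarrow> s z \<le> s y"
      using continuous_attains_inf[OF \<open>compact K\<close> False cont] by blast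
    then show ?thesis using pos by (intro exI[of _ "inverse (s z)"]) (auto simp: field_simps less_imp_le)
  qed auto
  then obtain C where "C \<ge> 0" "\<And>x. x \<in> K \<Longrightarrow> 1 \<le> C * s x" by blast
  then show ?thesis using that[of I C] fin \<rho> F unfolding s_def I_def by auto
qed

lemma compact_test_ge_1:
  fixes K :: "'a::euclidean_space set"
  assumes "compact K" "K \<subseteq> \<Omega>" "open \<Omega>"
  obtains \<eta> where "\<eta> \<in> test_functions \<Omega>" "\<And>x. 0 \<le> \<eta> x" "\<And>x. x \<in> K \<Longrightarrow> 1 \<le> \<eta> x"
proof -
  obtain I :: "('a \<times> real) set" and C where I: "finite I" "\<And>c r. (c, r) \<in> I \<Longrightarrow> 0 < r \<and> cball c r \<subseteq> \<Omega>" "0 \<le> C"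
    "\<And>x. x \<in> K \<Longrightarrow> 1 \<le> C * (\<Sum>(c,r)\<in>I. bump c r x)"
    using compact_dominated_by_bumps[OF assms] by metis
  show ?thesis
  proof (rule that[of "\<lambda>x. C * (\<Sum>(c,r)\<in>I. bump c r x)"])
    show "(\<lambda>x. C * (\<Sum>(c,r)\<in>I. bump c r x)) \<in> test_functions \<Omega>"
      unfolding split_def by (intro test_cmult test_sum bump_test) (use I in auto)
  qed (use I in \<open>auto intro!: mult_nonneg_nonneg sum_nonneg simp: bump_bounds\<close>)
qed

lemma lebesgue_on_smooth_measurable[measurable]:
  "smooth f \<Longrightarrow> f \<in> borel_measurable (lebesgue_on \<Omega>)"
  "smooth f \<Longrightarrow> gradient f \<in> borel_measurable (lebesgue_on \<Omega>)"
  by (auto intro!: measurable_restrict_space1 measurable_completion smooth_borel gradient_borel simp: measurable_lborel1)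

lemma integrable_lebesgue_on_compact_support:
  fixes h :: "'a::euclidean_space \<Rightarrow> 'b::euclidean_space"
  assumes h: "integrable (lebesgue_on C) h" and C: "compact C" "C \<subseteq> \<Omega>" and \<Omega>: "open \<Omega>"
  shows "integrable (lebesgue_on \<Omega>) (\<lambda>x. indicator C x *\<^sub>R h x)"
proof -
  have 1: "integrable lebesgue (\<lambda>x. indicator C x *\<^sub>R h x)"
    using h C by (subst (asm) integrable_restrict_space) (auto dest: fmeasurableD[OF lmeasurable_compact])
  have "indicator \<Omega> x *\<^sub>R indicator C x *\<^sub>R h x = indicator C x *\<^sub>R h x" for x
    using C(2) by (auto simp: indicator_def)
  then show ?thesis using 1 \<Omega> by (subst integrable_restrict_space) (auto simp del: scaleR_scaleR)
qed

lemma integrable_bounded_mult_compact: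
  fixes h :: "'a::euclidean_space \<Rightarrow> real" 
  assumes h: "locally_integrable \<Omega> h" and C: "compact C" "C \<subseteq> \<Omega>" and \<Omega>: "open \<Omega>"
    and \<psi>: "\<psi> \<in> borel_measurable (lebesgue_on \<Omega>)" "\<And>x. x \<in> \<Omega> \<Longrightarrow> \<bar>\<psi> x\<bar> \<le> B" "\<And>x. x \<in> \<Omega> - C \<Longrightarrow> \<psi> x = 0"
  shows "integrable (lebesgue_on \<Omega>) (\<lambda>x. h x * \<psi> x)"
proof (rule Bochner_Integration.integrable_bound)
  have "integrable (lebesgue_on \<Omega>) (\<lambda>x. indicator C x *\<^sub>R h x)"
    using h C \<Omega> by (intro integrable_lebesgue_on_compact_support) (auto simp: locally_integrable_def)
  then show "integrable (lebesgue_on \<Omega>) (\<lambda>x. B * (indicator C x *\<^sub>R h x))" by simp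
  show "(\<lambda>x. h x * \<psi> x) \<in> borel_measurable (lebesgue_on \<Omega>)"
    using h \<psi> by (auto simp: locally_integrable_def)
  have "norm (h x * \<psi> x) \<le> norm (B * (indicator C x *\<^sub>R h x))" if "x \<in> \<Omega>" for x
    using \<psi>(2,3)[of x] that by (cases "x \<in> C") (auto simp: abs_mult mult.commute[of _ "\<bar>h x\<bar>"] intro!: mult_left_mono)
  then show "AE x in lebesgue_on \<Omega>. norm (h x * \<psi> x) \<le> norm (B * (indicator C x *\<^sub>R h x))"
    by (intro AE_I2) auto
qed

lemma integrable_test_mult:
  fixes h :: "'a::euclidean_space \<Rightarrow> real" 
  assumes h: "locally_integrable \<Omega> h" and \<Omega>: "open \<Omega>" and \<psi>: "\<psi> \<in> test_functions \<Omega>"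
  shows "integrable (lebesgue_on \<Omega>) (\<lambda>x. h x * \<psi> x)"
        "integrable (lebesgue_on \<Omega>) (\<lambda>x. h x * (gradient \<psi> x \<bullet> b))"
proof -
  obtain C B where *: "smooth \<psi>" "compact C" "C \<subseteq> \<Omega>" "\<And>x. x \<notin> C \<Longrightarrow> \<psi> x = 0"
    "\<And>x. x \<notin> C \<Longrightarrow> gradient \<psi> x = 0" "0 \<le> B" "\<And>x. \<bar>\<psi> x\<bar> \<le> B" "\<And>x. norm (gradient \<psi> x) \<le> B"
    using test_functionE[OF \<psi>] by metis
  show "integrable (lebesgue_on \<Omega>) (\<lambda>x. h x * \<psi> x)"
    by (rule integrable_bounded_mult_compact[OF h *(2,3) \<Omega>]) (use * in auto)
  have "\<bar>gradient \<psi> x \<bullet> b\<bar> \<le> B * norm b" for x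
    using Cauchy_Schwarz_ineq2[of "gradient \<psi> x" b] *(8)[of x] by (meson mult_right_mono norm_ge_zero order_trans)
  then show "integrable (lebesgue_on \<Omega>) (\<lambda>x. h x * (gradient \<psi> x \<bullet> b))"
    by (intro integrable_bounded_mult_compact[OF h *(2,3) \<Omega>, where B="B * norm b"]) (use * in auto)
qed

lemma continuous_locally_integrable:
  fixes h :: "'a::euclidean_space \<Rightarrow> 'b::euclidean_space"
  assumes "continuous_on \<Omega> h" "open \<Omega>"
  shows "locally_integrable \<Omega> h"
  unfolding locally_integrable_def
proof (intro conjI allI impI)
  show "h \<in> borel_measurable (lebesgue_on \<Omega>)"
    using assms by (intro continuous_imp_measurable_on_sets_lebesgue) auto
  fix K assume K: "compact K \<and> K \<subseteq> \<Omega>"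
  then have "integrable lborel (\<lambda>x. indicator K x *\<^sub>R h x)"
    using assms continuous_on_subset by (intro borel_integrable_compact) auto
  then have "integrable lebesgue (\<lambda>x. indicator K x *\<^sub>R h x)"
    using borel_measurable_integrable by (subst integrable_completion) auto
  then show "integrable (lebesgue_on K) h"
    using K by (subst integrable_restrict_space) (auto dest: fmeasurableD[OF lmeasurable_compact])
qed

text \<open>The difference quotients of \<open>f\<close> in direction \<open>b\<close> integrate to \<open>0\<close> by translation
  invariance of Lebesgue measure, and they converge dominatedly to the directional derivative.\<close>

lemma integral_gradient_eq_0:
  fixes f :: "'a::euclidean_space \<Rightarrow> real"
  assumes f: "f \<in> test_functions UNIV"
  shows "(LINT x|lborel. gradient f x \<bullet> b) = 0"
proof -
  obtain C B where C: "smooth f" "compact C" "\<And>x. x \<notin> C \<Longrightarrow> f x = 0"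
    "0 \<le> B" "\<And>x. norm (gradient f x) \<le> B" using test_functionE[OF f] by metis
  define t where "t = (\<lambda>k. inverse (real (Suc k)))"
  have t: "0 < t k" "t k \<le> 1" "t \<longlonglongrightarrow> 0" for k
    using LIMSEQ_inverse_real_of_nat by (auto simp: t_def simp del: of_nat_Suc intro: le_imp_inverse_le[of 1, simplified])
  have [measurable]: "f \<in> borel_measurable borel" by (rule smooth_borel[OF C(1)])
  have "integrable (lebesgue_on UNIV) (\<lambda>x. 1 * f x)"
    by (rule integrable_test_mult[OF continuous_locally_integrable]) (use f in auto)
  then have int: "integrable lborel f"
    by (simp add: integrable_completion integrable_restrict_space)
  have shift: "integrable lborel (\<lambda>x. f (a + x))" "(LINT x|lborel. f (a + x)) = (LINT x|lborel. f x)" for a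
  proof -
    show "(LINT x|lborel. f (a + x)) = (LINT x|lborel. f x)"
      by (subst (2) lborel_distr_plus[of a, symmetric]) (simp add: integral_distr)
    have "integrable (distr lborel borel ((+) a)) f" using int by (simp add: lborel_distr_plus)
    then show "integrable lborel (\<lambda>x. f (a + x))" by (simp add: integrable_distr_eq)
  qed
  define d where "d k x = (f (t k *\<^sub>R b + x) - f x) / t k" for k x
  have "(LINT x|lborel. d k x) = 0" for k
    unfolding d_def using shift int by simp
  moreover have "(\<lambda>k. LINT x|lborel. d k x) \<longlonglongrightarrow> (LINT x|lborel. gradient f x \<bullet> b)"
  proof (rule integral_dominated_convergence)
    let ?S = "{x + y |x y. x \<in> C \<and> y \<in> cball 0 (norm b)}"
    have S: "compact ?S" using C by (intro compact_sums) auto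
    show "(\<lambda>x. gradient f x \<bullet> b) \<in> borel_measurable lborel"
      using gradient_borel[OF C(1)] by simp
    show "d k \<in> borel_measurable lborel" for k unfolding d_def by measurable
    show "integrable lborel (\<lambda>x. B * norm b * indicator ?S x)"
      using S emeasure_compact_finite[OF S] compact_imp_closed[OF S]
      by (intro integrable_mult_right integrable_real_indicator) auto
    show "AE x in lborel. (\<lambda>k. d k x) \<longlonglongrightarrow> gradient f x \<bullet> b"
    proof (rule AE_I2)
      fix x
      have "((\<lambda>s. f (s *\<^sub>R b + x)) has_derivative (\<lambda>s. (s *\<^sub>R b) \<bullet> gradient f x)) (at 0)"
        by (rule has_derivative_compose[where g=f and f="\<lambda>s. s *\<^sub>R b + x"])
          (use gradient_smooth(1)[OF C(1), of x] in \<open>auto intro!: derivative_eq_intros simp: gderiv_def\<close>)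
      then have "((\<lambda>s. f (s *\<^sub>R b + x)) has_field_derivative (gradient f x \<bullet> b)) (at 0)"
        by (simp add: has_field_derivative_def inner_commute mult_commute_abs)
      then have "((\<lambda>s. (f (s *\<^sub>R b + x) - f x) / s) \<longlongrightarrow> gradient f x \<bullet> b) (at 0)"
        by (simp add: DERIV_def)
      moreover have "filterlim t (at 0) sequentially"
        using t by (auto simp: filterlim_at intro!: eventuallyI less_imp_neq[symmetric])
      ultimately show "(\<lambda>k. d k x) \<longlonglongrightarrow> gradient f x \<bullet> b"
        unfolding d_def by (rule filterlim_compose)
    qed
    have lip: "\<bar>f y - f x\<bar> \<le> B * norm (y - x)" for x y
    proof -
      have "norm (f y - f x) \<le> B * norm (y - x)"
      proof (rule differentiable_bound[of UNIV f "\<lambda>x h. h \<bullet> gradient f x"])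
        show "(f has_derivative (\<lambda>h. h \<bullet> gradient f x)) (at x within UNIV)" for x
          using gradient_smooth(1)[OF C(1), of x] by (simp add: gderiv_def)
        show "onorm (\<lambda>h. h \<bullet> gradient f x) \<le> B" for x
          by (rule onorm_le) (metis C(5) Cauchy_Schwarz_ineq2 mult.commute mult_right_mono norm_ge_zero order_trans real_norm_def)
      qed auto
      then show ?thesis by simp
    qed
    have "norm (d k x) \<le> B * norm b * indicator ?S x" for k x
    proof (cases "x \<in> ?S")
      case True
      have "\<bar>f (t k *\<^sub>R b + x) - f x\<bar> \<le> B * (t k * norm b)" using lip[of "t k *\<^sub>R b + x" x] t(1)[of k] by simp
      then show ?thesis using True t(1)[of k] by (simp add: d_def field_simps)
    next
      case False
      have "x \<notin> C" using False by (auto intro!: exI[of _ x] exI[of _ 0])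
      moreover have "t k *\<^sub>R b + x \<notin> C"
      proof
        assume "t k *\<^sub>R b + x \<in> C"
        moreover have "norm (- (t k *\<^sub>R b)) \<le> norm b" using t(1)[of k] t(2)[of k] by (simp add: mult_left_le_one_le)
        moreover have "x = (t k *\<^sub>R b + x) + - (t k *\<^sub>R b)" by simp
        ultimately have "x \<in> ?S" unfolding mem_Collect_eq mem_cball dist_0_norm by blast
        then show False using False by simp
      qed
      ultimately show ?thesis using C by (simp add: d_def)
    qed
    then show "AE x in lborel. norm (d k x) \<le> B * norm b * indicator ?S x" for k by (intro AE_I2)
  qed
  ultimately show ?thesis using LIMSEQ_unique[OF tendsto_const] by fastforce
qed

lemma integral_lebesgue_on_lborel:
  fixes g :: "'a::euclidean_space \<Rightarrow> real"
  assumes "open \<Omega>" "g \<in> borel_measurable borel" "\<And>x. x \<notin> \<Omega> \<Longrightarrow> g x = 0"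
  shows "(LINT x|lebesgue_on \<Omega>. g x) = (LINT x|lborel. g x)"
proof -
  have "indicator \<Omega> x *\<^sub>R g x = g x" for x using assms(3)[of x] by (auto simp: indicator_def)
  then show ?thesis using assms(1,2)
    by (subst integral_restrict_space) (auto simp: integral_completion simp del: real_scaleR_def)
qed

lemma integration_by_parts_smooth:
  fixes w :: "'a::euclidean_space \<Rightarrow> real"
  assumes w: "smooth w" and \<psi>: "\<psi> \<in> test_functions \<Omega>" and \<Omega>: "open \<Omega>"
  shows "(LINT x|lebesgue_on \<Omega>. w x * (gradient \<psi> x \<bullet> b)) = - (LINT x|lebesgue_on \<Omega>. (gradient w x \<bullet> b) * \<psi> x)"
proof -
  have s: "smooth \<psi>" using \<psi> test_smooth by blast
  have t: "(\<lambda>x. w x * \<psi> x) \<in> test_functions \<Omega>" by (rule test_mult[OF \<psi> w])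
  have li: "locally_integrable \<Omega> w" "locally_integrable \<Omega> (\<lambda>x. gradient w x \<bullet> b)"
    using continuous_on_subset[OF smooth_continuous[OF w]]
      continuous_on_subset[OF smooth_continuous[OF smooth_gradient_component[OF w]]]
    by (auto intro!: continuous_locally_integrable \<Omega>)
  have "0 = (LINT x|lborel. gradient (\<lambda>x. w x * \<psi> x) x \<bullet> b)"
    using integral_gradient_eq_0[OF test_mono[OF t subset_UNIV]] by simp
  also have "\<dots> = (LINT x|lebesgue_on \<Omega>. gradient (\<lambda>x. w x * \<psi> x) x \<bullet> b)"
  proof (rule integral_lebesgue_on_lborel[OF \<Omega>, symmetric])
    show "(\<lambda>x. gradient (\<lambda>x. w x * \<psi> x) x \<bullet> b) \<in> borel_measurable borel"
      using gradient_borel[OF test_smooth[OF t]] by simp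
    show "gradient (\<lambda>x. w x * \<psi> x) x \<bullet> b = 0" if "x \<notin> \<Omega>" for x
    proof -
      obtain C where "C \<subseteq> \<Omega>" "\<And>x. x \<notin> C \<Longrightarrow> gradient (\<lambda>x. w x * \<psi> x) x = 0"
        using test_functionE[OF t] by metis
      then show ?thesis using that by (metis inner_zero_left subsetD)
    qed
  qed
  also have "\<dots> = (LINT x|lebesgue_on \<Omega>. w x * (gradient \<psi> x \<bullet> b) + (gradient w x \<bullet> b) * \<psi> x)"
    by (simp add: gradient_mult[OF w s] inner_add_left mult.commute[of "\<psi> _" "_ \<bullet> _"])
  also have "\<dots> = (LINT x|lebesgue_on \<Omega>. w x * (gradient \<psi> x \<bullet> b)) + (LINT x|lebesgue_on \<Omega>. (gradient w x \<bullet> b) * \<psi> x)"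
    by (intro Bochner_Integration.integral_add integrable_test_mult li \<Omega> \<psi>)
  finally show ?thesis by simp
qed

section \<open>Upper integrals of positive distributions\<close>

text \<open>For fixed \<open>c\<close> and \<open>r\<close>, smooth functions supported in the closed ball that increase to the
  indicator of the open ball.\<close>

definition plateau :: "'a::euclidean_space \<Rightarrow> real \<Rightarrow> nat \<Rightarrow> 'a \<Rightarrow> real" where
  "plateau c r n x = 1 - (1 - bump c r x) ^ n"

lemma plateau:
  shows "smooth (plateau c r n)" "0 \<le> plateau c r n x" "plateau c r n x \<le> 1"
    "m \<le> n \<Longrightarrow> plateau c r m x \<le> plateau c r n x" "plateau c r 0 x = 0" "plateau c r 1 x = bump c r x"
    "0 < r \<Longrightarrow> x \<notin> ball c r \<Longrightarrow> plateau c r n x = 0"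
    "0 < r \<Longrightarrow> x \<in> ball c r \<Longrightarrow> (\<lambda>n. plateau c r n x) \<longlonglongrightarrow> 1"
proof -
  have b: "0 \<le> 1 - bump c r x" "1 - bump c r x \<le> 1" using bump_bounds[of c r x] by auto
  show "smooth (plateau c r n)" unfolding plateau_def[abs_def]
    by (intro smooth_diff smooth_const smooth_power smooth_bump)
  show "0 \<le> plateau c r n x" "plateau c r n x \<le> 1"
    using b power_le_one[of "1 - bump c r x" n] by (auto simp: plateau_def)
  show "m \<le> n \<Longrightarrow> plateau c r m x \<le> plateau c r n x"
    using b power_decreasing[of m n "1 - bump c r x"] by (auto simp: plateau_def)
  show "plateau c r 0 x = 0" "plateau c r 1 x = bump c r x" by (auto simp: plateau_def)
  show "0 < r \<Longrightarrow> x \<notin> ball c r \<Longrightarrow> plateau c r n x = 0"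
    using bump_pos_iff[of r c x] bump_bounds[of c r x] by (auto simp: plateau_def)
  assume "0 < r" "x \<in> ball c r"
  then have "(\<lambda>n. 1 - (1 - bump c r x) ^ n) \<longlonglongrightarrow> 1 - 0"
    using bump_pos_iff[of r c x] bump_bounds[of c r x] by (intro tendsto_intros LIMSEQ_power_zero) auto
  then show "(\<lambda>n. plateau c r n x) \<longlonglongrightarrow> 1" by (simp add: plateau_def)
qed

lemma plateau_test: "0 < r \<Longrightarrow> cball c r \<subseteq> \<Omega> \<Longrightarrow> plateau c r n \<in> test_functions \<Omega>"
  by (rule test_functionI[where C="cball c r"]) (use plateau(1,7) ball_subset_cball in \<open>force+\<close>)

text \<open>Every open subset is a countable union of such balls by the Lindelof property.\<close>

lemma restrict_borel_subset_if_balls: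
  fixes \<Omega> :: "'a::euclidean_space set"
  assumes L: "sigma_algebra \<Omega> L" and \<Omega>: "open \<Omega>"
    and balls: "\<And>c r. 0 < r \<Longrightarrow> cball c r \<subseteq> \<Omega> \<Longrightarrow> ball c r \<in> L"
  shows "sets (restrict_space borel \<Omega>) \<subseteq> L"
proof -
  interpret L: sigma_algebra \<Omega> L by (rule L)
  have "open U \<Longrightarrow> \<Omega> \<inter> U \<in> L" for U
  proof -
    assume "open U"
    let ?F = "{ball c r |c r. 0 < r \<and> cball c r \<subseteq> \<Omega> \<inter> U}"
    obtain F where F: "F \<subseteq> ?F" "countable F" "\<Union>F = \<Union>?F"
      using Lindelof[of ?F] by blast
    have "\<Union>?F = \<Omega> \<inter> U"
    proof (rule antisym)
      show "\<Union>?F \<subseteq> \<Omega> \<inter> U" using ball_subset_cball by blast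
      show "\<Omega> \<inter> U \<subseteq> \<Union>?F"
      proof
        fix x assume x: "x \<in> \<Omega> \<inter> U"
        then obtain e where "e > 0" "cball x e \<subseteq> \<Omega> \<inter> U"
          using \<Omega> \<open>open U\<close> open_contains_cball[of "\<Omega> \<inter> U"] by blast
        then have "ball x e \<in> ?F" "x \<in> ball x e" by auto
        then show "x \<in> \<Union>?F" by blast
      qed
    qed
    moreover have "\<Union>F \<in> L"
      by (rule L.countable_Union[OF F(2)]) (use F(1) balls in blast)
    ultimately show ?thesis using F(3) by simp
  qed
  moreover have "\<Omega> \<inter> A \<in> L" if "A \<in> sigma_sets UNIV {S. open S}" and o: "\<And>U. open U \<Longrightarrow> \<Omega> \<inter> U \<in> L" for A
    using that(1)
  proof induction
    case (Compl a)
    have "\<Omega> \<inter> (UNIV - a) = \<Omega> - \<Omega> \<inter> a" by blast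
    then show ?case using L.compl_sets[OF Compl.IH] by simp
  next
    case (Union a)
    have "\<Omega> \<inter> (\<Union>i. a i) = (\<Union>i. \<Omega> \<inter> a i)" by blast
    then show ?case using L.countable_UN[of "\<lambda>i. \<Omega> \<inter> a i" UNIV] Union.IH by auto
  qed (auto intro: o)
  ultimately show ?thesis
    by (auto simp: sets_restrict_space borel_def)
qed

locale positive_distribution =
  fixes \<Omega> :: "'a::euclidean_space set" and T :: "('a \<Rightarrow> real) \<Rightarrow> real"
  assumes \<Omega>: "open \<Omega>"
    and T_add: "\<psi> \<in> test_functions \<Omega> \<Longrightarrow> \<eta> \<in> test_functions \<Omega> \<Longrightarrow> T (\<lambda>x. \<psi> x + \<eta> x) = T \<psi> + T \<eta>"
    and T_cmult: "\<psi> \<in> test_functions \<Omega> \<Longrightarrow> T (\<lambda>x. c * \<psi> x) = c * T \<psi>"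
    and T_nonneg: "\<psi> \<in> test_functions \<Omega> \<Longrightarrow> (\<And>x. 0 \<le> \<psi> x) \<Longrightarrow> 0 \<le> T \<psi>"
begin

lemma T_zero: "T (\<lambda>x. 0) = 0"
  using T_cmult[OF test_zero, of 0] by simp

lemma T_diff: "\<psi> \<in> test_functions \<Omega> \<Longrightarrow> \<eta> \<in> test_functions \<Omega> \<Longrightarrow> T (\<lambda>x. \<psi> x - \<eta> x) = T \<psi> - T \<eta>"
  using T_add[of \<psi> "\<lambda>x. (-1) * \<eta> x"] T_cmult[of \<eta> "-1"] test_cmult[of \<eta> \<Omega> "-1"] by simp

lemma T_mono:
  assumes "\<psi> \<in> test_functions \<Omega>" "\<eta> \<in> test_functions \<Omega>" "\<And>x. \<psi> x \<le> \<eta> x"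
  shows "T \<psi> \<le> T \<eta>"
  using T_diff[OF assms(2,1)] T_nonneg[OF test_diff[OF assms(2,1)]] assms(3) by simp

lemma T_sum: "(\<And>i. i \<in> I \<Longrightarrow> f i \<in> test_functions \<Omega>) \<Longrightarrow> T (\<lambda>x. \<Sum>i\<in>I. f i x) = (\<Sum>i\<in>I. T (f i))"
  by (induction I rule: infinite_finite_induct) (auto simp: T_zero T_add test_sum)

definition covers :: "(nat \<Rightarrow> 'a \<Rightarrow> real) \<Rightarrow> ('a \<Rightarrow> ennreal) \<Rightarrow> bool" where
  "covers s g \<longleftrightarrow> (\<forall>i. s i \<in> test_functions \<Omega> \<and> (\<forall>x. 0 \<le> s i x)) \<and> (\<forall>x\<in>\<Omega>. g x \<le> (\<Sum>i. ennreal (s i x)))"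

text \<open>A Daniell upper integral. Admitting sequences of test functions, rather than single ones,
  builds countable subadditivity into the definition.\<close>

definition upper_integral :: "('a \<Rightarrow> ennreal) \<Rightarrow> ennreal" where
  "upper_integral g = (INF s\<in>{s. covers s g}. \<Sum>i. ennreal (T (s i)))"

lemma upper_integral_le: "covers s g \<Longrightarrow> upper_integral g \<le> (\<Sum>i. ennreal (T (s i)))"
  unfolding upper_integral_def by (rule INF_lower) simp

lemma upper_integral_mono:
  assumes "\<And>x. x \<in> \<Omega> \<Longrightarrow> g x \<le> h x"
  shows "upper_integral g \<le> upper_integral h"
proof -
  have "covers s g" if "covers s h" for s
    using that assms unfolding covers_def by (meson order_trans)
  then show ?thesis unfolding upper_integral_def by (intro INF_superset_mono) auto
qed

lemma upper_integral_le_test: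
  assumes "\<psi> \<in> test_functions \<Omega>" "\<And>x. 0 \<le> \<psi> x" "\<And>x. x \<in> \<Omega> \<Longrightarrow> g x \<le> ennreal (\<psi> x)"
  shows "upper_integral g \<le> ennreal (T \<psi>)"
proof -
  define s where "s i = (if i = 0 then \<psi> else (\<lambda>x. 0))" for i :: nat
  have 1: "(\<Sum>i. ennreal (s i x)) = ennreal (\<psi> x)" for x
    by (subst suminf_finite[of "{0}"]) (auto simp: s_def)
  have 2: "(\<Sum>i. ennreal (T (s i))) = ennreal (T \<psi>)"
    by (subst suminf_finite[of "{0}"]) (auto simp: s_def T_zero)
  have "covers s g" using assms by (auto simp: covers_def 1) (auto simp: s_def test_zero)
  from upper_integral_le[OF this] show ?thesis by (simp add: 2)
qed

lemma upper_integral_0: "upper_integral (\<lambda>x. 0) = 0"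
  using upper_integral_le_test[OF test_zero, of "\<lambda>x. 0"] by (simp add: T_zero)

lemma upper_integral_countably_subadditive:
  assumes "\<And>x. x \<in> \<Omega> \<Longrightarrow> h x \<le> (\<Sum>n. g n x)"
  shows "upper_integral h \<le> (\<Sum>n. upper_integral (g n))"
proof (rule ennreal_le_epsilon)
  fix e :: real assume e: "0 < e" and fin: "(\<Sum>n. upper_integral (g n)) < top"
  have "upper_integral (g n) < upper_integral (g n) + e * (1/2)^Suc n" for n
    using fin e by (auto simp add: less_top dest!: ennreal_suminf_lessD)
  then have "\<exists>s. covers s (g n) \<and> (\<Sum>i. ennreal (T (s i))) < upper_integral (g n) + e * (1/2)^Suc n" for n
    unfolding upper_integral_def INF_less_iff by auto
  then obtain s where s: "\<And>n. covers (s n) (g n)"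
    "\<And>n. (\<Sum>i. ennreal (T (s n i))) < upper_integral (g n) + e * (1/2)^Suc n" by metis
  \<comment> \<open>All covers are merged into a single one by the pairing function.\<close>
  define C where "C = (\<lambda>k. case prod_decode k of (n, i) \<Rightarrow> s n i)"
  have "(\<Sum>k. ennreal (C k x)) = (\<Sum>n. \<Sum>i. ennreal (s n i x))" for x
    unfolding C_def using suminf_ennreal_2dimen[of "\<lambda>n. \<Sum>i. ennreal (s n i x)" "\<lambda>(n, i). ennreal (s n i x)"]
    by (simp add: split_def)
  moreover have "h x \<le> (\<Sum>n. \<Sum>i. ennreal (s n i x))" if "x \<in> \<Omega>" for x
    using assms[OF that] s(1) that by (rule_tac order_trans) (auto intro!: suminf_le simp: covers_def)
  ultimately have "covers C h" using s(1) by (auto simp: covers_def C_def split: prod.split)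
  from upper_integral_le[OF this] have "upper_integral h \<le> (\<Sum>k. ennreal (T (C k)))" .
  also have "\<dots> = (\<Sum>n. \<Sum>i. ennreal (T (s n i)))"
    unfolding C_def using suminf_ennreal_2dimen[of "\<lambda>n. \<Sum>i. ennreal (T (s n i))" "\<lambda>(n, i). ennreal (T (s n i))"]
    by (simp add: split_def)
  also have "\<dots> \<le> (\<Sum>n. upper_integral (g n) + e * (1/2) ^ Suc n)"
    using s(2) by (intro suminf_le) (auto intro: less_imp_le)
  also have "\<dots> = (\<Sum>n. upper_integral (g n)) + (\<Sum>n. ennreal e * ennreal ((1/2) ^ Suc n))"
    using e by (subst suminf_add[symmetric])
      (auto simp del: ennreal_suminf_cmult simp add: ennreal_mult[symmetric])
  also have "\<dots> = (\<Sum>n. upper_integral (g n)) + e"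
    unfolding ennreal_suminf_cmult
    by (subst suminf_ennreal_eq[OF zero_le_power power_half_series]) auto
  finally show "upper_integral h \<le> (\<Sum>n. upper_integral (g n)) + e" .
qed

lemma upper_integral_sum_le:
  fixes g :: "nat \<Rightarrow> 'a \<Rightarrow> ennreal"
  assumes "\<And>x. x \<in> \<Omega> \<Longrightarrow> h x \<le> (\<Sum>n<N. g n x)"
  shows "upper_integral h \<le> (\<Sum>n<N. upper_integral (g n))"
proof -
  let ?g = "\<lambda>n. if n < N then g n else (\<lambda>x. 0)"
  have "upper_integral h \<le> (\<Sum>n. upper_integral (?g n))"
  proof (rule upper_integral_countably_subadditive)
    fix x assume "x \<in> \<Omega>"
    moreover have "(\<Sum>n. ?g n x) = (\<Sum>n<N. g n x)" by (subst suminf_finite[of "{..<N}"]) auto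
    ultimately show "h x \<le> (\<Sum>n. ?g n x)" using assms by simp
  qed
  also have "\<dots> = (\<Sum>n<N. upper_integral (g n))"
    by (subst suminf_finite[of "{..<N}"]) (auto simp: upper_integral_0)
  finally show ?thesis .
qed

text \<open>A Dini argument: on the compact support of \<open>\<psi>\<close> the increasing partial sums exceed \<open>\<psi>\<close> up
  to a small multiple of a fixed test function from some index on, so finite additivity of \<open>T\<close>
  suffices.\<close>

lemma T_le_countable_cover:
  assumes \<psi>: "\<psi> \<in> test_functions \<Omega>" "\<And>x. 0 \<le> \<psi> x" and s: "covers s (\<lambda>x. ennreal (\<psi> x))"
  shows "ennreal (T \<psi>) \<le> (\<Sum>i. ennreal (T (s i)))"
proof (cases "\<Sum>i. ennreal (T (s i))" rule: ennreal_cases)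
  case (real r)
  obtain C where C: "compact C" "C \<subseteq> \<Omega>" "\<And>x. x \<notin> C \<Longrightarrow> \<psi> x = 0"
    using test_functionE[OF \<psi>(1)] by metis
  obtain \<eta> where \<eta>: "\<eta> \<in> test_functions \<Omega>" "\<And>x. 0 \<le> \<eta> x" "\<And>x. x \<in> C \<Longrightarrow> 1 \<le> \<eta> x"
    using compact_test_ge_1[OF C(1,2) \<Omega>] by metis
  have st: "s i \<in> test_functions \<Omega>" "0 \<le> s i x" for i x using s by (auto simp: covers_def)
  have "T \<psi> \<le> r + \<delta> * T \<eta>" if \<delta>: "\<delta> > 0" for \<delta>
  proof -
    define U where "U N = {x. \<psi> x < (\<Sum>i<N. s i x) + \<delta> * \<eta> x}" for N
    have "open (U N)" for N
      unfolding U_def by (intro open_Collect_less smooth_continuous test_smooth[OF \<psi>(1)]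
        smooth_add smooth_sum smooth_cmult test_smooth[OF st(1)] test_smooth[OF \<eta>(1)])
    moreover have "C \<subseteq> (\<Union>N\<in>UNIV. U N)"
    proof
      fix x assume x: "x \<in> C"
      have "\<exists>N. \<psi> x - \<delta> < (\<Sum>i<N. s i x)"
      proof (cases "\<psi> x = 0")
        case True then show ?thesis using \<delta> by (intro exI[of _ 0]) simp
      next
        case False
        have "ennreal (\<psi> x - \<delta>) < ennreal (\<psi> x)" using False \<psi>(2)[of x] \<delta> by (intro ennreal_lessI) auto
        also have "\<dots> \<le> (\<Sum>i. ennreal (s i x))" using s x C by (auto simp: covers_def)
        also have "\<dots> = (SUP N. ennreal (\<Sum>i<N. s i x))" unfolding suminf_eq_SUP using st by simp
        finally obtain N where "ennreal (\<psi> x - \<delta>) < ennreal (\<Sum>i<N. s i x)" unfolding less_SUP_iff by auto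
        then have "\<psi> x - \<delta> < (\<Sum>i<N. s i x)"
          using ennreal_leI[of "\<Sum>i<N. s i x" "\<psi> x - \<delta>"] unfolding not_le[symmetric] by blast
        then show ?thesis ..
      qed
      then obtain N where "\<psi> x - \<delta> < (\<Sum>i<N. s i x)" by blast
      moreover have "\<delta> \<le> \<delta> * \<eta> x" using \<eta>(3)[OF x] \<delta> by simp
      ultimately have "x \<in> U N" unfolding U_def by simp
      then show "x \<in> (\<Union>N\<in>UNIV. U N)" by blast
    qed
    ultimately obtain F where F: "finite F" "C \<subseteq> (\<Union>N\<in>F. U N)"
      using compactE_image[OF C(1), of UNIV U] by metis
    obtain N where N: "\<And>n. n \<in> F \<Longrightarrow> n \<le> N" using finite_nat_set_iff_bounded_le F(1) by auto
    have le: "\<psi> x \<le> (\<Sum>i<N. s i x) + \<delta> * \<eta> x" for x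
    proof (cases "x \<in> C")
      case True
      then obtain n where n: "n \<in> F" "x \<in> U n" using F(2) by auto
      have "(\<Sum>i<n. s i x) \<le> (\<Sum>i<N. s i x)" using N[OF n(1)] st by (intro sum_mono2) auto
      then show ?thesis using n(2) by (auto simp: U_def)
    next
      case False
      then show ?thesis using C(3) st \<eta>(2) \<delta> by (auto intro!: add_nonneg_nonneg sum_nonneg mult_nonneg_nonneg)
    qed
    have sumt: "(\<lambda>x. \<Sum>i<N. s i x) \<in> test_functions \<Omega>" by (intro test_sum st)
    have \<delta>\<eta>: "(\<lambda>x. \<delta> * \<eta> x) \<in> test_functions \<Omega>" by (intro test_cmult \<eta>)
    have "T \<psi> \<le> T (\<lambda>x. (\<Sum>i<N. s i x) + \<delta> * \<eta> x)"
      by (rule T_mono[OF \<psi>(1) test_add[OF sumt \<delta>\<eta>] le])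
    also have "\<dots> = (\<Sum>i<N. T (s i)) + \<delta> * T \<eta>"
      unfolding T_add[OF sumt \<delta>\<eta>] T_cmult[OF \<eta>(1)] using st by (subst T_sum) auto
    also have "(\<Sum>i<N. T (s i)) \<le> r"
    proof -
      have nn: "0 \<le> T (s i)" for i by (intro T_nonneg st)
      have "ennreal (\<Sum>i<N. T (s i)) = (\<Sum>i<N. ennreal (T (s i)))" using nn by (simp add: sum_ennreal)
      also have "\<dots> \<le> ennreal r" unfolding real(2)[symmetric] by (rule sum_le_suminf) auto
      finally show ?thesis using real(1) by (simp add: ennreal_le_iff)
    qed
    finally show ?thesis by simp
  qed
  then have "T \<psi> \<le> r + e" if "e > 0" for e
  proof -
    have 0: "0 \<le> T \<eta>" using T_nonneg \<eta> by blast
    have "T \<psi> \<le> r + (e / (T \<eta> + 1)) * T \<eta>" using \<open>e > 0\<close> 0 by (intro \<open>\<And>\<delta>. \<delta> > 0 \<Longrightarrow> T \<psi> \<le> r + \<delta> * T \<eta>\<close>) auto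
    also have "(e / (T \<eta> + 1)) * T \<eta> \<le> e" using that 0 by (simp add: field_simps)
    finally show ?thesis by simp
  qed
  then have "T \<psi> \<le> r" by (rule field_le_epsilon)
  then show ?thesis using real by (simp add: ennreal_leI)
qed simp

lemma upper_integral_test:
  assumes "\<psi> \<in> test_functions \<Omega>" "\<And>x. 0 \<le> \<psi> x"
  shows "upper_integral (\<lambda>x. ennreal (\<psi> x)) = ennreal (T \<psi>)"
proof (rule antisym)
  show "upper_integral (\<lambda>x. ennreal (\<psi> x)) \<le> ennreal (T \<psi>)"
    by (rule upper_integral_le_test) (use assms in auto)
  show "ennreal (T \<psi>) \<le> upper_integral (\<lambda>x. ennreal (\<psi> x))"
    unfolding upper_integral_def by (rule INF_greatest) (use T_le_countable_cover assms in auto)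
qed

definition outer :: "'a set \<Rightarrow> ennreal" where
  "outer A = upper_integral (indicator A)"

text \<open>The differences of consecutive plateaus, multiplied by \<open>\<psi>\<close>, form a cover whose values
  under \<open>T\<close> telescope.\<close>

lemma upper_integral_ball_le_SUP:
  assumes r: "0 < r" and t: "\<And>n. (\<lambda>x. plateau c r n x * \<psi> x) \<in> test_functions \<Omega>" and \<psi>: "\<And>x. 0 \<le> \<psi> x"
  shows "upper_integral (\<lambda>x. indicator (ball c r) x * ennreal (\<psi> x)) \<le> (SUP n. ennreal (T (\<lambda>x. plateau c r n x * \<psi> x)))"
proof -
  let ?d = "\<lambda>n x. plateau c r (Suc n) x * \<psi> x - plateau c r n x * \<psi> x"
  have nn: "0 \<le> ?d n x" for n x using plateau(4)[of n "Suc n" c r x] \<psi>[of x] by (simp add: mult_right_mono)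
  have tel: "(\<Sum>i<n. ?d i x) = plateau c r n x * \<psi> x" for n x
    by (subst sum_lessThan_telescope) (simp add: plateau(5))
  have "covers ?d (\<lambda>x. indicator (ball c r) x * ennreal (\<psi> x))"
    unfolding covers_def
  proof (intro conjI allI ballI)
    fix x assume "x \<in> \<Omega>"
    have "(\<Sum>n. ennreal (?d n x)) = (SUP n. ennreal (plateau c r n x * \<psi> x))"
      unfolding suminf_eq_SUP using nn tel by (simp add: sum_ennreal)
    moreover have "ennreal (\<psi> x) \<le> (SUP n. ennreal (plateau c r n x * \<psi> x))" if "x \<in> ball c r"
    proof (rule LIMSEQ_le_const2)
      show "(\<lambda>n. ennreal (plateau c r n x * \<psi> x)) \<longlonglongrightarrow> ennreal (\<psi> x)"
        using tendsto_mult_right[OF plateau(8)[OF r that], of "\<psi> x"] by (intro tendsto_ennrealI) simp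
    qed (intro exI allI impI SUP_upper UNIV_I)
    ultimately show "indicator (ball c r) x * ennreal (\<psi> x) \<le> (\<Sum>n. ennreal (?d n x))"
      by (auto simp: indicator_def)
  qed (intro test_diff t nn)+
  from upper_integral_le[OF this]
  have "upper_integral (\<lambda>x. indicator (ball c r) x * ennreal (\<psi> x)) \<le> (\<Sum>n. ennreal (T (?d n)))" .
  moreover have "(\<Sum>i<n. ennreal (T (?d i))) = ennreal (T (\<lambda>x. plateau c r n x * \<psi> x))" for n
    using T_sum[of "{..<n}" ?d] T_nonneg[OF test_diff[OF t t] nn]
    by (simp add: sum_ennreal tel test_diff[OF t t])
  ultimately show ?thesis unfolding suminf_eq_SUP by simp
qed

text \<open>A plateau splits \<open>\<psi>\<close> into a part living in the ball and a remainder that still dominates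
  \<open>\<psi>\<close> off the ball. This is the Caratheodory condition for balls on the level of test functions.\<close>

lemma upper_integral_ball_split:
  assumes r: "0 < r" and \<psi>: "\<psi> \<in> test_functions \<Omega>" "\<And>x. 0 \<le> \<psi> x"
  shows "upper_integral (\<lambda>x. indicator (ball c r) x * ennreal (\<psi> x))
      + upper_integral (\<lambda>x. indicator (- ball c r) x * ennreal (\<psi> x)) \<le> ennreal (T \<psi>)" (is "?A + ?B \<le> _")
proof -
  let ?t = "\<lambda>n x. plateau c r n x * \<psi> x"
  have t: "?t n \<in> test_functions \<Omega>" for n by (intro test_mult \<psi> plateau)
  have B: "?B \<le> ennreal (T \<psi> - T (?t n))" for n
    unfolding T_diff[OF \<psi>(1) t, symmetric]
    by (rule upper_integral_le_test[OF test_diff[OF \<psi>(1) t]])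
      (use plateau(3)[of c r n] \<psi>(2) plateau(7)[OF r, of _ c n] in \<open>auto simp: indicator_def mult_left_le_one_le plateau(2)\<close>)
  have "?A + ?B \<le> (SUP n. ennreal (T (?t n))) + ?B"
    by (intro add_right_mono upper_integral_ball_le_SUP r t \<psi>)
  also have "\<dots> = (SUP n. ennreal (T (?t n)) + ?B)" by (simp add: ennreal_SUP_add_left)
  also have "\<dots> \<le> ennreal (T \<psi>)"
  proof (rule SUP_least)
    fix n
    have "0 \<le> T (?t n)" by (intro T_nonneg t mult_nonneg_nonneg plateau \<psi>)
    moreover have "T (?t n) \<le> T \<psi>"
      by (intro T_mono t \<psi>) (use plateau(2,3)[of c r n] \<psi>(2) in \<open>simp add: mult_left_le_one_le\<close>)
    moreover have "ennreal (T (?t n)) + ?B \<le> ennreal (T (?t n)) + ennreal (T \<psi> - T (?t n))"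
      by (intro add_left_mono B)
    ultimately show "ennreal (T (?t n)) + ?B \<le> ennreal (T \<psi>)"
      by (simp add: ennreal_plus[symmetric] del: ennreal_plus)
  qed
  finally show ?thesis .
qed

lemma outer_measure_space_outer: "outer_measure_space (Pow \<Omega>) outer"
  unfolding outer_measure_space_def
proof (intro conjI)
  show "positive (Pow \<Omega>) outer"
    using upper_integral_0 by (simp add: positive_def outer_def indicator_def[abs_def])
  show "increasing (Pow \<Omega>) outer"
    by (auto simp: increasing_def outer_def intro!: upper_integral_mono split: split_indicator)
  show "countably_subadditive (Pow \<Omega>) outer"
    unfolding countably_subadditive_def
  proof (intro allI impI)
    fix A :: "nat \<Rightarrow> 'a set"
    show "outer (\<Union>i. A i) \<le> (\<Sum>i. outer (A i))"
      unfolding outer_def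
    proof (rule upper_integral_countably_subadditive)
      fix x
      have "indicator (A i) x \<le> (\<Sum>i. indicator (A i) x :: ennreal)" for i
        using sum_le_suminf[of "\<lambda>i. indicator (A i) x :: ennreal" "{i}"] by simp
      then show "indicator (\<Union>i. A i) x \<le> (\<Sum>i. indicator (A i) x :: ennreal)"
        by (cases "x \<in> (\<Union>i. A i)") (auto, metis indicator_simps(1))
    qed
  qed
qed

lemma ball_in_lambda_system:
  assumes r: "0 < r" "ball c r \<subseteq> \<Omega>"
  shows "ball c r \<in> lambda_system \<Omega> (Pow \<Omega>) outer"
proof -
  interpret sigma_algebra \<Omega> "Pow \<Omega>" by (rule sigma_algebra_Pow)
  have sub: "outer E \<le> outer (E \<inter> ball c r) + outer (E - ball c r)" if "E \<subseteq> \<Omega>" for E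
  proof -
    have "upper_integral (indicator E) \<le> (\<Sum>n<2. upper_integral (if n = (0::nat) then indicator (E \<inter> ball c r) else indicator (E - ball c r)))"
      by (rule upper_integral_sum_le) (auto simp: numeral_2_eq_2 split: split_indicator)
    then show ?thesis by (simp add: outer_def numeral_2_eq_2)
  qed
  have "outer (E \<inter> ball c r) + outer (E - ball c r) \<le> outer E" for E
    unfolding outer_def upper_integral_def[of "indicator E"]
  proof (rule INF_greatest, safe)
    fix s assume s: "covers s (indicator E)"
    have st: "s i \<in> test_functions \<Omega>" "0 \<le> s i x" for i x using s by (auto simp: covers_def)
    have c: "indicator E x \<le> (\<Sum>i. ennreal (s i x))" if "x \<in> \<Omega>" for x using s that by (auto simp: covers_def)
    have "upper_integral (indicator (E \<inter> ball c r)) \<le> (\<Sum>i. upper_integral (\<lambda>x. indicator (ball c r) x * ennreal (s i x)))"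
      by (rule upper_integral_countably_subadditive) (use c in \<open>fastforce split: split_indicator_asm simp: indicator_def\<close>)
    moreover have "upper_integral (indicator (E - ball c r)) \<le> (\<Sum>i. upper_integral (\<lambda>x. indicator (- ball c r) x * ennreal (s i x)))"
      by (rule upper_integral_countably_subadditive) (use c in \<open>fastforce split: split_indicator_asm simp: indicator_def\<close>)
    ultimately have "upper_integral (indicator (E \<inter> ball c r)) + upper_integral (indicator (E - ball c r))
        \<le> (\<Sum>i. upper_integral (\<lambda>x. indicator (ball c r) x * ennreal (s i x)) + upper_integral (\<lambda>x. indicator (- ball c r) x * ennreal (s i x)))"
      by (subst suminf_add[symmetric]) (auto intro: add_mono)
    also have "\<dots> \<le> (\<Sum>i. ennreal (T (s i)))"
      by (intro suminf_le upper_integral_ball_split r st) auto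
    finally show "upper_integral (indicator (E \<inter> ball c r)) + upper_integral (indicator (E - ball c r)) \<le> (\<Sum>i. ennreal (T (s i)))" .
  qed
  then show ?thesis using sub r(2) unfolding lambda_system_eq by (auto intro: antisym)
qed

lemma borel_in_lambda_system:
  "sets (restrict_space borel \<Omega>) \<subseteq> lambda_system \<Omega> (Pow \<Omega>) outer"
proof (rule restrict_borel_subset_if_balls[OF _ \<Omega>])
  interpret P: sigma_algebra \<Omega> "Pow \<Omega>" by (rule sigma_algebra_Pow)
  show "sigma_algebra \<Omega> (lambda_system \<Omega> (Pow \<Omega>) outer)"
    using P.caratheodory_lemma[OF outer_measure_space_outer] by (simp add: measure_space_def)
qed (use ball_in_lambda_system ball_subset_cball in blast)

definition M :: "'a measure" where
  "M = measure_of \<Omega> (sets (restrict_space borel \<Omega>)) outer"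

lemma
  shows space_M: "space M = \<Omega>" and sets_M: "sets M = sets (restrict_space borel \<Omega>)"
    and emeasure_M: "A \<in> sets (restrict_space borel \<Omega>) \<Longrightarrow> emeasure M A = outer A"
proof -
  interpret P: sigma_algebra \<Omega> "Pow \<Omega>" by (rule sigma_algebra_Pow)
  have sa: "sigma_algebra \<Omega> (sets (restrict_space borel \<Omega>))"
    using sets.sigma_algebra_axioms[of "restrict_space borel \<Omega>"] by (simp add: space_restrict_space)
  have ms: "measure_space \<Omega> (sets (restrict_space borel \<Omega>)) outer"
    by (rule measure_down[OF P.caratheodory_lemma[OF outer_measure_space_outer] sa borel_in_lambda_system])
  have sub: "sets (restrict_space borel \<Omega>) \<subseteq> Pow \<Omega>"
    using sets.space_closed[of "restrict_space borel \<Omega>"] by (simp add: space_restrict_space)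
  show "space M = \<Omega>" unfolding M_def using sub by (simp add: space_measure_of)
  show sM: "sets M = sets (restrict_space borel \<Omega>)"
    unfolding M_def using sub sa by (simp add: sigma_algebra.sigma_sets_eq)
  show "emeasure M A = outer A" if "A \<in> sets (restrict_space borel \<Omega>)"
    using ms that sM unfolding measure_space_def
    by (intro emeasure_measure_of[OF M_def sub]) (auto)
qed

end

section \<open>Positive distributions are Radon measures\<close>

text \<open>The sum counts the integers \<open>j < N\<close> below \<open>y\<close>. The trivial last bound makes the other two
  inductive.\<close>

lemma unit_steps_count_bounds:
  fixes y :: real
  assumes "0 \<le> y"
  shows "min y (real N) \<le> (\<Sum>j<N. indicator {real j<..} y)" "(\<Sum>j<N. indicator {real j<..} y) \<le> y + 1"
    "(\<Sum>j<N. indicator {real j<..} y) \<le> real N"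
  by (induction N) (use assms in \<open>auto simp: indicator_def min_def split: if_splits\<close>)

lemma test_function_measurable [measurable]:
  assumes "\<psi> \<in> test_functions \<Omega>" "sets N = sets (restrict_space borel \<Omega>)"
  shows "\<psi> \<in> borel_measurable N"
  using measurable_restrict_space1[OF smooth_borel[OF test_smooth[OF assms(1)]], of \<Omega>]
  by (simp add: measurable_cong_sets[OF assms(2) refl])

lemma compact_in_restrict_borel: "compact C \<Longrightarrow> C \<subseteq> \<Omega> \<Longrightarrow> open \<Omega> \<Longrightarrow> C \<in> sets (restrict_space borel (\<Omega>::'a::euclidean_space set))"
  by (subst sets_restrict_space_iff) (auto intro: borel_compact borel_closed compact_imp_closed)

lemma test_function_integrable:
  fixes \<Omega> :: "'a::euclidean_space set"
  assumes \<psi>: "\<psi> \<in> test_functions \<Omega>" and N: "sets N = sets (restrict_space borel \<Omega>)"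
    and fin: "\<And>C. compact C \<Longrightarrow> C \<subseteq> \<Omega> \<Longrightarrow> emeasure N C < \<infinity>" and \<Omega>: "open \<Omega>"
  shows "integrable N \<psi>"
proof -
  obtain C B where C: "compact C" "C \<subseteq> \<Omega>" "\<And>x. x \<notin> C \<Longrightarrow> \<psi> x = 0" "0 \<le> B" "\<And>x. \<bar>\<psi> x\<bar> \<le> B"
    using test_functionE[OF \<psi>] by metis
  show ?thesis
  proof (rule Bochner_Integration.integrable_bound)
    show "integrable N (\<lambda>x. B * indicator C x)"
      using fin[OF C(1,2)] compact_in_restrict_borel[OF C(1,2) \<Omega>] N by (intro integrable_mult_right integrable_real_indicator) auto
    show "\<psi> \<in> borel_measurable N" by (rule test_function_measurable[OF \<psi> N])
    show "AE x in N. norm (\<psi> x) \<le> norm (B * indicator C x)"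
      using C by (intro AE_I2) (auto simp: indicator_def)
  qed
qed

context positive_distribution begin

lemma outer_compact_finite:
  assumes "compact C" "C \<subseteq> \<Omega>" shows "outer C < \<infinity>"
proof -
  obtain \<eta> where "\<eta> \<in> test_functions \<Omega>" "\<And>x. 0 \<le> \<eta> x" "\<And>x. x \<in> C \<Longrightarrow> 1 \<le> \<eta> x"
    using compact_test_ge_1[OF assms \<Omega>] by metis
  then have "outer C \<le> ennreal (T \<eta>)" unfolding outer_def
    by (intro upper_integral_le_test) (auto split: split_indicator simp flip: ennreal_1 intro: ennreal_leI)
  then show ?thesis using ennreal_less_top order_le_less_trans unfolding infinity_ennreal_def by blast
qed

lemma emeasure_M_compact_finite: "compact C \<Longrightarrow> C \<subseteq> \<Omega> \<Longrightarrow> emeasure M C < \<infinity>"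
  using outer_compact_finite by (simp add: emeasure_M compact_in_restrict_borel \<Omega>)

lemma M_integrable: "\<psi> \<in> test_functions \<Omega> \<Longrightarrow> integrable M \<psi>"
  by (rule test_function_integrable[OF _ sets_M emeasure_M_compact_finite \<Omega>])

text \<open>Slicing \<open>\<psi>\<close> at integer heights replaces it by a finite sum of indicators, which differs
  from \<open>\<psi>\<close> by at most \<open>1\<close> on the support of \<open>\<psi>\<close>.\<close>

lemma T_le_integral_plus:
  assumes \<psi>: "\<psi> \<in> test_functions \<Omega>" "\<And>x. 0 \<le> \<psi> x" and C: "compact C" "C \<subseteq> \<Omega>" "\<And>x. x \<notin> C \<Longrightarrow> \<psi> x = 0"
  shows "T \<psi> \<le> (LINT x|M. \<psi> x) + measure M C"
proof -
  obtain B where B: "\<And>x. \<bar>\<psi> x\<bar> \<le> B" using test_functionE[OF \<psi>(1)] by metis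
  obtain N :: nat where N: "B \<le> real N" using real_arch_simple by blast
  define A where "A j = {x \<in> \<Omega>. real j < \<psi> x}" for j :: nat
  have [measurable]: "\<psi> \<in> borel_measurable M" by (rule test_function_measurable[OF \<psi>(1) sets_M])
  have "{x \<in> space M. real j < \<psi> x} \<in> sets M" for j by measurable
  then have A: "A j \<in> sets M" for j by (simp add: A_def space_M)
  have Csets: "C \<in> sets M" using compact_in_restrict_borel[OF C(1,2) \<Omega>] by (simp add: sets_M)
  have ind: "indicator (A j) x = (indicator {real j<..} (\<psi> x) :: real)" if "x \<in> \<Omega>" for j x
    using that by (auto simp: A_def indicator_def)
  have cnt: "\<psi> x \<le> (\<Sum>j<N. indicator (A j) x)" "(\<Sum>j<N. indicator (A j) x) \<le> \<psi> x + indicator C x" if "x \<in> \<Omega>" for x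
  proof -
    have "\<psi> x \<le> real N" using B[of x] N by simp
    then show "\<psi> x \<le> (\<Sum>j<N. indicator (A j) x)"
      using unit_steps_count_bounds(1)[OF \<psi>(2), of x N] by (simp add: ind[OF that])
    show "(\<Sum>j<N. indicator (A j) x) \<le> \<psi> x + indicator C x"
    proof (cases "x \<in> C")
      case True then show ?thesis using unit_steps_count_bounds(2)[OF \<psi>(2), of x N] by (simp add: ind[OF that])
    next
      case False
      then have "indicator (A j) x = (0::real)" for j using C(3) by (auto simp: A_def indicator_def)
      then show ?thesis using False C(3) by simp
    qed
  qed
  have ennsum: "(\<Sum>j<N. indicator (A j) x) = ennreal (\<Sum>j<N. indicator (A j) x)" for x
    by (simp add: sum_ennreal[symmetric] ennreal_indicator)
  have "ennreal (T \<psi>) = upper_integral (\<lambda>x. ennreal (\<psi> x))" using upper_integral_test[OF \<psi>] by simp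
  also have "\<dots> \<le> (\<Sum>j<N. upper_integral (indicator (A j)))"
    by (rule upper_integral_sum_le) (use cnt in \<open>auto simp: ennsum intro: ennreal_leI\<close>)
  also have "\<dots> = (\<Sum>j<N. emeasure M (A j))" using A by (simp add: outer_def[symmetric] emeasure_M sets_M)
  also have "\<dots> = (\<integral>\<^sup>+x. (\<Sum>j<N. indicator (A j) x) \<partial>M)" using A by (simp add: nn_integral_sum)
  also have "\<dots> \<le> (\<integral>\<^sup>+x. ennreal (\<psi> x + indicator C x) \<partial>M)"
    unfolding ennsum by (intro nn_integral_mono ennreal_leI cnt) (simp add: space_M)
  also have "\<dots> = ennreal (LINT x|M. \<psi> x + indicator C x)"
    using M_integrable[OF \<psi>(1)] emeasure_M_compact_finite[OF C(1,2)] Csets \<psi>(2)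
    by (intro nn_integral_eq_integral) auto
  also have "(LINT x|M. \<psi> x + indicator C x) = (LINT x|M. \<psi> x) + measure M C"
    using M_integrable[OF \<psi>(1)] emeasure_M_compact_finite[OF C(1,2)] Csets sets.sets_into_space[OF Csets]
    by (subst Bochner_Integration.integral_add) (auto simp: Int_absorb2)
  finally show ?thesis
    by (subst (asm) ennreal_le_iff) (auto intro!: add_nonneg_nonneg Bochner_Integration.integral_nonneg \<psi>(2))
qed

text \<open>The error term in the previous estimate does not change when \<open>\<psi>\<close> is multiplied by a large
  constant.\<close>

lemma T_le_integral:
  assumes \<psi>: "\<psi> \<in> test_functions \<Omega>" "\<And>x. 0 \<le> \<psi> x"
  shows "T \<psi> \<le> (LINT x|M. \<psi> x)"
proof (rule field_le_epsilon)
  fix e :: real assume e: "0 < e"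
  obtain C where C: "compact C" "C \<subseteq> \<Omega>" "\<And>x. x \<notin> C \<Longrightarrow> \<psi> x = 0" using test_functionE[OF \<psi>(1)] by metis
  obtain n :: nat where n: "measure M C / e < real n" using reals_Archimedean2 by blast
  then have n0: "0 < real n" using e by (meson divide_nonneg_pos le_less_trans measure_nonneg)
  have "T (\<lambda>x. real n * \<psi> x) \<le> (LINT x|M. real n * \<psi> x) + measure M C"
    by (rule T_le_integral_plus[OF test_cmult[OF \<psi>(1)] _ C(1,2)]) (use C(3) \<psi>(2) in auto)
  then have "real n * T \<psi> \<le> real n * (LINT x|M. \<psi> x) + measure M C" by (simp add: T_cmult \<psi>)
  also have "measure M C \<le> real n * e" using n e by (simp add: field_simps)
  finally have "real n * T \<psi> \<le> real n * ((LINT x|M. \<psi> x) + e)" by (simp add: algebra_simps)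
  then show "T \<psi> \<le> (LINT x|M. \<psi> x) + e" using n0 by simp
qed

text \<open>The difference \<open>\<integral> \<psi> - T \<psi>\<close> is nonnegative for \<open>\<psi> \<ge> 0\<close> and linear, hence it is monotone in
  \<open>\<psi>\<close>. Along the plateaus it increases with \<open>n\<close>, while \<open>T\<close> and the integral both converge to the
  measure of the ball. Therefore it cannot be positive for \<open>plateau c r 1\<close>, which is the bump.\<close>

lemma integral_bump_le_T:
  assumes r: "0 < r" "cball c r \<subseteq> \<Omega>"
  shows "(LINT x|M. bump c r x) \<le> T (bump c r)"
proof (rule field_le_epsilon)
  fix e :: real assume e: "0 < e"
  have t: "plateau c r n \<in> test_functions \<Omega>" for n by (rule plateau_test[OF r])
  have T0: "0 \<le> T (plateau c r n)" for n by (intro T_nonneg t plateau)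
  have bs: "ball c r \<in> sets M"
    using r ball_subset_cball[of c r] \<Omega> by (auto simp: sets_M sets_restrict_space_iff)
  have bfin: "emeasure M (ball c r) < \<infinity>"
  proof (rule order_le_less_trans[OF emeasure_mono emeasure_M_compact_finite])
    show "cball c r \<in> sets M" using compact_in_restrict_borel[OF compact_cball r(2) \<Omega>] by (simp add: sets_M)
  qed (use r in auto)
  have "\<exists>n. measure M (ball c r) - e < T (plateau c r n)"
  proof (cases "measure M (ball c r) - e < 0")
    case True then show ?thesis using T0 by (intro exI[of _ 0]) (meson less_le_trans)
  next
    case False
    then have "ennreal (measure M (ball c r) - e) < ennreal (measure M (ball c r))" using e by (intro ennreal_lessI) auto
    also have "\<dots> = emeasure M (ball c r)" using bfin by (simp add: emeasure_eq_ennreal_measure less_top)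
    also have "\<dots> = upper_integral (\<lambda>x. indicator (ball c r) x * ennreal 1)"
      using bs by (simp add: emeasure_M sets_M outer_def)
    also have "\<dots> \<le> (SUP n. ennreal (T (\<lambda>x. plateau c r n x * 1)))"
      by (rule upper_integral_ball_le_SUP[OF r(1)]) (use t in auto)
    finally obtain n where "ennreal (measure M (ball c r) - e) < ennreal (T (plateau c r n))"
      unfolding less_SUP_iff by auto
    then show ?thesis using False by (auto simp: ennreal_less_iff)
  qed
  then obtain n where n: "measure M (ball c r) - e < T (plateau c r n)" by blast
  then have n': "measure M (ball c r) - e < T (plateau c r (Suc n))"
    using T_mono[OF t t, of n "Suc n"] plateau(4)[of n "Suc n" c r] by fastforce
  have t1: "bump c r \<in> test_functions \<Omega>" by (rule bump_test[OF r])
  have "T (\<lambda>x. plateau c r (Suc n) x - bump c r x) \<le> (LINT x|M. plateau c r (Suc n) x - bump c r x)"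
    using plateau(4)[of 1 "Suc n" c r] plateau(6)[of c r] by (intro T_le_integral test_diff t t1) simp
  then have "(LINT x|M. bump c r x) - T (bump c r) \<le> (LINT x|M. plateau c r (Suc n) x) - T (plateau c r (Suc n))"
    using M_integrable[OF t] M_integrable[OF t1] by (simp add: T_diff[OF t t1])
  also have "(LINT x|M. plateau c r (Suc n) x) \<le> (LINT x|M. indicator (ball c r) x)"
  proof (rule integral_mono[OF M_integrable[OF t]])
    show "integrable M (indicator (ball c r) :: _ \<Rightarrow> real)" using bs bfin by (intro integrable_real_indicator) auto
    show "plateau c r (Suc n) x \<le> indicator (ball c r) x" for x
      using plateau(3)[of c r "Suc n" x] plateau(7)[OF r(1), of x c "Suc n"] by (cases "x \<in> ball c r") auto
  qed
  also have "\<dots> = measure M (ball c r)"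
    using sets.sets_into_space[OF bs] by (simp add: Int_absorb2)
  finally show "(LINT x|M. bump c r x) \<le> T (bump c r) + e" using n' by simp
qed

text \<open>Again by monotonicity of \<open>\<integral> \<psi> - T \<psi>\<close>, since \<open>\<psi>\<close> is dominated by a multiple of a sum of
  bumps.\<close>

lemma T_eq_integral_nonneg:
  assumes \<psi>: "\<psi> \<in> test_functions \<Omega>" "\<And>x. 0 \<le> \<psi> x"
  shows "T \<psi> = (LINT x|M. \<psi> x)"
proof (rule antisym[OF T_le_integral[OF assms]])
  obtain C B where C: "compact C" "C \<subseteq> \<Omega>" "\<And>x. x \<notin> C \<Longrightarrow> \<psi> x = 0" "0 \<le> B" "\<And>x. \<bar>\<psi> x\<bar> \<le> B"
    using test_functionE[OF \<psi>(1)] by metis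
  obtain I :: "('a \<times> real) set" and k where I: "finite I" "\<And>c r. (c, r) \<in> I \<Longrightarrow> 0 < r \<and> cball c r \<subseteq> \<Omega>" "0 \<le> k"
    "\<And>x. x \<in> C \<Longrightarrow> 1 \<le> k * (\<Sum>(c,r)\<in>I. bump c r x)"
    using compact_dominated_by_bumps[OF C(1,2) \<Omega>] by metis
  define s where "s x = (\<Sum>q\<in>I. bump (fst q) (snd q) x)" for x
  have bt: "bump (fst q) (snd q) \<in> test_functions \<Omega>" if "q \<in> I" for q
    using I(2)[of "fst q" "snd q"] that by (intro bump_test) auto
  have st: "s \<in> test_functions \<Omega>" unfolding s_def by (intro test_sum bt)
  have s0: "0 \<le> s x" for x unfolding s_def by (intro sum_nonneg bump_bounds)
  have le: "\<psi> x \<le> (B * k) * s x" for x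
  proof (cases "x \<in> C")
    case True
    have "\<psi> x \<le> B * 1" using C(5)[of x] by simp
    also have "\<dots> \<le> B * (k * s x)" using I(4)[OF True] C(4) by (intro mult_left_mono) (auto simp: s_def split_def)
    finally show ?thesis by simp
  next
    case False then show ?thesis using C I s0 by simp
  qed
  have "(LINT x|M. s x) \<le> T s"
    unfolding s_def using bt I integral_bump_le_T
    by (subst T_sum, simp, subst Bochner_Integration.integral_sum) (auto intro!: M_integrable sum_mono)
  moreover have "T (\<lambda>x. (B * k) * s x - \<psi> x) \<le> (LINT x|M. (B * k) * s x - \<psi> x)"
    using le by (intro T_le_integral test_diff test_cmult st \<psi>) simp
  then have "B * k * T s - T \<psi> \<le> B * k * (LINT x|M. s x) - (LINT x|M. \<psi> x)"
    using M_integrable[OF st] M_integrable[OF \<psi>(1)] by (simp add: T_diff test_cmult st \<psi> T_cmult)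
  ultimately show "(LINT x|M. \<psi> x) \<le> T \<psi>"
    using mult_left_mono[of "LINT x|M. s x" "T s" "B * k"] C(4) I(3) by auto
qed

lemma T_eq_integral:
  assumes \<psi>: "\<psi> \<in> test_functions \<Omega>"
  shows "T \<psi> = (LINT x|M. \<psi> x)"
proof -
  obtain C B where C: "compact C" "C \<subseteq> \<Omega>" "\<And>x. x \<notin> C \<Longrightarrow> \<psi> x = 0" "0 \<le> B" "\<And>x. \<bar>\<psi> x\<bar> \<le> B"
    using test_functionE[OF \<psi>] by metis
  obtain \<eta> where \<eta>: "\<eta> \<in> test_functions \<Omega>" "\<And>x. 0 \<le> \<eta> x" "\<And>x. x \<in> C \<Longrightarrow> 1 \<le> \<eta> x"
    using compact_test_ge_1[OF C(1,2) \<Omega>] by metis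
  have \<eta>B: "(\<lambda>x. B * \<eta> x) \<in> test_functions \<Omega>" by (intro test_cmult \<eta>)
  have nn: "0 \<le> B * \<eta> x" "0 \<le> B * \<eta> x + \<psi> x" for x
  proof -
    show "0 \<le> B * \<eta> x" using C(4) \<eta>(2) by simp
    have "B * 1 \<le> B * \<eta> x" if "x \<in> C" using \<eta>(3)[OF that] C(4) by (intro mult_left_mono)
    then show "0 \<le> B * \<eta> x + \<psi> x" using C(3)[of x] C(5)[of x] \<open>0 \<le> B * \<eta> x\<close> by (cases "x \<in> C") auto
  qed
  have "T (\<lambda>x. B * \<eta> x + \<psi> x) = (LINT x|M. B * \<eta> x + \<psi> x)"
    by (intro T_eq_integral_nonneg test_add \<eta>B \<psi> nn)
  moreover have "T (\<lambda>x. B * \<eta> x) = (LINT x|M. B * \<eta> x)"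
    by (intro T_eq_integral_nonneg \<eta>B nn)
  ultimately show ?thesis
    using M_integrable[OF \<eta>B] M_integrable[OF \<psi>] by (simp add: T_add[OF \<eta>B \<psi>])
qed

end

text \<open>Inner regularity holds for finite Borel measures on the whole space; it is applied to the
  restrictions to an exhausting sequence of compact sets.\<close>

lemma radon_measure_onI:
  fixes \<Omega> :: "'a::euclidean_space set"
  assumes N: "space N = \<Omega>" "sets N = sets (restrict_space borel \<Omega>)"
    and fin: "\<And>C. compact C \<Longrightarrow> C \<subseteq> \<Omega> \<Longrightarrow> emeasure N C < \<infinity>" and \<Omega>: "open \<Omega>"
  shows "radon_measure_on \<Omega> N"
  unfolding radon_measure_on_def
proof (intro conjI ballI N allI impI fin; (elim conjE; assumption)?)
  fix B assume B: "B \<in> sets N"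
  have B\<Omega>: "B \<subseteq> \<Omega>" "B \<in> sets borel" using B \<Omega> by (auto simp: N(2) sets_restrict_space_iff)
  obtain C where C: "\<And>n. compact(C n)" "\<And>n. C n \<subseteq> \<Omega>" "\<And>n. C n \<subseteq> interior(C(Suc n))" "\<Union>(range C) = \<Omega>"
    using open_Union_compact_subsets[OF \<Omega>] by metis
  have Cs: "C n \<in> sets N" for n using compact_in_restrict_borel[OF C(1,2) \<Omega>] N by simp
  have inc: "incseq (\<lambda>n. B \<inter> C n)"
    by (rule incseq_SucI) (use C(3) interior_subset in blast)
  have "emeasure N B = (SUP n. emeasure N (B \<inter> C n))"
  proof -
    have "(\<Union>n. B \<inter> C n) = B" using B\<Omega> C(4) by blast
    then show ?thesis using SUP_emeasure_incseq[OF _ inc, of N] B Cs by (auto simp: image_subset_iff)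
  qed
  also have "\<dots> \<le> (SUP K\<in>{K. compact K \<and> K \<subseteq> B}. emeasure N K)"
  proof (rule SUP_least)
    fix n
    define N' where "N' = density (distr N borel id) (indicator (C n))"
    have id: "id \<in> measurable N borel"
      using measurable_restrict_space1[of id borel borel \<Omega>] by (simp add: measurable_cong_sets[OF N(2) refl])
    have N': "emeasure N' A = emeasure N (A \<inter> C n)" if A: "A \<in> sets borel" for A
    proof -
      have "emeasure N' A = emeasure (distr N borel id) (C n \<inter> A)"
        unfolding N'_def using A borel_compact[OF C(1)] 
        by (subst emeasure_density) (auto simp: nn_integral_indicator[symmetric] indicator_inter_arith simp del: nn_integral_indicator)
      also have "\<dots> = emeasure N (A \<inter> C n)"
        using A borel_compact[OF C(1)] id C(2)[of n] N(1) by (subst emeasure_distr) (auto intro!: arg_cong[of _ _ "emeasure N"])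
      finally show ?thesis .
    qed
    have "emeasure N' (space N') \<noteq> \<infinity>"
      using N'[of UNIV] fin[OF C(1,2)[of n]] by (auto simp: N'_def)
    then have "emeasure N' (B \<inter> C n) = (SUP K\<in>{K. K \<subseteq> B \<inter> C n \<and> compact K}. emeasure N' K)"
      using B\<Omega> borel_compact[OF C(1)] by (intro inner_regular) (auto simp: N'_def)
    also have "\<dots> \<le> (SUP K\<in>{K. compact K \<and> K \<subseteq> B}. emeasure N K)"
    proof (rule SUP_mono, safe)
      fix K assume K: "K \<subseteq> B \<inter> C n" "compact K"
      then have "emeasure N' K = emeasure N K" using N'[OF borel_compact[OF K(2)]] by (simp add: inf.absorb1)
      then show "\<exists>m\<in>{K. compact K \<and> K \<subseteq> B}. emeasure N' K \<le> emeasure N m" using K by (intro bexI[of _ K]) auto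
    qed
    finally show "emeasure N (B \<inter> C n) \<le> (SUP K\<in>{K. compact K \<and> K \<subseteq> B}. emeasure N K)"
      using N'[of "B \<inter> C n"] B\<Omega> borel_compact[OF C(1)] by (simp add: Int_assoc)
  qed
  finally have le: "emeasure N B \<le> (SUP K\<in>{K. compact K \<and> K \<subseteq> B}. emeasure N K)" .
  show "emeasure N B = (SUP K\<in>{K. compact K \<and> K \<subseteq> B}. emeasure N K)"
    by (rule antisym[OF le SUP_least]) (use B in \<open>auto intro: emeasure_mono\<close>)
qed

text \<open>Products of plateaus converge to indicators of finite intersections of balls, and these
  sets form an intersection-stable generator of the Borel sets.\<close>

lemma measure_eq_if_test_integrals_eq:
  fixes \<Omega> :: "'a::euclidean_space set"
  assumes \<Omega>: "open \<Omega>"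
    and N: "sets N1 = sets (restrict_space borel \<Omega>)" "sets N2 = sets (restrict_space borel \<Omega>)"
    and fin: "\<And>C. compact C \<Longrightarrow> C \<subseteq> \<Omega> \<Longrightarrow> emeasure N1 C < \<infinity>" "\<And>C. compact C \<Longrightarrow> C \<subseteq> \<Omega> \<Longrightarrow> emeasure N2 C < \<infinity>"
    and eq: "\<And>\<psi>. \<psi> \<in> test_functions \<Omega> \<Longrightarrow> (LINT x|N1. \<psi> x) = (LINT x|N2. \<psi> x)"
  shows "N1 = N2"
proof -
  define good where "good I \<longleftrightarrow> finite I \<and> I \<noteq> {} \<and> (\<forall>(c,r)\<in>I. 0 < r \<and> cball c r \<subseteq> \<Omega>)" for I :: "('a \<times> real) set"
  define X where "X I = (\<Inter>q\<in>I. ball (fst q) (snd q))" for I :: "('a \<times> real) set"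
  define E where "E = X ` {I. good I}"
  have Xsub: "\<exists>C. compact C \<and> X I \<subseteq> C \<and> C \<subseteq> \<Omega>" if "good I" for I
  proof -
    obtain q where q: "q \<in> I" using \<open>good I\<close> unfolding good_def by blast
    then show ?thesis using \<open>good I\<close> ball_subset_cball[of "fst q" "snd q"]
      by (intro exI[of _ "cball (fst q) (snd q)"]) (force simp: good_def X_def)
  qed
  have Xopen: "open (X I)" if "good I" for I using that by (auto simp: X_def good_def intro!: open_INT)
  have Xs: "X I \<in> sets (restrict_space borel \<Omega>)" if "good I" for I
    using Xsub[OF that] Xopen[OF that] \<Omega> by (auto simp: sets_restrict_space_iff)
  have lim: "(\<lambda>n. LINT x|N. (\<Prod>q\<in>I. plateau (fst q) (snd q) n x)) \<longlonglongrightarrow> measure N (X I)" and Xfin: "emeasure N (X I) < \<infinity>"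
    if good: "good I" and N: "sets N = sets (restrict_space borel \<Omega>)"
      and fin: "\<And>C. compact C \<Longrightarrow> C \<subseteq> \<Omega> \<Longrightarrow> emeasure N C < \<infinity>" for N I
  proof -
    obtain C where C: "compact C" "X I \<subseteq> C" "C \<subseteq> \<Omega>" using Xsub[OF good] by blast
    have Cs: "C \<in> sets N" using compact_in_restrict_borel[OF C(1,3) \<Omega>] N by simp
    show Xf: "emeasure N (X I) < \<infinity>"
      using emeasure_mono[OF C(2) Cs] fin[OF C(1,3)] by (rule order_le_less_trans)
    have XN: "X I \<in> sets N" using Xs[OF good] N by simp
    have sm: "(\<lambda>x. \<Prod>q\<in>I. plateau (fst q) (snd q) n x) \<in> borel_measurable N" for n
    proof -
      have "(\<lambda>x. \<Prod>q\<in>I. plateau (fst q) (snd q) n x) \<in> borel_measurable borel"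
        by (intro smooth_borel smooth_prod plateau)
      then show ?thesis using measurable_restrict_space1[of _ borel borel \<Omega>] by (simp add: measurable_cong_sets[OF N refl])
    qed
    have z: "(\<Prod>q\<in>I. plateau (fst q) (snd q) n x) = 0" if xI: "x \<notin> X I" for n x
    proof -
      obtain q where q: "q \<in> I" "x \<notin> ball (fst q) (snd q)" using xI unfolding X_def by blast
      then have "plateau (fst q) (snd q) n x = 0" using good by (intro plateau(7)) (auto simp: good_def)
      then show ?thesis using q good by (intro prod_zero) (auto simp: good_def)
    qed
    have "(\<lambda>n. LINT x|N. (\<Prod>q\<in>I. plateau (fst q) (snd q) n x)) \<longlonglongrightarrow> (LINT x|N. indicator (X I) x)"
    proof (rule integral_dominated_convergence[where w="indicator (X I)"])
      show "AE x in N. (\<lambda>n. \<Prod>q\<in>I. plateau (fst q) (snd q) n x) \<longlonglongrightarrow> indicator (X I) x"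
      proof (rule AE_I2)
        fix x
        show "(\<lambda>n. \<Prod>q\<in>I. plateau (fst q) (snd q) n x) \<longlonglongrightarrow> indicator (X I) x"
        proof (cases "x \<in> X I")
          case True
          have "(\<lambda>n. \<Prod>q\<in>I. plateau (fst q) (snd q) n x) \<longlonglongrightarrow> (\<Prod>q\<in>I. 1)"
            using True good by (intro tendsto_prod plateau(8)) (auto simp: X_def good_def)
          then show ?thesis using True by simp
        qed (simp add: z)
      qed
      show "AE x in N. norm (\<Prod>q\<in>I. plateau (fst q) (snd q) n x) \<le> indicator (X I) x" for n
      proof (rule AE_I2)
        fix x
        have "(\<Prod>q\<in>I. plateau (fst q) (snd q) n x) \<le> 1" "0 \<le> (\<Prod>q\<in>I. plateau (fst q) (snd q) n x)"
          by (auto intro!: prod_le_1 prod_nonneg plateau)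
        then show "norm (\<Prod>q\<in>I. plateau (fst q) (snd q) n x) \<le> indicator (X I) x"
          by (cases "x \<in> X I") (simp_all add: z)
      qed
    qed (use sm XN Xf in auto)
    then show "(\<lambda>n. LINT x|N. (\<Prod>q\<in>I. plateau (fst q) (snd q) n x)) \<longlonglongrightarrow> measure N (X I)"
      using sets.sets_into_space[OF XN] by (simp add: Int_absorb2)
  qed
  have sets_E: "sets (restrict_space borel \<Omega>) = sigma_sets \<Omega> E"
  proof (rule antisym)
    have E\<Omega>: "E \<subseteq> Pow \<Omega>" using Xsub by (fastforce simp: E_def)
    show "sets (restrict_space borel \<Omega>) \<subseteq> sigma_sets \<Omega> E"
    proof (rule restrict_borel_subset_if_balls[OF sigma_algebra_sigma_sets[OF E\<Omega>] \<Omega>])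
      fix c r assume "0 < r" "cball c r \<subseteq> \<Omega>"
      then have "ball c r \<in> E" unfolding E_def by (intro image_eqI[of _ _ "{(c, r)}"]) (auto simp: good_def X_def)
      then show "ball c r \<in> sigma_sets \<Omega> E" by auto
    qed
    show "sigma_sets \<Omega> E \<subseteq> sets (restrict_space borel \<Omega>)"
      using sets.sigma_sets_subset[of E "restrict_space borel \<Omega>"] Xs by (auto simp: E_def space_restrict_space)
  qed
  let ?F = "{ball c r |c r. 0 < r \<and> cball c r \<subseteq> \<Omega>}"
  obtain F where F: "F \<subseteq> ?F" "countable F" "\<Union>F = \<Union>?F"
    using Lindelof[of ?F] by blast
  have ballE: "A \<in> E" if "A \<in> ?F" for A
    using that unfolding E_def by (auto intro!: image_eqI[where x="{(_, _)}"] simp: good_def X_def)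
  have FU: "\<Union>?F = \<Omega>"
  proof (rule antisym)
    show "\<Union>?F \<subseteq> \<Omega>" using ball_subset_cball by blast
    show "\<Omega> \<subseteq> \<Union>?F"
    proof
      fix x assume "x \<in> \<Omega>"
      then obtain e where "e > 0" "cball x e \<subseteq> \<Omega>" using \<Omega> open_contains_cball by blast
      then have "ball x e \<in> ?F" "x \<in> ball x e" by auto
      then show "x \<in> \<Union>?F" by blast
    qed
  qed
  show ?thesis
  proof (rule measure_eqI_generator_eq_countable[of E \<Omega> N1 N2 F])
    show "Int_stable E"
    proof (rule Int_stableI)
      fix a b assume "a \<in> E" "b \<in> E"
      then obtain I J where "a = X I" "good I" "b = X J" "good J" by (auto simp: E_def)
      then have "a \<inter> b = X (I \<union> J)" "good (I \<union> J)" by (auto simp: X_def good_def)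
      then show "a \<inter> b \<in> E" by (auto simp: E_def)
    qed
    show "E \<subseteq> Pow \<Omega>" using Xsub by (fastforce simp: E_def)
    show "emeasure N1 A = emeasure N2 A" if A: "A \<in> E" for A
    proof -
      obtain I where I: "A = X I" "good I" using A by (auto simp: E_def)
      have t: "(\<lambda>x. \<Prod>q\<in>I. plateau (fst q) (snd q) n x) \<in> test_functions \<Omega>" for n
      proof -
        obtain q where q: "q \<in> I" using I(2) by (auto simp: good_def)
        then have "0 < snd q" "cball (fst q) (snd q) \<subseteq> \<Omega>" using I(2) by (auto simp: good_def split_def)
        then have "(\<lambda>x. (\<Prod>q\<in>I - {q}. plateau (fst q) (snd q) n x) * plateau (fst q) (snd q) n x) \<in> test_functions \<Omega>"
          by (intro test_mult plateau_test smooth_prod plateau)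
        then show ?thesis using q I(2) by (subst prod.remove[of I q]) (auto simp: good_def mult.commute)
      qed
      have "measure N1 (X I) = measure N2 (X I)"
        using lim[OF I(2) N(1) fin(1)] lim[OF I(2) N(2) fin(2)] eq[OF t] LIMSEQ_unique by auto
      then show ?thesis
        using Xfin[OF I(2) N(1) fin(1)] Xfin[OF I(2) N(2) fin(2)] unfolding I(1)
        by (simp add: emeasure_eq_ennreal_measure less_top)
    qed
    show "F \<subseteq> E" using F(1) ballE by blast
    show "emeasure N1 a \<noteq> \<infinity>" if a: "a \<in> F" for a
    proof -
      have "a \<in> E" using ballE F(1) a by blast
      then obtain I where "a = X I" "good I" by (auto simp: E_def)
      then show ?thesis using Xfin[OF _ N(1) fin(1)] by force
    qed
  qed (use F FU N sets_E in auto)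
qed

theorem positive_distribution_representation:
  assumes "positive_distribution \<Omega> T"
  shows "\<exists>!\<mu>. radon_measure_on \<Omega> \<mu> \<and> distr_is_measure \<Omega> T \<mu>"
proof -
  interpret positive_distribution \<Omega> T by fact
  show ?thesis
  proof (rule ex1I[of _ M])
    show "radon_measure_on \<Omega> M \<and> distr_is_measure \<Omega> T M"
      using radon_measure_onI[OF space_M sets_M emeasure_M_compact_finite \<Omega>] T_eq_integral
      by (auto simp: distr_is_measure_def)
    fix \<mu> assume *: "radon_measure_on \<Omega> \<mu> \<and> distr_is_measure \<Omega> T \<mu>"
    show "\<mu> = M"
      by (rule measure_eq_if_test_integrals_eq[OF \<Omega> _ sets_M _ emeasure_M_compact_finite])
        (use * T_eq_integral in \<open>auto simp: radon_measure_on_def distr_is_measure_def\<close>)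
  qed
qed

section \<open>The fundamental lemma and weak gradients\<close>

lemma id_measurable_restrict_borel:
  "open \<Omega> \<Longrightarrow> id \<in> measurable (lebesgue_on \<Omega>) (restrict_space borel (\<Omega>::'a::euclidean_space set))"
  by (intro measurable_restrict_space2)
    (auto simp: space_restrict_space intro!: measurable_restrict_space1 measurable_completion)

text \<open>The fundamental lemma of the calculus of variations. The positive and the negative part of
  \<open>h\<close> are densities of two measures that agree on test functions, hence on Borel sets. Evaluated on
  the set where \<open>h\<close> is positive, one of them vanishes.\<close>

lemma AE_eq_0_if_test_integrals_eq_0:
  fixes h :: "'a::euclidean_space \<Rightarrow> real"
  assumes \<Omega>: "open \<Omega>" and h: "locally_integrable \<Omega> h"
    and zero: "\<And>\<psi>. \<psi> \<in> test_functions \<Omega> \<Longrightarrow> (LINT x|lebesgue_on \<Omega>. h x * \<psi> x) = 0"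
  shows "AE x in lebesgue_on \<Omega>. h x = 0"
proof -
  define g where "g s x = max 0 (s * h x)" for s x
  define N where "N s = distr (density (lebesgue_on \<Omega>) (\<lambda>x. ennreal (g s x))) (restrict_space borel \<Omega>) id" for s
  have hm [measurable]: "h \<in> borel_measurable (lebesgue_on \<Omega>)" using h by (simp add: locally_integrable_def)
  have gm [measurable]: "g s \<in> borel_measurable (lebesgue_on \<Omega>)" for s unfolding g_def by measurable
  have idm: "id \<in> measurable (density (lebesgue_on \<Omega>) (\<lambda>x. ennreal (g s x))) (restrict_space borel \<Omega>)" for s
    using id_measurable_restrict_borel[OF \<Omega>] by simp
  have gl: "locally_integrable \<Omega> (g s)" for s
    using h unfolding locally_integrable_def g_def by auto
  have emN: "emeasure (N s) A = (\<integral>\<^sup>+x. ennreal (g s x) * indicator A x \<partial>lebesgue_on \<Omega>)"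
    if A: "A \<in> sets (restrict_space borel \<Omega>)" for s A
  proof -
    have "id -` A \<inter> space (density (lebesgue_on \<Omega>) (\<lambda>x. ennreal (g s x))) = A"
      using A sets.sets_into_space[OF A] by (auto simp: space_restrict_space)
    moreover from measurable_sets[OF id_measurable_restrict_borel[OF \<Omega>] A] have "A \<in> sets (lebesgue_on \<Omega>)"
      using sets.sets_into_space[OF A] by (auto simp: space_restrict_space Int_absorb2)
    ultimately show ?thesis unfolding N_def using A idm by (simp add: emeasure_distr emeasure_density)
  qed
  have finN: "emeasure (N s) C < \<infinity>" if C: "compact C" "C \<subseteq> \<Omega>" for s C
  proof -
    have "integrable (lebesgue_on \<Omega>) (\<lambda>x. indicator C x *\<^sub>R g s x)"
      using gl C \<Omega> by (intro integrable_lebesgue_on_compact_support) (auto simp: locally_integrable_def)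
    moreover have "ennreal (g s x) * indicator C x = ennreal (norm (indicator C x *\<^sub>R g s x))" for x
      by (auto simp: g_def split: split_indicator)
    ultimately show ?thesis unfolding emN[OF compact_in_restrict_borel[OF C \<Omega>]]
      by (simp add: integrable_iff_bounded)
  qed
  have intN: "(LINT x|N s. \<psi> x) = (LINT x|lebesgue_on \<Omega>. g s x * \<psi> x)" if \<psi>: "\<psi> \<in> test_functions \<Omega>" for s \<psi>
  proof -
    have m: "\<psi> \<in> borel_measurable (restrict_space borel \<Omega>)" by (rule test_function_measurable[OF \<psi> refl])
    have m2: "\<psi> \<in> borel_measurable (lebesgue_on \<Omega>)"
      by (rule lebesgue_on_smooth_measurable(1)[OF test_smooth[OF \<psi>]])
    have "(LINT x|N s. \<psi> x) = (LINT x|density (lebesgue_on \<Omega>) (\<lambda>x. ennreal (g s x)). \<psi> x)"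
      unfolding N_def by (subst integral_distr[OF idm m]) simp
    also have "\<dots> = (LINT x|lebesgue_on \<Omega>. g s x *\<^sub>R \<psi> x)"
      by (rule integral_density[OF m2 gm]) (simp add: g_def)
    finally show ?thesis by simp
  qed
  have NN: "N 1 = N (-1)"
  proof (rule measure_eq_if_test_integrals_eq[OF \<Omega>])
    fix \<psi> assume \<psi>: "\<psi> \<in> test_functions \<Omega>"
    have "(LINT x|lebesgue_on \<Omega>. g 1 x * \<psi> x) - (LINT x|lebesgue_on \<Omega>. g (-1) x * \<psi> x)
      = (LINT x|lebesgue_on \<Omega>. g 1 x * \<psi> x - g (-1) x * \<psi> x)"
      by (rule Bochner_Integration.integral_diff[symmetric]) (intro integrable_test_mult gl \<Omega> \<psi>)+
    also have "\<dots> = (LINT x|lebesgue_on \<Omega>. h x * \<psi> x)"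
      by (rule Bochner_Integration.integral_cong) (auto simp: g_def max_def)
    finally show "(LINT x|N 1. \<psi> x) = (LINT x|N (-1). \<psi> x)" using zero[OF \<psi>] intN[OF \<psi>] by simp
  qed (use finN in \<open>auto simp: N_def\<close>)
  have AE: "AE x in lebesgue_on \<Omega>. \<not> 0 < s * h x" if s: "s = 1 \<or> s = -1" for s
  proof -
    have "{x \<in> space (lebesgue_on \<Omega>). 0 < s * h x} \<in> sets (lebesgue_on \<Omega>)" by measurable
    then have "{x \<in> \<Omega>. 0 < s * h x} \<in> sets lebesgue"
      using \<Omega> by (simp add: sets_restrict_space_iff)
    then obtain C T where CT: "fsigma C" "T \<in> null_sets lebesgue" "C \<union> T = {x \<in> \<Omega>. 0 < s * h x}"
      using lebesgue_set_almost_fsigma by metis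
    have "C \<in> sets borel" using CT(1) by (auto elim!: fsigma.cases)
    then have C: "C \<in> sets (restrict_space borel \<Omega>)"
      using CT(3) \<Omega> by (auto simp: sets_restrict_space_iff)
    have "N s = N (- s)" using NN s by auto
    then have "emeasure (N s) C = (\<integral>\<^sup>+x. ennreal (g (-s) x) * indicator C x \<partial>lebesgue_on \<Omega>)" using emN[OF C] by simp
    also have "\<dots> = (\<integral>\<^sup>+x. 0 \<partial>lebesgue_on \<Omega>)"
    proof (rule nn_integral_cong)
      fix x
      have "x \<in> C \<Longrightarrow> x \<in> {x \<in> \<Omega>. 0 < s * h x}" using CT(3) by blast
      then have "x \<notin> C \<or> - s * h x \<le> 0" by auto
      then show "ennreal (g (-s) x) * indicator C x = 0" by (auto simp: g_def)
    qed
    finally have "(\<integral>\<^sup>+x. ennreal (g s x) * indicator C x \<partial>lebesgue_on \<Omega>) = 0" using emN[OF C, of s] by simp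
    moreover have "C \<in> sets (lebesgue_on \<Omega>)"
      using measurable_sets[OF id_measurable_restrict_borel[OF \<Omega>] C] sets.sets_into_space[OF C]
      by (auto simp: space_restrict_space Int_absorb2)
    ultimately have "AE x in lebesgue_on \<Omega>. ennreal (g s x) * indicator C x = 0"
      by (subst (asm) nn_integral_0_iff_AE) auto
    moreover have "AE x in lebesgue_on \<Omega>. x \<notin> T"
      using AE_not_in[OF CT(2)] \<Omega> by (subst AE_restrict_space_iff) auto
    moreover have "AE x in lebesgue_on \<Omega>. x \<in> \<Omega>" using AE_space[of "lebesgue_on \<Omega>"] by simp
    ultimately show ?thesis
    proof eventually_elim
      case (elim x)
      show ?case
      proof
        assume pos: "0 < s * h x"
        have "x \<notin> C" using elim(1) pos by (auto simp: g_def indicator_def ennreal_eq_0_iff)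
        moreover have "x \<in> C \<union> T" using pos elim CT(3) by auto
        ultimately show False using elim by auto
      qed
    qed
  qed
  have "AE x in lebesgue_on \<Omega>. \<not> 0 < 1 * h x" "AE x in lebesgue_on \<Omega>. \<not> 0 < -1 * h x" by (intro AE; simp)+
  then show ?thesis by eventually_elim auto
qed

lemma locally_integrable_inner:
  "locally_integrable \<Omega> V \<Longrightarrow> locally_integrable \<Omega> (\<lambda>x. V x \<bullet> b)"
  by (auto simp: locally_integrable_def)

text \<open>Makes the choice in \<open>weak_gradient\<close> harmless: every identity for a weak gradient holds for
  the chosen one almost everywhere.\<close>

lemma has_weak_gradient_unique:
  fixes u :: "'a::euclidean_space \<Rightarrow> real"
  assumes \<Omega>: "open \<Omega>" and V: "has_weak_gradient \<Omega> u V" and W: "has_weak_gradient \<Omega> u W"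
  shows "AE x in lebesgue_on \<Omega>. V x = W x"
proof -
  have li: "locally_integrable \<Omega> (\<lambda>x. V x \<bullet> b)" "locally_integrable \<Omega> (\<lambda>x. W x \<bullet> b)" for b
    using V W by (auto simp: has_weak_gradient_def intro: locally_integrable_inner)
  have "AE x in lebesgue_on \<Omega>. V x \<bullet> b - W x \<bullet> b = 0" if b: "b \<in> Basis" for b
  proof (rule AE_eq_0_if_test_integrals_eq_0[OF \<Omega>])
    show "locally_integrable \<Omega> (\<lambda>x. V x \<bullet> b - W x \<bullet> b)"
      using li[of b] by (auto simp: locally_integrable_def)
    fix \<psi> assume \<psi>: "\<psi> \<in> test_functions \<Omega>"
    show "(LINT x|lebesgue_on \<Omega>. (V x \<bullet> b - W x \<bullet> b) * \<psi> x) = 0"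
      unfolding left_diff_distrib
      using V W \<psi> b integrable_test_mult(1)[OF li(1) \<Omega> \<psi>] integrable_test_mult(1)[OF li(2) \<Omega> \<psi>]
      by (subst Bochner_Integration.integral_diff) (auto simp: has_weak_gradient_def)
  qed
  then have "AE x in lebesgue_on \<Omega>. \<forall>b\<in>Basis. V x \<bullet> b - W x \<bullet> b = 0"
    by (subst AE_finite_all) auto
  then show ?thesis by eventually_elim (simp add: euclidean_eq_iff[of "V _"])
qed

lemma weak_gradient_AE_eq:
  fixes u :: "'a::euclidean_space \<Rightarrow> real"
  assumes "open \<Omega>" "has_weak_gradient \<Omega> u V"
  shows "AE x in lebesgue_on \<Omega>. weak_gradient \<Omega> u x = V x"
  using has_weak_gradient_unique[OF assms(1) someI[of "has_weak_gradient \<Omega> u", OF assms(2)] assms(2)]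
  by (simp add: weak_gradient_def)

section \<open>Convergence in \<open>L\<^sup>p\<close>\<close>

lemma norm_add_powr_le:
  fixes a b :: "'a::real_normed_vector"
  assumes "0 \<le> p"
  shows "norm (a + b) powr p \<le> 2 powr p * (norm a powr p + norm b powr p)"
proof -
  have "norm (a + b) \<le> 2 * max (norm a) (norm b)" using norm_triangle_ineq[of a b] by simp
  then have "norm (a + b) powr p \<le> (2 * max (norm a) (norm b)) powr p" using assms by (intro powr_mono2) auto
  also have "\<dots> = 2 powr p * max (norm a) (norm b) powr p" by (simp add: powr_mult)
  also have "max (norm a) (norm b) powr p \<le> norm a powr p + norm b powr p" by (simp add: max_def)
  finally show ?thesis by simp
qed

lemma Lp_on_bound:
  assumes "Lp_on p M f" "g \<in> borel_measurable M" "0 \<le> p" "0 \<le> C" "AE x in M. norm (g x) \<le> C * norm (f x)"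
  shows "Lp_on p M g"
  unfolding Lp_on_def
proof (rule conjI[OF assms(2) Bochner_Integration.integrable_bound])
  show "integrable M (\<lambda>x. C powr p * norm (f x) powr p)" using assms(1) by (simp add: Lp_on_def)
  show "(\<lambda>x. norm (g x) powr p) \<in> borel_measurable M" using assms(2) by measurable
  show "AE x in M. norm (norm (g x) powr p) \<le> norm (C powr p * norm (f x) powr p)"
    using assms(5)
  proof eventually_elim
    case (elim x)
    have "norm (g x) powr p \<le> (C * norm (f x)) powr p" using elim assms(3) by (intro powr_mono2) auto
    then show ?case using assms(4) by (simp add: powr_mult)
  qed
qed

lemma Lp_on_add:
  assumes "Lp_on p M f" "Lp_on p M g" "0 \<le> p"
  shows "Lp_on p M (\<lambda>x. f x + g x)"
proof -
  have [measurable]: "f \<in> borel_measurable M" "g \<in> borel_measurable M" using assms by (auto simp: Lp_on_def)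
  have m: "(\<lambda>x. f x + g x) \<in> borel_measurable M" by measurable
  show ?thesis unfolding Lp_on_def
  proof (rule conjI[OF m Bochner_Integration.integrable_bound])
    show "integrable M (\<lambda>x. 2 powr p * (norm (f x) powr p + norm (g x) powr p))" using assms by (simp add: Lp_on_def)
    show "(\<lambda>x. norm (f x + g x) powr p) \<in> borel_measurable M" by measurable
    show "AE x in M. norm (norm (f x + g x) powr p) \<le> norm (2 powr p * (norm (f x) powr p + norm (g x) powr p))"
      by (intro AE_I2) (simp add: norm_add_powr_le[OF assms(3)])
  qed
qed

lemma Lp_on_scaleR: "Lp_on p M f \<Longrightarrow> 0 \<le> p \<Longrightarrow> Lp_on p M (\<lambda>x. c *\<^sub>R f x)"
  by (rule Lp_on_bound[where C="\<bar>c\<bar>"]) (auto simp: Lp_on_def)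

lemma norm_powr_measurable:
  fixes g :: "'a \<Rightarrow> 'b::euclidean_space"
  shows "g \<in> borel_measurable M \<Longrightarrow> (\<lambda>x. ennreal (norm (g x) powr p)) \<in> borel_measurable M"
  by measurable

lemma Lp_tendsto_bound:
  assumes "Lp_tendsto p M w f" "0 \<le> p" "0 \<le> C"
    and m: "\<And>k. (\<lambda>x. w k x - f x) \<in> borel_measurable M"
    and le: "\<And>k x. x \<in> space M \<Longrightarrow> norm (w' k x - f' x) \<le> C * norm (w k x - f x)"
  shows "Lp_tendsto p M w' f'"
  unfolding Lp_tendsto_def
proof (rule tendsto_sandwich[OF _ _ tendsto_const])
  have "(\<lambda>k. ennreal (C powr p) * (\<integral>\<^sup>+x. ennreal (norm (w k x - f x) powr p) \<partial>M)) \<longlonglongrightarrow> ennreal (C powr p) * 0"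
    using assms(1) unfolding Lp_tendsto_def by (intro tendsto_mult_ennreal tendsto_const) auto
  then show "(\<lambda>k. ennreal (C powr p) * (\<integral>\<^sup>+x. ennreal (norm (w k x - f x) powr p) \<partial>M)) \<longlonglongrightarrow> 0" by simp
  have "(\<integral>\<^sup>+x. ennreal (norm (w' k x - f' x) powr p) \<partial>M) \<le> (\<integral>\<^sup>+x. ennreal (C powr p) * ennreal (norm (w k x - f x) powr p) \<partial>M)" for k
  proof (rule nn_integral_mono)
    fix x assume "x \<in> space M"
    then have "norm (w' k x - f' x) powr p \<le> (C * norm (w k x - f x)) powr p"
      using assms(2) le by (intro powr_mono2) auto
    then show "ennreal (norm (w' k x - f' x) powr p) \<le> ennreal (C powr p) * ennreal (norm (w k x - f x) powr p)"
      using assms(3) by (simp add: powr_mult ennreal_mult[symmetric] ennreal_leI)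
  qed
  also have "(\<integral>\<^sup>+x. ennreal (C powr p) * ennreal (norm (w k x - f x) powr p) \<partial>M)
      = ennreal (C powr p) * (\<integral>\<^sup>+x. ennreal (norm (w k x - f x) powr p) \<partial>M)" for k
    by (rule nn_integral_cmult[OF norm_powr_measurable[OF m]])
  finally show "\<forall>\<^sub>F k in sequentially. (\<integral>\<^sup>+x. ennreal (norm (w' k x - f' x) powr p) \<partial>M)
      \<le> ennreal (C powr p) * (\<integral>\<^sup>+x. ennreal (norm (w k x - f x) powr p) \<partial>M)"
    by (intro always_eventually allI)
qed auto

lemma Lp_tendsto_add:
  assumes "Lp_tendsto p M w f" "Lp_tendsto p M w' f'" "0 \<le> p"
    and m: "\<And>k. (\<lambda>x. w k x - f x) \<in> borel_measurable M" "\<And>k. (\<lambda>x. w' k x - f' x) \<in> borel_measurable M"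
  shows "Lp_tendsto p M (\<lambda>k x. w k x + w' k x) (\<lambda>x. f x + f' x)"
  unfolding Lp_tendsto_def
proof (rule tendsto_sandwich[OF _ _ tendsto_const])
  let ?I = "\<lambda>k. \<integral>\<^sup>+x. ennreal (norm (w k x - f x) powr p) \<partial>M" and ?J = "\<lambda>k. \<integral>\<^sup>+x. ennreal (norm (w' k x - f' x) powr p) \<partial>M"
  have "(\<lambda>k. ennreal (2 powr p) * (?I k + ?J k)) \<longlonglongrightarrow> ennreal (2 powr p) * (0 + 0)"
    using assms(1,2) unfolding Lp_tendsto_def by (intro tendsto_mult_ennreal tendsto_const tendsto_add) auto
  then show "(\<lambda>k. ennreal (2 powr p) * (?I k + ?J k)) \<longlonglongrightarrow> 0" by simp
  have "(\<integral>\<^sup>+x. ennreal (norm (w k x + w' k x - (f x + f' x)) powr p) \<partial>M) \<le>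
      (\<integral>\<^sup>+x. ennreal (2 powr p) * (ennreal (norm (w k x - f x) powr p) + ennreal (norm (w' k x - f' x) powr p)) \<partial>M)" for k
  proof (rule nn_integral_mono)
    fix x
    have "norm (w k x + w' k x - (f x + f' x)) powr p \<le> 2 powr p * (norm (w k x - f x) powr p + norm (w' k x - f' x) powr p)"
      using norm_add_powr_le[OF assms(3), of "w k x - f x" "w' k x - f' x"] by (simp add: algebra_simps)
    then show "ennreal (norm (w k x + w' k x - (f x + f' x)) powr p) \<le> ennreal (2 powr p) * (ennreal (norm (w k x - f x) powr p) + ennreal (norm (w' k x - f' x) powr p))"
      by (simp add: ennreal_mult[symmetric] ennreal_plus[symmetric] ennreal_leI del: ennreal_plus)
  qed
  also have "(\<integral>\<^sup>+x. ennreal (2 powr p) * (ennreal (norm (w k x - f x) powr p) + ennreal (norm (w' k x - f' x) powr p)) \<partial>M)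
      = ennreal (2 powr p) * (?I k + ?J k)" for k
    using nn_integral_add[OF norm_powr_measurable[OF m(1)] norm_powr_measurable[OF m(2)], of k p k p]
    by (subst nn_integral_cmult) (auto intro!: borel_measurable_add norm_powr_measurable m)
  finally show "\<forall>\<^sub>F k in sequentially. (\<integral>\<^sup>+x. ennreal (norm (w k x + w' k x - (f x + f' x)) powr p) \<partial>M)
      \<le> ennreal (2 powr p) * (?I k + ?J k)"
    by (intro always_eventually allI)
qed auto

text \<open>An elementary substitute for Hoelder's inequality on finite measure spaces.\<close>

lemma le_eps_plus_powr:
  fixes a \<epsilon> p :: real
  assumes "0 < \<epsilon>" "0 \<le> a" "1 \<le> p"
  shows "a \<le> \<epsilon> + \<epsilon> powr (1 - p) * a powr p"
proof (cases "a \<le> \<epsilon>")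
  case False
  have "a = a powr (1 - p) * a powr p" using assms False by (simp add: powr_add[symmetric])
  also have "\<dots> \<le> \<epsilon> powr (1 - p) * a powr p"
    using False assms by (intro mult_right_mono powr_mono2') auto
  finally show ?thesis using assms by simp
qed (use assms in \<open>simp add: add_increasing2\<close>)

lemma Lp_tendsto_imp_L1:
  assumes "Lp_tendsto p M w f" "1 \<le> p" and m: "\<And>k. (\<lambda>x. w k x - f x) \<in> borel_measurable M"
    and fin: "emeasure M (space M) < \<infinity>"
  shows "(\<lambda>k. \<integral>\<^sup>+x. ennreal (norm (w k x - f x)) \<partial>M) \<longlonglongrightarrow> 0"
proof (rule tendsto_0_if_Limsup_eq_0_ennreal)
  let ?I = "\<lambda>k. \<integral>\<^sup>+x. ennreal (norm (w k x - f x) powr p) \<partial>M"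
  obtain B where B: "emeasure M (space M) = ennreal B" "0 \<le> B"
    using fin by (metis ennreal_cases infinity_ennreal_def less_irrefl)
  have "Limsup sequentially (\<lambda>k. \<integral>\<^sup>+x. ennreal (norm (w k x - f x)) \<partial>M) \<le> 0 + ennreal e" if e: "e > 0" for e
  proof -
    \<comment> \<open>Adding \<open>1\<close> avoids division by \<open>0\<close> when the measure is trivial.\<close>
    define d where "d = e / (B + 1)"
    have d: "d > 0" "d * B \<le> e" using e B(2) by (auto simp: d_def field_simps)
    have "(\<integral>\<^sup>+x. ennreal (norm (w k x - f x)) \<partial>M) \<le> (\<integral>\<^sup>+x. ennreal d + ennreal (d powr (1 - p)) * ennreal (norm (w k x - f x) powr p) \<partial>M)" for k
      using le_eps_plus_powr[OF d(1) norm_ge_zero assms(2)] d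
      by (intro nn_integral_mono) (simp add: ennreal_mult[symmetric] ennreal_plus[symmetric] ennreal_leI del: ennreal_plus)
    also have "\<dots> k = ennreal (d * B) + ennreal (d powr (1 - p)) * ?I k" for k
      using d B norm_powr_measurable[OF m, of k p]
      by (subst nn_integral_add) (auto simp: nn_integral_cmult ennreal_mult)
    finally have le: "(\<integral>\<^sup>+x. ennreal (norm (w k x - f x)) \<partial>M) \<le> ennreal (d * B) + ennreal (d powr (1 - p)) * ?I k" for k .
    have "(\<lambda>k. ennreal (d * B) + ennreal (d powr (1 - p)) * ?I k) \<longlonglongrightarrow> ennreal (d * B) + ennreal (d powr (1 - p)) * 0"
      using assms(1) unfolding Lp_tendsto_def by (intro tendsto_mult_ennreal tendsto_const tendsto_add) auto
    then have "Limsup sequentially (\<lambda>k. ennreal (d * B) + ennreal (d powr (1 - p)) * ?I k) = ennreal (d * B)"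
      using lim_imp_Limsup[OF trivial_limit_sequentially] by fastforce
    moreover have "Limsup sequentially (\<lambda>k. \<integral>\<^sup>+x. ennreal (norm (w k x - f x)) \<partial>M) \<le> Limsup sequentially (\<lambda>k. ennreal (d * B) + ennreal (d powr (1 - p)) * ?I k)"
      by (intro Limsup_mono always_eventually allI le)
    ultimately show ?thesis using d(2) ennreal_leI order_trans by fastforce
  qed
  then have "Limsup sequentially (\<lambda>k. \<integral>\<^sup>+x. ennreal (norm (w k x - f x)) \<partial>M) \<le> 0" by (rule ennreal_le_epsilon)
  then show "Limsup sequentially (\<lambda>k. \<integral>\<^sup>+x. ennreal (norm (w k x - f x)) \<partial>M) = 0" by simp
qed

lemma Lp_on_imp_integrable:
  fixes f :: "'a \<Rightarrow> 'b::euclidean_space"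
  assumes "Lp_on p M f" "1 \<le> p" "emeasure M (space M) < \<infinity>"
  shows "integrable M f"
proof (rule Bochner_Integration.integrable_bound)
  have "integrable M (\<lambda>x. 1 :: real)" using assms(3) by (intro finite_measure.integrable_const finite_measureI) (simp add: less_top)
  then show "integrable M (\<lambda>x. 1 + norm (f x) powr p)" using assms(1) by (intro Bochner_Integration.integrable_add) (auto simp: Lp_on_def)
  show "AE x in M. norm (f x) \<le> norm (1 + norm (f x) powr p)"
    using le_eps_plus_powr[of 1 "norm (f _)" p] assms(2) by (intro AE_I2) auto
qed (use assms in \<open>auto simp: Lp_on_def\<close>)

section \<open>Smooth approximation of Sobolev functions\<close>

text \<open>The part of \<open>has_trace\<close> that concerns the interior, with the limit \<open>V\<close> of the gradients not
  yet known to be a weak gradient of \<open>u\<close>.\<close>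

definition sobolev_approx ::
  "'a::euclidean_space set \<Rightarrow> real \<Rightarrow> (nat \<Rightarrow> 'a \<Rightarrow> real) \<Rightarrow> ('a \<Rightarrow> real) \<Rightarrow> ('a \<Rightarrow> 'a) \<Rightarrow> bool" where
  "sobolev_approx \<Omega> p w u V \<longleftrightarrow> (\<forall>k. smooth (w k)) \<and> Lp_on p (lebesgue_on \<Omega>) u \<and> Lp_on p (lebesgue_on \<Omega>) V \<and>
     Lp_tendsto p (lebesgue_on \<Omega>) w u \<and> Lp_tendsto p (lebesgue_on \<Omega>) (\<lambda>k. gradient (w k)) V"

text \<open>The functions \<open>\<theta>\<close> for which \<open>\<theta>(w)\<close> stays smooth and the chain rule passes to limits in
  \<open>W\<^sup>1\<^sup>,\<^sup>p\<close>.\<close>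

definition smooth_bounded :: "(real \<Rightarrow> real) \<Rightarrow> (real \<Rightarrow> real) \<Rightarrow> real \<Rightarrow> bool" where
  "smooth_bounded \<theta> \<theta>' C \<longleftrightarrow> smooth \<theta> \<and> (\<forall>s. (\<theta> has_field_derivative \<theta>' s) (at s)) \<and> continuous_on UNIV \<theta>' \<and>
     (\<forall>s. \<bar>\<theta> s\<bar> \<le> C) \<and> (\<forall>s. \<bar>\<theta>' s\<bar> \<le> C)"

lemma sobolev_approx_measurable:
  assumes "sobolev_approx \<Omega> p w u V"
  shows "u \<in> borel_measurable (lebesgue_on \<Omega>)" "V \<in> borel_measurable (lebesgue_on \<Omega>)"
    "w k \<in> borel_measurable (lebesgue_on \<Omega>)" "gradient (w k) \<in> borel_measurable (lebesgue_on \<Omega>)"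
    "(\<lambda>x. w k x - u x) \<in> borel_measurable (lebesgue_on \<Omega>)"
    "(\<lambda>x. gradient (w k) x - V x) \<in> borel_measurable (lebesgue_on \<Omega>)"
proof -
  show 1: "u \<in> borel_measurable (lebesgue_on \<Omega>)" "V \<in> borel_measurable (lebesgue_on \<Omega>)"
    "w k \<in> borel_measurable (lebesgue_on \<Omega>)" "gradient (w k) \<in> borel_measurable (lebesgue_on \<Omega>)"
    using assms by (auto simp: sobolev_approx_def Lp_on_def intro: lebesgue_on_smooth_measurable)
  show "(\<lambda>x. w k x - u x) \<in> borel_measurable (lebesgue_on \<Omega>)"
    "(\<lambda>x. gradient (w k) x - V x) \<in> borel_measurable (lebesgue_on \<Omega>)"
    by (intro borel_measurable_diff 1)+
qed

lemma sobolev_approx_subseq: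
  assumes "sobolev_approx \<Omega> p w u V" "strict_mono r"
  shows "sobolev_approx \<Omega> p (w \<circ> r) u V"
  using assms LIMSEQ_subseq_LIMSEQ[OF _ assms(2)]
  by (fastforce simp: sobolev_approx_def Lp_tendsto_def o_def)

lemma sobolev_approx_add:
  assumes "sobolev_approx \<Omega> p w u V" "sobolev_approx \<Omega> p w' u' V'" "0 \<le> p"
  shows "sobolev_approx \<Omega> p (\<lambda>k x. w k x + w' k x) (\<lambda>x. u x + u' x) (\<lambda>x. V x + V' x)"
proof -
  have s: "smooth (w k)" "smooth (w' k)" for k using assms by (auto simp: sobolev_approx_def)
  have "Lp_tendsto p (lebesgue_on \<Omega>) (\<lambda>k x. w k x + w' k x) (\<lambda>x. u x + u' x)"
    using assms sobolev_approx_measurable[OF assms(1)] sobolev_approx_measurable[OF assms(2)]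
    by (intro Lp_tendsto_add) (auto simp: sobolev_approx_def)
  moreover have "Lp_tendsto p (lebesgue_on \<Omega>) (\<lambda>k x. gradient (w k) x + gradient (w' k) x) (\<lambda>x. V x + V' x)"
    using assms sobolev_approx_measurable[OF assms(1)] sobolev_approx_measurable[OF assms(2)]
    by (intro Lp_tendsto_add) (auto simp: sobolev_approx_def)
  moreover have "gradient (\<lambda>x. w k x + w' k x) = (\<lambda>x. gradient (w k) x + gradient (w' k) x)" for k
    using gradient_add[OF s] by blast
  ultimately show ?thesis using assms s unfolding sobolev_approx_def by (auto intro: Lp_on_add smooth_add)
qed

lemma sobolev_approx_test_mult:
  assumes a: "sobolev_approx \<Omega> p w u V" and \<psi>: "\<psi> \<in> test_functions \<Omega>" and p: "0 \<le> p"
  shows "sobolev_approx \<Omega> p (\<lambda>k x. \<psi> x * w k x) (\<lambda>x. \<psi> x * u x) (\<lambda>x. \<psi> x *\<^sub>R V x + u x *\<^sub>R gradient \<psi> x)"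
proof -
  have s: "smooth (w k)" for k using a by (auto simp: sobolev_approx_def)
  obtain B where B: "0 \<le> B" "\<And>x. \<bar>\<psi> x\<bar> \<le> B" "\<And>x. norm (gradient \<psi> x) \<le> B" using test_functionE[OF \<psi>] by metis
  have s\<psi>: "smooth \<psi>" by (rule test_smooth[OF \<psi>])
  note [measurable] = sobolev_approx_measurable[OF a] lebesgue_on_smooth_measurable[OF s\<psi>, of \<Omega>]
  have lim: "Lp_tendsto p (lebesgue_on \<Omega>) w u" "Lp_tendsto p (lebesgue_on \<Omega>) (\<lambda>k. gradient (w k)) V"
    and Lp: "Lp_on p (lebesgue_on \<Omega>) u" "Lp_on p (lebesgue_on \<Omega>) V" using a by (auto simp: sobolev_approx_def)
  have 1: "Lp_tendsto p (lebesgue_on \<Omega>) (\<lambda>k x. \<psi> x * w k x) (\<lambda>x. \<psi> x * u x)"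
    by (rule Lp_tendsto_bound[OF lim(1) p B(1)])
      (use B(2) in \<open>auto simp: right_diff_distrib[symmetric] abs_mult intro!: mult_right_mono\<close>)
  have 2: "Lp_tendsto p (lebesgue_on \<Omega>) (\<lambda>k x. \<psi> x *\<^sub>R gradient (w k) x) (\<lambda>x. \<psi> x *\<^sub>R V x)"
    by (rule Lp_tendsto_bound[OF lim(2) p B(1)])
      (use B(2) in \<open>auto simp: scaleR_diff_right[symmetric] intro!: mult_right_mono\<close>)
  have 3: "Lp_tendsto p (lebesgue_on \<Omega>) (\<lambda>k x. w k x *\<^sub>R gradient \<psi> x) (\<lambda>x. u x *\<^sub>R gradient \<psi> x)"
    by (rule Lp_tendsto_bound[OF lim(1) p B(1)])
      (use B(3) in \<open>auto simp: scaleR_diff_left[symmetric] mult.commute[of B] intro!: mult_left_mono\<close>)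
  have 4: "Lp_tendsto p (lebesgue_on \<Omega>) (\<lambda>k x. \<psi> x *\<^sub>R gradient (w k) x + w k x *\<^sub>R gradient \<psi> x) (\<lambda>x. \<psi> x *\<^sub>R V x + u x *\<^sub>R gradient \<psi> x)"
    by (rule Lp_tendsto_add[OF 2 3 p]) measurable
  have g: "gradient (\<lambda>x. \<psi> x * w k x) = (\<lambda>x. \<psi> x *\<^sub>R gradient (w k) x + w k x *\<^sub>R gradient \<psi> x)" for k
    using gradient_mult[OF s\<psi> s] by blast
  have "Lp_on p (lebesgue_on \<Omega>) (\<lambda>x. \<psi> x * u x)"
    by (rule Lp_on_bound[OF Lp(1) _ p B(1)]) (use B(2) in \<open>auto simp: abs_mult intro!: AE_I2 mult_right_mono\<close>)
  moreover have "Lp_on p (lebesgue_on \<Omega>) (\<lambda>x. \<psi> x *\<^sub>R V x)"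
    by (rule Lp_on_bound[OF Lp(2) _ p B(1)]) (use B(2) in \<open>auto intro!: AE_I2 mult_right_mono\<close>)
  moreover have "Lp_on p (lebesgue_on \<Omega>) (\<lambda>x. u x *\<^sub>R gradient \<psi> x)"
    by (rule Lp_on_bound[OF Lp(1) _ p B(1)]) (use B(3) in \<open>auto simp: mult.commute[of B] intro!: AE_I2 mult_left_mono\<close>)
  ultimately show ?thesis unfolding sobolev_approx_def g
    using 1 4 by (auto intro!: Lp_on_add smooth_mult s s\<psi> p)
qed

lemma smooth_bounded_lipschitz:
  assumes "smooth_bounded \<theta> \<theta>' C" shows "\<bar>\<theta> a - \<theta> b\<bar> \<le> C * \<bar>a - b\<bar>"
proof -
  have "norm (\<theta> a - \<theta> b) \<le> C * norm (a - b)"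
    by (rule field_differentiable_bound[of UNIV \<theta> \<theta>']) (use assms in \<open>auto simp: smooth_bounded_def\<close>)
  then show ?thesis by simp
qed

text \<open>With \<open>\<nabla>\<theta>(w\<^sub>k) = \<theta>'(w\<^sub>k) (\<nabla>w\<^sub>k - V) + \<theta>'(w\<^sub>k) V\<close>, the first summand tends to \<open>0\<close> as \<open>\<theta>'\<close> is
  bounded, and the second converges by dominated convergence. This is where pointwise convergence
  of \<open>w\<^sub>k\<close> enters.\<close>

lemma sobolev_approx_compose:
  assumes a: "sobolev_approx \<Omega> p w u V" and \<theta>: "smooth_bounded \<theta> \<theta>' C" and p: "0 < p"
    and ptw: "AE x in lebesgue_on \<Omega>. (\<lambda>k. w k x) \<longlonglongrightarrow> u x" and fin: "emeasure lebesgue \<Omega> < \<infinity>" "open \<Omega>"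
  shows "sobolev_approx \<Omega> p (\<lambda>k x. \<theta> (w k x)) (\<lambda>x. \<theta> (u x)) (\<lambda>x. \<theta>' (u x) *\<^sub>R V x)"
proof -
  have s: "smooth (w k)" for k using a by (auto simp: sobolev_approx_def)
  have C: "0 \<le> C" "\<And>s. \<bar>\<theta> s\<bar> \<le> C" "\<And>s. \<bar>\<theta>' s\<bar> \<le> C" using \<theta> abs_ge_zero order_trans unfolding smooth_bounded_def by blast+
  have [measurable]: "\<theta> \<in> borel_measurable borel" "\<theta>' \<in> borel_measurable borel"
    using \<theta> by (auto simp: smooth_bounded_def intro: smooth_borel borel_measurable_continuous_onI)
  note [measurable] = sobolev_approx_measurable[OF a]
  have lim: "Lp_tendsto p (lebesgue_on \<Omega>) w u" "Lp_tendsto p (lebesgue_on \<Omega>) (\<lambda>k. gradient (w k)) V"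
    and Lp: "Lp_on p (lebesgue_on \<Omega>) u" "Lp_on p (lebesgue_on \<Omega>) V" using a by (auto simp: sobolev_approx_def)
  have p0: "0 \<le> p" using p by simp
  have 1: "Lp_tendsto p (lebesgue_on \<Omega>) (\<lambda>k x. \<theta> (w k x)) (\<lambda>x. \<theta> (u x))"
    by (rule Lp_tendsto_bound[OF lim(1) p0 C(1)]) (use smooth_bounded_lipschitz[OF \<theta>] in auto)
  have 2: "Lp_tendsto p (lebesgue_on \<Omega>) (\<lambda>k x. \<theta>' (w k x) *\<^sub>R (gradient (w k) x - V x)) (\<lambda>x. 0)"
    by (rule Lp_tendsto_bound[OF lim(2) p0 C(1)]) (use C(3) in \<open>auto intro!: mult_right_mono\<close>)
  have 3: "Lp_tendsto p (lebesgue_on \<Omega>) (\<lambda>k x. \<theta>' (w k x) *\<^sub>R V x) (\<lambda>x. \<theta>' (u x) *\<^sub>R V x)"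
    unfolding Lp_tendsto_def
  proof -
    have "(\<lambda>k. \<integral>\<^sup>+ x. ennreal (norm (\<theta>' (w k x) *\<^sub>R V x - \<theta>' (u x) *\<^sub>R V x) powr p) \<partial>lebesgue_on \<Omega>) \<longlonglongrightarrow> (\<integral>\<^sup>+ x. 0 \<partial>lebesgue_on \<Omega>)"
    proof (rule nn_integral_dominated_convergence)
      show "(\<lambda>x. ennreal (norm (\<theta>' (w k x) *\<^sub>R V x - \<theta>' (u x) *\<^sub>R V x) powr p)) \<in> borel_measurable (lebesgue_on \<Omega>)" for k
        by (rule norm_powr_measurable) measurable
      show "(\<lambda>x. ennreal ((2 * C) powr p * norm (V x) powr p)) \<in> borel_measurable (lebesgue_on \<Omega>)" by measurable
      have "integrable (lebesgue_on \<Omega>) (\<lambda>x. (2 * C) powr p * norm (V x) powr p)" using Lp(2) by (simp add: Lp_on_def)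
      from nn_integral_eq_integral[OF this]
      show "(\<integral>\<^sup>+ x. ennreal ((2 * C) powr p * norm (V x) powr p) \<partial>lebesgue_on \<Omega>) < \<infinity>" by simp
      show "AE x in lebesgue_on \<Omega>. ennreal (norm (\<theta>' (w k x) *\<^sub>R V x - \<theta>' (u x) *\<^sub>R V x) powr p) \<le> ennreal ((2 * C) powr p * norm (V x) powr p)" for k
      proof (intro AE_I2 ennreal_leI)
        fix x
        have "\<bar>\<theta>' (w k x) - \<theta>' (u x)\<bar> \<le> 2 * C" using C(3)[of "w k x"] C(3)[of "u x"] by linarith
        then have "norm (\<theta>' (w k x) *\<^sub>R V x - \<theta>' (u x) *\<^sub>R V x) \<le> (2 * C) * norm (V x)"
          by (simp add: scaleR_diff_left[symmetric] mult_right_mono)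
        then have "norm (\<theta>' (w k x) *\<^sub>R V x - \<theta>' (u x) *\<^sub>R V x) powr p \<le> ((2 * C) * norm (V x)) powr p"
          using p0 by (intro powr_mono2) auto
        then show "norm (\<theta>' (w k x) *\<^sub>R V x - \<theta>' (u x) *\<^sub>R V x) powr p \<le> (2 * C) powr p * norm (V x) powr p"
          using C(1) by (simp add: powr_mult)
      qed
      show "AE x in lebesgue_on \<Omega>. (\<lambda>k. ennreal (norm (\<theta>' (w k x) *\<^sub>R V x - \<theta>' (u x) *\<^sub>R V x) powr p)) \<longlonglongrightarrow> 0"
        using ptw
      proof eventually_elim
        case (elim x)
        have "isCont \<theta>' (u x)" using \<theta> by (auto simp: smooth_bounded_def continuous_on_eq_continuous_at)
        then have "(\<lambda>k. \<theta>' (w k x)) \<longlonglongrightarrow> \<theta>' (u x)" using elim by (rule isCont_tendsto_compose)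
        then have "(\<lambda>k. norm (\<theta>' (w k x) *\<^sub>R V x - \<theta>' (u x) *\<^sub>R V x)) \<longlonglongrightarrow> norm (\<theta>' (u x) *\<^sub>R V x - \<theta>' (u x) *\<^sub>R V x)"
          by (intro tendsto_intros)
        then have "(\<lambda>k. norm (\<theta>' (w k x) *\<^sub>R V x - \<theta>' (u x) *\<^sub>R V x) powr p) \<longlonglongrightarrow> norm (\<theta>' (u x) *\<^sub>R V x - \<theta>' (u x) *\<^sub>R V x) powr p"
          using p by (intro tendsto_powr2 tendsto_const) auto
        from tendsto_ennrealI[OF this] show ?case by simp
      qed
    qed simp
    then show "(\<lambda>k. \<integral>\<^sup>+ x. ennreal (norm (\<theta>' (w k x) *\<^sub>R V x - \<theta>' (u x) *\<^sub>R V x) powr p) \<partial>lebesgue_on \<Omega>) \<longlonglongrightarrow> 0" by simp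
  qed
  have "Lp_tendsto p (lebesgue_on \<Omega>) (\<lambda>k x. \<theta>' (w k x) *\<^sub>R (gradient (w k) x - V x) + \<theta>' (w k x) *\<^sub>R V x) (\<lambda>x. 0 + \<theta>' (u x) *\<^sub>R V x)"
    by (rule Lp_tendsto_add[OF 2 3 p0]) measurable
  moreover have "gradient (\<lambda>x. \<theta> (w k x)) = (\<lambda>x. \<theta>' (w k x) *\<^sub>R (gradient (w k) x - V x) + \<theta>' (w k x) *\<^sub>R V x)" for k
    using gradient_compose[OF s, of \<theta> \<theta>'] \<theta> by (auto simp: smooth_bounded_def scaleR_diff_right)
  ultimately have 4: "Lp_tendsto p (lebesgue_on \<Omega>) (\<lambda>k. gradient (\<lambda>x. \<theta> (w k x))) (\<lambda>x. \<theta>' (u x) *\<^sub>R V x)" by simp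
  have "Lp_on p (lebesgue_on \<Omega>) (\<lambda>x. \<theta>' (u x) *\<^sub>R V x)"
    by (rule Lp_on_bound[OF Lp(2) _ p0 C(1)]) (use C(3) in \<open>auto intro!: AE_I2 mult_right_mono\<close>)
  moreover have "Lp_on p (lebesgue_on \<Omega>) (\<lambda>x. 1 :: real)"
    using fin by (auto simp: Lp_on_def emeasure_restrict_space intro!: finite_measure.integrable_const finite_measureI)
  then have "Lp_on p (lebesgue_on \<Omega>) (\<lambda>x. \<theta> (u x))"
    by (rule Lp_on_bound[OF _ _ p0 C(1)]) (use C(2) in auto)
  ultimately show ?thesis unfolding sobolev_approx_def
    using 1 4 \<theta> s by (auto simp: smooth_bounded_def intro: smooth_compose)
qed

lemma emeasure_lebesgue_on_space:
  "open \<Omega> \<Longrightarrow> bounded \<Omega> \<Longrightarrow> emeasure (lebesgue_on \<Omega>) (space (lebesgue_on (\<Omega>::'a::euclidean_space set))) < \<infinity>"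
  "open \<Omega> \<Longrightarrow> bounded \<Omega> \<Longrightarrow> emeasure lebesgue (\<Omega>::'a::euclidean_space set) < \<infinity>"
  using emeasure_bounded_finite[of \<Omega>] by (auto simp: emeasure_restrict_space)

lemma integrable_imp_locally_integrable:
  fixes f :: "'a::euclidean_space \<Rightarrow> 'b::euclidean_space"
  assumes "integrable (lebesgue_on \<Omega>) f" "open \<Omega>" shows "locally_integrable \<Omega> f"
  unfolding locally_integrable_def
proof (intro conjI allI impI)
  show "f \<in> borel_measurable (lebesgue_on \<Omega>)" using assms by simp
  fix K assume K: "compact K \<and> K \<subseteq> \<Omega>"
  have Kl: "K \<in> sets lebesgue" using K by (auto dest: fmeasurableD[OF lmeasurable_compact])
  have "integrable lebesgue (\<lambda>x. indicator \<Omega> x *\<^sub>R f x)"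
    using assms by (subst (asm) integrable_restrict_space) auto
  then have "integrable lebesgue (\<lambda>x. indicator K x *\<^sub>R indicator \<Omega> x *\<^sub>R f x)"
    by (rule integrable_mult_indicator[OF Kl])
  moreover have "indicator K x *\<^sub>R indicator \<Omega> x *\<^sub>R f x = indicator K x *\<^sub>R f x" for x
    using K by (auto simp: indicator_def)
  ultimately show "integrable (lebesgue_on K) f"
    using Kl by (subst integrable_restrict_space) (auto simp del: scaleR_scaleR)
qed

lemma Lp_tendsto_integral_mult:
  fixes w :: "nat \<Rightarrow> 'a \<Rightarrow> real"
  assumes lim: "Lp_tendsto p M w f" and p: "1 \<le> p" and m: "\<And>k. (\<lambda>x. w k x - f x) \<in> borel_measurable M"
    and fin: "emeasure M (space M) < \<infinity>"
    and g: "g \<in> borel_measurable M" "\<And>x. \<bar>g x\<bar> \<le> B"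
    and int: "\<And>k. integrable M (\<lambda>x. w k x * g x)" "integrable M (\<lambda>x. f x * g x)"
  shows "(\<lambda>k. LINT x|M. w k x * g x) \<longlonglongrightarrow> (LINT x|M. f x * g x)"
proof (rule tendsto_L1_int[OF int])
  have "0 \<le> B" using g(2) abs_ge_zero order_trans by blast
  then have "Lp_tendsto p M (\<lambda>k x. w k x * g x) (\<lambda>x. f x * g x)"
    using p g(2) by (intro Lp_tendsto_bound[OF lim _ _ m, where C=B])
      (auto simp: left_diff_distrib[symmetric] abs_mult mult.commute[of B] intro!: mult_left_mono)
  then show "(\<lambda>k. \<integral>\<^sup>+ x. ennreal (norm (w k x * g x - f x * g x)) \<partial>M) \<longlonglongrightarrow> 0"
    by (rule Lp_tendsto_imp_L1[OF _ p _ fin]) (use int in auto)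
qed

text \<open>Integration by parts for the smooth approximations passes to the limit.\<close>

lemma sobolev_approx_has_weak_gradient:
  assumes a: "sobolev_approx \<Omega> p w u V" and p: "1 \<le> p" and \<Omega>: "open \<Omega>" "bounded \<Omega>"
  shows "has_weak_gradient \<Omega> u V"
  unfolding has_weak_gradient_def
proof (intro conjI ballI)
  note fin = emeasure_lebesgue_on_space(1)[OF \<Omega>]
  have s: "smooth (w k)" for k using a by (auto simp: sobolev_approx_def)
  have lim: "Lp_tendsto p (lebesgue_on \<Omega>) w u" "Lp_tendsto p (lebesgue_on \<Omega>) (\<lambda>k. gradient (w k)) V"
    and Lp: "Lp_on p (lebesgue_on \<Omega>) u" "Lp_on p (lebesgue_on \<Omega>) V" using a by (auto simp: sobolev_approx_def)
  show lu: "locally_integrable \<Omega> u" and lV: "locally_integrable \<Omega> V"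
    using Lp_on_imp_integrable[OF _ p fin] Lp \<Omega> by (auto intro: integrable_imp_locally_integrable)
  fix \<psi> b assume \<psi>: "\<psi> \<in> test_functions \<Omega>" and b: "b \<in> (Basis :: 'a set)"
  note s\<psi> = test_smooth[OF \<psi>]
  note [measurable] = sobolev_approx_measurable[OF a] lebesgue_on_smooth_measurable[OF s\<psi>, of \<Omega>]
  obtain B where B: "0 \<le> B" "\<And>x. \<bar>\<psi> x\<bar> \<le> B" "\<And>x. norm (gradient \<psi> x) \<le> B" using test_functionE[OF \<psi>] by metis
  have gb: "\<bar>gradient \<psi> x \<bullet> b\<bar> \<le> B" for x using B(3)[of x] b Basis_le_norm order_trans by blast
  have lw: "locally_integrable \<Omega> (w k)" "locally_integrable \<Omega> (\<lambda>x. gradient (w k) x \<bullet> b)" for k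
    using continuous_on_subset[OF smooth_continuous[OF s]]
      continuous_on_subset[OF smooth_continuous[OF smooth_gradient_component[OF s]]]
    by (auto intro!: continuous_locally_integrable \<Omega>)
  have "(\<lambda>k. LINT x|lebesgue_on \<Omega>. w k x * (gradient \<psi> x \<bullet> b)) \<longlonglongrightarrow> (LINT x|lebesgue_on \<Omega>. u x * (gradient \<psi> x \<bullet> b))"
    by (rule Lp_tendsto_integral_mult[OF lim(1) p _ fin _ gb])
      (use integrable_test_mult(2)[OF _ \<Omega>(1) \<psi>] lw lu in auto)
  moreover have "Lp_tendsto p (lebesgue_on \<Omega>) (\<lambda>k x. gradient (w k) x \<bullet> b) (\<lambda>x. V x \<bullet> b)"
    by (rule Lp_tendsto_bound[OF lim(2), of 1])
      (use p b Basis_le_norm in \<open>auto simp: inner_diff_left[symmetric]\<close>)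
  then have "(\<lambda>k. LINT x|lebesgue_on \<Omega>. (gradient (w k) x \<bullet> b) * \<psi> x) \<longlonglongrightarrow> (LINT x|lebesgue_on \<Omega>. (V x \<bullet> b) * \<psi> x)"
    by (rule Lp_tendsto_integral_mult[OF _ p _ fin _ B(2)])
      (use integrable_test_mult(1)[OF _ \<Omega>(1) \<psi>] lw locally_integrable_inner[OF lV] in auto)
  then have "(\<lambda>k. - (LINT x|lebesgue_on \<Omega>. (gradient (w k) x \<bullet> b) * \<psi> x)) \<longlonglongrightarrow> - (LINT x|lebesgue_on \<Omega>. (V x \<bullet> b) * \<psi> x)"
    by (rule tendsto_minus)
  ultimately show "(LINT x|lebesgue_on \<Omega>. u x * (gradient \<psi> x \<bullet> b)) = - (LINT x|lebesgue_on \<Omega>. (V x \<bullet> b) * \<psi> x)"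
    unfolding integration_by_parts_smooth[OF s \<psi> \<Omega>(1)] by (rule LIMSEQ_unique)
qed

lemma sobolev_approx_AE_subseq:
  assumes a: "sobolev_approx \<Omega> p w u V" and p: "1 \<le> p" and \<Omega>: "open \<Omega>" "bounded \<Omega>"
  obtains r where "strict_mono r" "AE x in lebesgue_on \<Omega>. (\<lambda>k. w (r k) x) \<longlonglongrightarrow> u x"
proof -
  note fin = emeasure_lebesgue_on_space(1)[OF \<Omega>]
  have s: "smooth (w k)" for k using a by (auto simp: sobolev_approx_def)
  have lim: "Lp_tendsto p (lebesgue_on \<Omega>) w u"
    and Lp: "Lp_on p (lebesgue_on \<Omega>) u" using a by (auto simp: sobolev_approx_def)
  have "integrable (lebesgue_on \<Omega>) (w k)" for k
  proof -
    have "compact (closure \<Omega>)" using \<Omega> by (simp add: compact_closure)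
    then have "bounded (w k ` closure \<Omega>)"
      using s by (intro compact_imp_bounded compact_continuous_image continuous_on_subset[OF smooth_continuous]) auto
    then obtain B where "\<And>x. x \<in> \<Omega> \<Longrightarrow> norm (w k x) \<le> B" using closure_subset unfolding bounded_iff by blast
    then show ?thesis using fin lebesgue_on_smooth_measurable(1)[OF s]
      by (intro finite_measure.integrable_const_bound[where B=B] finite_measureI) (auto intro!: AE_I2)
  qed
  then have "integrable (lebesgue_on \<Omega>) (\<lambda>x. w k x - u x)" for k
    using Lp_on_imp_integrable[OF Lp p fin] by auto
  moreover have "(\<lambda>k. \<integral>\<^sup>+ x. ennreal (norm (w k x - u x)) \<partial>lebesgue_on \<Omega>) \<longlonglongrightarrow> 0"
    by (rule Lp_tendsto_imp_L1[OF lim p sobolev_approx_measurable(5)[OF a] fin])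
  moreover have "(\<integral>\<^sup>+ x. ennreal (norm (w k x - u x)) \<partial>lebesgue_on \<Omega>) = ennreal (LINT x|lebesgue_on \<Omega>. norm (w k x - u x))" for k
    using calculation(1) by (intro nn_integral_eq_integral) auto
  ultimately have "(\<lambda>k. LINT x|lebesgue_on \<Omega>. norm (w k x - u x)) \<longlonglongrightarrow> 0"
    by (simp add: tendsto_ennreal_iff[of _ _ 0, simplified])
  from tendsto_L1_AE_subseq[OF _ this] obtain r where "strict_mono r" "AE x in lebesgue_on \<Omega>. (\<lambda>n. w (r n) x - u x) \<longlonglongrightarrow> 0"
    using \<open>\<And>k. integrable (lebesgue_on \<Omega>) (\<lambda>x. w k x - u x)\<close> by blast
  then show ?thesis using that by (auto simp: LIM_zero_iff)
qed

section \<open>Cutoffs of values and admissible perturbations\<close>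

lemma smooth_id: "smooth (\<lambda>s::real. s)"
  using smooth_inner[of "1::real"] by simp

lemma smooth_bounded_const: "smooth_bounded (\<lambda>s. c) (\<lambda>s. 0) \<bar>c\<bar>"
  by (auto simp: smooth_bounded_def smooth_const)

text \<open>Cuts off the zero set: these functions lie in \<open>[0, 1)\<close>, vanish to second order at \<open>0\<close>, and
  tend to \<open>1\<close> at every other point as \<open>d\<close> tends to \<open>0\<close>.\<close>

lemma smooth_bounded_zero_cutoff:
  fixes d :: real
  assumes d: "0 < d"
  shows "smooth_bounded (\<lambda>s. s\<^sup>2 / (s\<^sup>2 + d\<^sup>2)) (\<lambda>s. 2 * s * d\<^sup>2 / (s\<^sup>2 + d\<^sup>2)\<^sup>2) (1 + 1 / d)"
proof -
  have pos: "0 < s\<^sup>2 + d\<^sup>2" for s using d by (simp add: add_nonneg_pos)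
  have nz: "s\<^sup>2 + d\<^sup>2 \<noteq> 0" for s using pos[of s] by (rule less_imp_neq[symmetric])
  have "smooth (\<lambda>s::real. s\<^sup>2 * inverse (s\<^sup>2 + d\<^sup>2))"
    by (intro smooth_mult smooth_inverse smooth_power smooth_id smooth_add smooth_const nz)
  moreover have "((\<lambda>s. s\<^sup>2 / (s\<^sup>2 + d\<^sup>2)) has_field_derivative 2 * s * d\<^sup>2 / (s\<^sup>2 + d\<^sup>2)\<^sup>2) (at s)" for s
    by (rule derivative_eq_intros refl nz)+ (simp add: power2_eq_square algebra_simps)
  moreover have "continuous_on UNIV (\<lambda>s. 2 * s * d\<^sup>2 / (s\<^sup>2 + d\<^sup>2)\<^sup>2)"
    by (intro continuous_intros) (use d in simp)
  moreover have "\<bar>s\<^sup>2 / (s\<^sup>2 + d\<^sup>2)\<bar> \<le> 1 + 1 / d" for s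
  proof -
    have "\<bar>s\<^sup>2 / (s\<^sup>2 + d\<^sup>2)\<bar> \<le> 1" using pos[of s] by (simp add: divide_le_eq)
    then show ?thesis using d by (simp add: add_increasing2)
  qed
  moreover have "\<bar>2 * s * d\<^sup>2 / (s\<^sup>2 + d\<^sup>2)\<^sup>2\<bar> \<le> 1 + 1 / d" for s
  proof -
    have "0 \<le> (\<bar>s\<bar> - d)\<^sup>2" by simp
    then have 1: "2 * \<bar>s\<bar> * d \<le> s\<^sup>2 + d\<^sup>2" by (simp add: power2_diff)
    have "(2 * \<bar>s\<bar> * d) * d\<^sup>2 \<le> (s\<^sup>2 + d\<^sup>2) * (s\<^sup>2 + d\<^sup>2)"
      by (rule mult_mono[OF 1]) (use pos[of s] in auto)
    then have "2 * \<bar>s\<bar> * d\<^sup>2 \<le> (s\<^sup>2 + d\<^sup>2)\<^sup>2 / d"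
      using d by (subst pos_le_divide_eq) (simp_all only: power2_eq_square mult_ac)
    then have "2 * \<bar>s\<bar> * d\<^sup>2 / (s\<^sup>2 + d\<^sup>2)\<^sup>2 \<le> 1 / d"
      using pos[of s] by (subst pos_divide_le_eq) auto
    then have "\<bar>2 * s * d\<^sup>2 / (s\<^sup>2 + d\<^sup>2)\<^sup>2\<bar> \<le> 1 / d" by (simp add: abs_mult)
    then show ?thesis by simp
  qed
  ultimately show ?thesis by (simp add: smooth_bounded_def divide_inverse)
qed

text \<open>These functions tend to \<open>0\<close> uniformly as \<open>d\<close> tends to \<open>0\<close>, whereas their derivatives tend to
  the indicator of \<open>{0}\<close>.\<close>

lemma smooth_bounded_near_identity:
  fixes d :: real
  assumes d: "0 < d"
  shows "smooth_bounded (\<lambda>s. s * d\<^sup>2 / (s\<^sup>2 + d\<^sup>2)) (\<lambda>s. d\<^sup>2 * (d\<^sup>2 - s\<^sup>2) / (s\<^sup>2 + d\<^sup>2)\<^sup>2) (1 + d)"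
    and "\<bar>s * d\<^sup>2 / (s\<^sup>2 + d\<^sup>2)\<bar> \<le> d" and "\<bar>d\<^sup>2 * (d\<^sup>2 - s\<^sup>2) / (s\<^sup>2 + d\<^sup>2)\<^sup>2\<bar> \<le> 1"
proof -
  have pos: "0 < s\<^sup>2 + d\<^sup>2" for s using d by (simp add: add_nonneg_pos)
  have nz: "s\<^sup>2 + d\<^sup>2 \<noteq> 0" for s using pos[of s] by (rule less_imp_neq[symmetric])
  have "smooth (\<lambda>s::real. (s * d\<^sup>2) * inverse (s\<^sup>2 + d\<^sup>2))"
    by (intro smooth_mult smooth_inverse smooth_power smooth_id smooth_add smooth_const nz)
  moreover have "((\<lambda>s. s * d\<^sup>2 / (s\<^sup>2 + d\<^sup>2)) has_field_derivative d\<^sup>2 * (d\<^sup>2 - s\<^sup>2) / (s\<^sup>2 + d\<^sup>2)\<^sup>2) (at s)" for s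
    by (rule derivative_eq_intros refl nz)+ (simp add: power2_eq_square algebra_simps)
  moreover have "continuous_on UNIV (\<lambda>s. d\<^sup>2 * (d\<^sup>2 - s\<^sup>2) / (s\<^sup>2 + d\<^sup>2)\<^sup>2)"
    by (intro continuous_intros) (use d in simp)
  moreover show le_d: "\<bar>s * d\<^sup>2 / (s\<^sup>2 + d\<^sup>2)\<bar> \<le> d" for s
  proof -
    have "0 \<le> (\<bar>s\<bar> - d)\<^sup>2" by simp
    then have 1: "2 * (\<bar>s\<bar> * d) \<le> s\<^sup>2 + d\<^sup>2" by (simp add: power2_diff)
    have "0 \<le> \<bar>s\<bar> * d" using d by simp
    then have "\<bar>s\<bar> * d \<le> s\<^sup>2 + d\<^sup>2" using 1 by linarith
    then have "d * (\<bar>s\<bar> * d) \<le> d * (s\<^sup>2 + d\<^sup>2)" using d by (intro mult_left_mono) auto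
    then show ?thesis using pos[of s] by (simp add: abs_mult divide_le_eq power2_eq_square mult_ac)
  qed
  moreover show le_1: "\<bar>d\<^sup>2 * (d\<^sup>2 - s\<^sup>2) / (s\<^sup>2 + d\<^sup>2)\<^sup>2\<bar> \<le> 1" for s
  proof -
    have "\<bar>d\<^sup>2 - s\<^sup>2\<bar> \<le> s\<^sup>2 + d\<^sup>2" using zero_le_power2[of s] zero_le_power2[of d] by linarith
    then have "d\<^sup>2 * \<bar>d\<^sup>2 - s\<^sup>2\<bar> \<le> (s\<^sup>2 + d\<^sup>2) * (s\<^sup>2 + d\<^sup>2)"
      by (intro mult_mono) (use pos[of s] in auto)
    then show ?thesis using pos[of s] by (simp add: abs_mult divide_le_eq power2_eq_square)
  qed
  moreover have "\<bar>s * d\<^sup>2 / (s\<^sup>2 + d\<^sup>2)\<bar> \<le> 1 + d" "\<bar>d\<^sup>2 * (d\<^sup>2 - s\<^sup>2) / (s\<^sup>2 + d\<^sup>2)\<^sup>2\<bar> \<le> 1 + d" for s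
    using order_trans[OF le_d[of s], of "1 + d"] order_trans[OF le_1[of s], of "1 + d"] d by simp_all
  ultimately show "smooth_bounded (\<lambda>s. s * d\<^sup>2 / (s\<^sup>2 + d\<^sup>2)) (\<lambda>s. d\<^sup>2 * (d\<^sup>2 - s\<^sup>2) / (s\<^sup>2 + d\<^sup>2)\<^sup>2) (1 + d)"
    by (simp add: smooth_bounded_def divide_inverse)
qed

text \<open>For the functions \<open>\<theta>\<^sub>n\<close> of \<open>smooth_bounded_near_identity\<close> with \<open>d = 1 / (n + 1)\<close>, \<open>\<theta>\<^sub>n(u)\<close> tends to \<open>0\<close> uniformly while its weak
  gradient \<open>\<theta>\<^sub>n'(u) V\<close> tends to \<open>V\<close> on \<open>{u = 0}\<close> and to \<open>0\<close> elsewhere. The limit of the weak gradients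
  must therefore vanish.\<close>

lemma weak_gradient_AE_0_on_zero_set:
  assumes a: "sobolev_approx \<Omega> p w u V" and p: "1 \<le> p" and \<Omega>: "open \<Omega>" "bounded \<Omega>"
    and ptw: "AE x in lebesgue_on \<Omega>. (\<lambda>k. w k x) \<longlonglongrightarrow> u x"
  shows "AE x in lebesgue_on \<Omega>. u x = 0 \<longrightarrow> V x = 0"
proof -
  note fin = emeasure_lebesgue_on_space[OF \<Omega>]
  note [measurable] = sobolev_approx_measurable[OF a]
  have Lp: "Lp_on p (lebesgue_on \<Omega>) u" "Lp_on p (lebesgue_on \<Omega>) V" using a by (auto simp: sobolev_approx_def)
  have lV: "locally_integrable \<Omega> V"
    using Lp_on_imp_integrable[OF Lp(2) p fin(1)] \<Omega> by (auto intro: integrable_imp_locally_integrable)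
  define d where "d = (\<lambda>n. inverse (real (Suc n)))"
  have d: "0 < d n" "d \<longlonglongrightarrow> 0" for n unfolding d_def using LIMSEQ_inverse_real_of_nat by auto
  define \<theta> where "\<theta> n s = s * (d n)\<^sup>2 / (s\<^sup>2 + (d n)\<^sup>2)" for n s
  define \<theta>' where "\<theta>' n s = (d n)\<^sup>2 * ((d n)\<^sup>2 - s\<^sup>2) / (s\<^sup>2 + (d n)\<^sup>2)\<^sup>2" for n s
  have sb: "smooth_bounded (\<theta> n) (\<theta>' n) (1 + d n)" "\<bar>\<theta> n s\<bar> \<le> d n" "\<bar>\<theta>' n s\<bar> \<le> 1" for n s
    unfolding \<theta>_def[abs_def] \<theta>'_def[abs_def] by (rule smooth_bounded_near_identity[OF d(1)])+
  have [measurable]: "\<theta> n \<in> borel_measurable borel" "\<theta>' n \<in> borel_measurable borel" for n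
    using sb(1)[of n] by (auto simp: smooth_bounded_def intro: smooth_borel borel_measurable_continuous_onI)
  have lim': "(\<lambda>n. \<theta>' n s) \<longlonglongrightarrow> (if s = 0 then 1 else 0)" for s
  proof (cases "s = 0")
    case True
    then have "\<theta>' n s = 1" for n using d(1)[of n] by (simp add: \<theta>'_def power2_eq_square)
    then show ?thesis using True by simp
  next
    case False
    have "(\<lambda>n. (d n)\<^sup>2 * ((d n)\<^sup>2 - s\<^sup>2) / (s\<^sup>2 + (d n)\<^sup>2)\<^sup>2) \<longlonglongrightarrow> 0\<^sup>2 * (0\<^sup>2 - s\<^sup>2) / (s\<^sup>2 + 0\<^sup>2)\<^sup>2"
      using False by (intro tendsto_intros d) simp
    then show ?thesis using False by (simp add: \<theta>'_def)
  qed
  have wg: "has_weak_gradient \<Omega> (\<lambda>x. \<theta> n (u x)) (\<lambda>x. \<theta>' n (u x) *\<^sub>R V x)" for n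
    by (rule sobolev_approx_has_weak_gradient[OF sobolev_approx_compose[OF a sb(1) _ ptw fin(2) \<Omega>(1)] p \<Omega>]) (use p in simp)
  let ?Z = "\<lambda>x. if u x = 0 then 1 else 0 :: real"
  have "AE x in lebesgue_on \<Omega>. ?Z x * (V x \<bullet> b) = 0" if b: "b \<in> Basis" for b
  proof (rule AE_eq_0_if_test_integrals_eq_0[OF \<Omega>(1)])
    have "integrable (lebesgue_on \<Omega>) (\<lambda>x. ?Z x * (V x \<bullet> b))"
    proof (rule Bochner_Integration.integrable_bound)
      show "integrable (lebesgue_on \<Omega>) (\<lambda>x. V x \<bullet> b)" using Lp_on_imp_integrable[OF Lp(2) p fin(1)] by simp
      show "(\<lambda>x. ?Z x * (V x \<bullet> b)) \<in> borel_measurable (lebesgue_on \<Omega>)" by measurable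
    qed auto
    then show "locally_integrable \<Omega> (\<lambda>x. ?Z x * (V x \<bullet> b))" using \<Omega> by (intro integrable_imp_locally_integrable)
    fix \<psi> assume \<psi>: "\<psi> \<in> test_functions \<Omega>"
    note [measurable] = lebesgue_on_smooth_measurable[OF test_smooth[OF \<psi>], of \<Omega>]
    have i1: "integrable (lebesgue_on \<Omega>) (\<lambda>x. 1 * (gradient \<psi> x \<bullet> b))"
      by (rule integrable_test_mult(2)[OF continuous_locally_integrable \<Omega>(1) \<psi>]) (use \<Omega> in auto)
    have i2: "integrable (lebesgue_on \<Omega>) (\<lambda>x. (V x \<bullet> b) * \<psi> x)"
      by (rule integrable_test_mult(1)[OF locally_integrable_inner[OF lV] \<Omega>(1) \<psi>])
    have "(\<lambda>n. LINT x|lebesgue_on \<Omega>. \<theta> n (u x) * (gradient \<psi> x \<bullet> b)) \<longlonglongrightarrow> (LINT x|lebesgue_on \<Omega>. 0)"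
    proof (rule integral_dominated_convergence[where w="\<lambda>x. \<bar>gradient \<psi> x \<bullet> b\<bar>"])
      show "integrable (lebesgue_on \<Omega>) (\<lambda>x. \<bar>gradient \<psi> x \<bullet> b\<bar>)" using i1 by simp
      show "AE x in lebesgue_on \<Omega>. (\<lambda>n. \<theta> n (u x) * (gradient \<psi> x \<bullet> b)) \<longlonglongrightarrow> 0"
      proof (intro AE_I2 tendsto_mult_left_zero)
        show "(\<lambda>n. \<theta> n (u x)) \<longlonglongrightarrow> 0" for x
          by (rule Lim_null_comparison[OF _ d(2)]) (use sb(2) in auto)
      qed
      have "d n \<le> 1" for n by (simp add: d_def inverse_le_1_iff)
      then show "AE x in lebesgue_on \<Omega>. norm (\<theta> n (u x) * (gradient \<psi> x \<bullet> b)) \<le> \<bar>gradient \<psi> x \<bullet> b\<bar>" for n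
        using sb(2)[of n] order_trans by (fastforce intro!: AE_I2 mult_left_le_one_le simp: abs_mult)
    qed measurable
    moreover have "(\<lambda>n. LINT x|lebesgue_on \<Omega>. ((\<theta>' n (u x) *\<^sub>R V x) \<bullet> b) * \<psi> x) \<longlonglongrightarrow> (LINT x|lebesgue_on \<Omega>. ?Z x * (V x \<bullet> b) * \<psi> x)"
    proof (rule integral_dominated_convergence[where w="\<lambda>x. \<bar>(V x \<bullet> b) * \<psi> x\<bar>"])
      show "integrable (lebesgue_on \<Omega>) (\<lambda>x. \<bar>(V x \<bullet> b) * \<psi> x\<bar>)" using i2 by simp
      show "AE x in lebesgue_on \<Omega>. (\<lambda>n. ((\<theta>' n (u x) *\<^sub>R V x) \<bullet> b) * \<psi> x) \<longlonglongrightarrow> ?Z x * (V x \<bullet> b) * \<psi> x"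
        unfolding inner_scaleR_left by (intro AE_I2 tendsto_intros lim')
      show "AE x in lebesgue_on \<Omega>. norm (((\<theta>' n (u x) *\<^sub>R V x) \<bullet> b) * \<psi> x) \<le> \<bar>(V x \<bullet> b) * \<psi> x\<bar>" for n
        using sb(3)[of n] by (auto intro!: AE_I2 mult_left_le_one_le simp: abs_mult mult.assoc)
    qed measurable
    then have "(\<lambda>n. LINT x|lebesgue_on \<Omega>. \<theta> n (u x) * (gradient \<psi> x \<bullet> b)) \<longlonglongrightarrow> - (LINT x|lebesgue_on \<Omega>. ?Z x * (V x \<bullet> b) * \<psi> x)"
      using wg \<psi> b tendsto_minus by (fastforce simp: has_weak_gradient_def)
    ultimately show "(LINT x|lebesgue_on \<Omega>. ?Z x * (V x \<bullet> b) * \<psi> x) = 0"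
      using LIMSEQ_unique by fastforce
  qed
  then have "AE x in lebesgue_on \<Omega>. \<forall>b\<in>Basis. ?Z x * (V x \<bullet> b) = 0"
    by (subst AE_finite_all) auto
  then show ?thesis by eventually_elim (auto simp: euclidean_eq_iff[of "V _"])
qed

lemma Lp_tendsto_AE_cong:
  assumes "Lp_tendsto p M w f" "AE x in M. f x = f' x"
  shows "Lp_tendsto p M w f'"
proof -
  have "(\<integral>\<^sup>+x. ennreal (norm (w k x - f x) powr p) \<partial>M) = (\<integral>\<^sup>+x. ennreal (norm (w k x - f' x) powr p) \<partial>M)" for k
    by (rule nn_integral_cong_AE) (use assms(2) in eventually_elim, simp)
  then show ?thesis using assms(1) by (simp add: Lp_tendsto_def)
qed

lemma space_surface_measure: "space (surface_measure \<Omega>) = frontier \<Omega>"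
  by (simp add: surface_measure_def space_restrict_space space_measure_of_conv)

lemma Lp_tendsto_surface_cong:
  assumes "Lp_tendsto p (surface_measure \<Omega>) w h" "\<And>k x. x \<in> frontier \<Omega> \<Longrightarrow> w' k x = w k x"
  shows "Lp_tendsto p (surface_measure \<Omega>) w' h"
proof -
  have "(\<integral>\<^sup>+x. ennreal (norm (w' k x - h x) powr p) \<partial>surface_measure \<Omega>) = (\<integral>\<^sup>+x. ennreal (norm (w k x - h x) powr p) \<partial>surface_measure \<Omega>)" for k
    by (rule nn_integral_cong) (use assms(2) in \<open>simp add: space_surface_measure\<close>)
  then show ?thesis using assms(1) by (simp add: Lp_tendsto_def)
qed

lemma W1p_bdry_sobolev_approx:
  fixes u :: "'a::euclidean_space \<Rightarrow> real"
  assumes u: "u \<in> W1p_bdry \<Omega> p \<phi>" and p: "1 \<le> p" and \<Omega>: "open \<Omega>" "bounded \<Omega>"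
  obtains w h where "sobolev_approx \<Omega> p w u (weak_gradient \<Omega> u)"
    "AE x in lebesgue_on \<Omega>. (\<lambda>k. w k x) \<longlonglongrightarrow> u x"
    "has_trace \<Omega> p \<phi> h" "Lp_on p (surface_measure \<Omega>) h" "Lp_tendsto p (surface_measure \<Omega>) w h"
proof -
  obtain h V w where *: "Lp_on p (lebesgue_on \<Omega>) u" "has_weak_gradient \<Omega> u V" "Lp_on p (lebesgue_on \<Omega>) V"
    "has_trace \<Omega> p \<phi> h" "Lp_on p (surface_measure \<Omega>) h" "\<And>k. smooth (w k)"
    "Lp_tendsto p (lebesgue_on \<Omega>) w u" "Lp_tendsto p (lebesgue_on \<Omega>) (\<lambda>k. gradient (w k)) (weak_gradient \<Omega> u)"
    "Lp_tendsto p (surface_measure \<Omega>) w h"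
    using u by (auto simp: W1p_bdry_def W1p_def has_trace_def)
  have wg: "has_weak_gradient \<Omega> u (weak_gradient \<Omega> u)" unfolding weak_gradient_def by (rule someI[of "has_weak_gradient \<Omega> u", OF *(2)])
  have "Lp_on p (lebesgue_on \<Omega>) (weak_gradient \<Omega> u)"
  proof (rule Lp_on_bound[OF *(3), of _ 1])
    show "weak_gradient \<Omega> u \<in> borel_measurable (lebesgue_on \<Omega>)"
      using wg by (simp add: has_weak_gradient_def locally_integrable_def)
    show "AE x in lebesgue_on \<Omega>. norm (weak_gradient \<Omega> u x) \<le> 1 * norm (V x)"
      using weak_gradient_AE_eq[OF \<Omega>(1) *(2)] by eventually_elim simp
  qed (use p in auto)
  then have a: "sobolev_approx \<Omega> p w u (weak_gradient \<Omega> u)" using * by (simp add: sobolev_approx_def)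
  obtain r where r: "strict_mono r" "AE x in lebesgue_on \<Omega>. (\<lambda>k. w (r k) x) \<longlonglongrightarrow> u x"
    using sobolev_approx_AE_subseq[OF a p \<Omega>] by blast
  show ?thesis
  proof (rule that[of "w \<circ> r" h])
    show "Lp_tendsto p (surface_measure \<Omega>) (w \<circ> r) h"
      using LIMSEQ_subseq_LIMSEQ[OF *(9)[unfolded Lp_tendsto_def] r(1)] by (simp add: Lp_tendsto_def o_def)
  qed (use r sobolev_approx_subseq[OF a r(1)] * in auto)
qed

text \<open>If \<open>w\<^sub>k\<close> is a sequence realizing the trace of \<open>u\<close>, then \<open>w\<^sub>k + t * \<psi> * \<theta>(w\<^sub>k)\<close> realizes the same
  trace for the perturbed function, because \<open>\<psi>\<close> vanishes on the boundary.\<close>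

lemma W1p_bdry_perturbation:
  fixes u :: "'a::euclidean_space \<Rightarrow> real"
  assumes u: "u \<in> W1p_bdry \<Omega> p \<phi>" and p: "1 \<le> p" and \<Omega>: "open \<Omega>" "bounded \<Omega>"
    and \<psi>: "\<psi> \<in> test_functions \<Omega>" and \<theta>: "smooth_bounded \<theta> \<theta>' C"
  defines "W \<equiv> \<lambda>x. \<theta> (u x) *\<^sub>R gradient \<psi> x + (\<psi> x * \<theta>' (u x)) *\<^sub>R weak_gradient \<Omega> u x"
  shows "(\<lambda>x. u x + t * (\<psi> x * \<theta> (u x))) \<in> W1p_bdry \<Omega> p \<phi>"
    "AE x in lebesgue_on \<Omega>. weak_gradient \<Omega> (\<lambda>x. u x + t * (\<psi> x * \<theta> (u x))) x = weak_gradient \<Omega> u x + t *\<^sub>R W x"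
    "Lp_on p (lebesgue_on \<Omega>) W"
proof -
  obtain w h where a: "sobolev_approx \<Omega> p w u (weak_gradient \<Omega> u)"
    and ptw: "AE x in lebesgue_on \<Omega>. (\<lambda>k. w k x) \<longlonglongrightarrow> u x"
    and h: "has_trace \<Omega> p \<phi> h" "Lp_on p (surface_measure \<Omega>) h" "Lp_tendsto p (surface_measure \<Omega>) w h"
    by (rule W1p_bdry_sobolev_approx[OF u p \<Omega>])
  have s\<psi>: "smooth \<psi>" by (rule test_smooth[OF \<psi>])
  have pert: "sobolev_approx \<Omega> p (\<lambda>k x. (t * \<psi> x) * \<theta> (w k x)) (\<lambda>x. (t * \<psi> x) * \<theta> (u x)) (\<lambda>x. t *\<^sub>R W x)" for t
  proof -
    have "sobolev_approx \<Omega> p (\<lambda>k x. (t * \<psi> x) * \<theta> (w k x)) (\<lambda>x. (t * \<psi> x) * \<theta> (u x))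
      (\<lambda>x. (t * \<psi> x) *\<^sub>R (\<theta>' (u x) *\<^sub>R weak_gradient \<Omega> u x) + \<theta> (u x) *\<^sub>R gradient (\<lambda>x. t * \<psi> x) x)"
      by (rule sobolev_approx_test_mult[OF sobolev_approx_compose[OF a \<theta> _ ptw emeasure_lebesgue_on_space(2)[OF \<Omega>] \<Omega>(1)] test_cmult[OF \<psi>]])
        (use p in auto)
    then show ?thesis by (simp add: W_def gradient_cmult[OF s\<psi>] scaleR_add_right add.commute mult_ac)
  qed
  let ?v = "\<lambda>x. u x + t * \<psi> x * \<theta> (u x)"
  have v: "sobolev_approx \<Omega> p (\<lambda>k x. w k x + t * \<psi> x * \<theta> (w k x)) ?v (\<lambda>x. weak_gradient \<Omega> u x + t *\<^sub>R W x)"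
    by (rule sobolev_approx_add[OF a pert]) (use p in simp)
  have wg: "has_weak_gradient \<Omega> ?v (\<lambda>x. weak_gradient \<Omega> u x + t *\<^sub>R W x)"
    by (rule sobolev_approx_has_weak_gradient[OF v p \<Omega>])
  have AE: "AE x in lebesgue_on \<Omega>. weak_gradient \<Omega> ?v x = weak_gradient \<Omega> u x + t *\<^sub>R W x"
    by (rule weak_gradient_AE_eq[OF \<Omega>(1) wg])
  then show "AE x in lebesgue_on \<Omega>. weak_gradient \<Omega> (\<lambda>x. u x + t * (\<psi> x * \<theta> (u x))) x = weak_gradient \<Omega> u x + t *\<^sub>R W x"
    by (simp add: mult.assoc)
  show "Lp_on p (lebesgue_on \<Omega>) W" using pert[of 1] by (simp add: sobolev_approx_def)
  have "has_trace \<Omega> p ?v h"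
    unfolding has_trace_def
  proof (intro conjI h exI[of _ "\<lambda>k x. w k x + t * \<psi> x * \<theta> (w k x)"] allI)
    show "smooth (\<lambda>x. w k x + t * \<psi> x * \<theta> (w k x))" for k using v by (simp add: sobolev_approx_def)
    show "Lp_tendsto p (lebesgue_on \<Omega>) (\<lambda>k x. w k x + t * \<psi> x * \<theta> (w k x)) ?v" using v by (simp add: sobolev_approx_def)
    show "Lp_tendsto p (lebesgue_on \<Omega>) (\<lambda>k. gradient (\<lambda>x. w k x + t * \<psi> x * \<theta> (w k x))) (weak_gradient \<Omega> ?v)"
      by (rule Lp_tendsto_AE_cong[of _ _ _ "\<lambda>x. weak_gradient \<Omega> u x + t *\<^sub>R W x"])
        (use v AE in \<open>auto simp: sobolev_approx_def elim!: eventually_mono\<close>)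
    show "Lp_tendsto p (surface_measure \<Omega>) (\<lambda>k x. w k x + t * \<psi> x * \<theta> (w k x)) h"
    proof (rule Lp_tendsto_surface_cong[OF h(3)])
      fix k x assume "x \<in> frontier \<Omega>"
      then have "x \<notin> \<Omega>" using \<Omega>(1) by (simp add: frontier_def interior_open)
      then show "w k x + t * \<psi> x * \<theta> (w k x) = w k x" using test_off[OF \<psi>] by simp
    qed
  qed
  moreover have "?v \<in> W1p \<Omega> p" using v wg by (auto simp: W1p_def sobolev_approx_def)
  ultimately show "(\<lambda>x. u x + t * (\<psi> x * \<theta> (u x))) \<in> W1p_bdry \<Omega> p \<phi>"
    using h(1) by (auto simp: W1p_bdry_def mult.assoc)
qed

section \<open>Convex energy densities\<close>

text \<open>The properties of the density \<open>G\<close> hold for almost every point only, so measurability of its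
  compositions relies on completeness of Lebesgue measure.\<close>

lemma borel_measurable_lebesgue_on_AE:
  fixes f :: "'a::euclidean_space \<Rightarrow> real"
  assumes f: "f \<in> borel_measurable (lebesgue_on \<Omega>)" and ae: "AE x in lebesgue_on \<Omega>. f x = g x" and \<Omega>: "open \<Omega>"
  shows "g \<in> borel_measurable (lebesgue_on \<Omega>)"
proof -
  have 1: "(\<lambda>x. indicator \<Omega> x *\<^sub>R f x) \<in> borel_measurable lebesgue"
    using f \<Omega> by (subst borel_measurable_restrict_space_iff[symmetric]) auto
  have "AE x in lebesgue. x \<in> \<Omega> \<longrightarrow> f x = g x" using ae \<Omega> by (subst (asm) AE_restrict_space_iff) auto
  then have "AE x in lebesgue. indicator \<Omega> x *\<^sub>R f x = indicator \<Omega> x *\<^sub>R g x"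
    by eventually_elim (auto simp: indicator_def)
  from borel_measurable_AE[OF 1 this] show ?thesis
    using \<Omega> by (subst borel_measurable_restrict_space_iff) auto
qed

text \<open>For simple \<open>V\<close> the composition is a finite sum; the general case follows by continuity in the
  second argument.\<close>

lemma caratheodory_composition_measurable:
  fixes G :: "'a::euclidean_space \<Rightarrow> 'b::euclidean_space \<Rightarrow> real"
  assumes \<Omega>: "open \<Omega>" and G: "\<And>\<xi>. (\<lambda>X. G X \<xi>) \<in> borel_measurable (lebesgue_on \<Omega>)"
    and cont: "AE X in lebesgue_on \<Omega>. continuous_on UNIV (G X)"
    and V: "V \<in> borel_measurable (lebesgue_on \<Omega>)"
  shows "(\<lambda>X. G X (V X)) \<in> borel_measurable (lebesgue_on \<Omega>)"
proof -
  let ?M = "lebesgue_on \<Omega>"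
  obtain N where N: "N \<in> null_sets ?M" "{X \<in> space ?M. \<not> continuous_on UNIV (G X)} \<subseteq> N"
    using cont unfolding eventually_ae_filter by blast
  obtain s where s: "\<And>i. simple_function ?M (s i)" "\<And>X. X \<in> space ?M \<Longrightarrow> (\<lambda>i. s i X) \<longlonglongrightarrow> V X"
    using borel_measurable_implies_sequence_metric[OF V] by metis
  define H where "H X \<xi> = (if X \<in> N then 0 else G X \<xi>)" for X \<xi>
  have NM: "N \<in> sets ?M" using N by auto
  have Hm: "(\<lambda>X. H X \<xi>) \<in> borel_measurable ?M" for \<xi>
    unfolding H_def using NM G by (intro measurable_If_set) auto
  have "(\<lambda>X. H X (s i X)) \<in> borel_measurable ?M" for i
  proof -
    have fin: "finite (s i ` space ?M)" using s(1) by (simp add: simple_function_def)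
    have "(\<lambda>X. \<Sum>\<xi>\<in>s i ` space ?M. indicator (s i -` {\<xi>} \<inter> space ?M) X * H X \<xi>) \<in> borel_measurable ?M"
      using s(1)[of i] Hm by (intro borel_measurable_sum borel_measurable_times) (auto simp: simple_function_def)
    moreover have "(\<Sum>\<xi>\<in>s i ` space ?M. indicator (s i -` {\<xi>} \<inter> space ?M) X * H X \<xi>) = H X (s i X)"
      if X: "X \<in> space ?M" for X
    proof -
      have "(\<Sum>\<xi>\<in>s i ` space ?M. indicator (s i -` {\<xi>} \<inter> space ?M) X * H X \<xi>)
          = (\<Sum>\<xi>\<in>s i ` space ?M. if \<xi> = s i X then H X (s i X) else 0)"
        using X by (intro sum.cong) (auto simp: indicator_def)
      also have "\<dots> = H X (s i X)" using fin X by simp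
      finally show ?thesis .
    qed
    ultimately show ?thesis by (rule measurable_cong[THEN iffD1, rotated])
  qed
  moreover have "(\<lambda>i. H X (s i X)) \<longlonglongrightarrow> H X (V X)" if X: "X \<in> space ?M" for X
  proof (cases "X \<in> N")
    case False
    then have "continuous_on UNIV (G X)" using N X by auto
    then have "isCont (G X) (V X)" by (simp add: continuous_on_eq_continuous_at)
    then show ?thesis using False s(2)[OF X] by (auto simp: H_def intro: isCont_tendsto_compose)
  qed (simp add: H_def)
  ultimately have "(\<lambda>X. H X (V X)) \<in> borel_measurable ?M" by (rule borel_measurable_LIMSEQ_real[rotated])
  moreover have "AE X in ?M. H X (V X) = G X (V X)"
    using AE_not_in[OF N(1)] by eventually_elim (simp add: H_def)
  ultimately show ?thesis by (rule borel_measurable_lebesgue_on_AE[OF _ _ \<Omega>])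
qed

text \<open>The function \<open>\<xi> \<mapsto> G X \<xi>\<close> at one fixed point \<open>X\<close>, to be instantiated at almost every point.\<close>

locale convex_density =
  fixes H :: "'a::euclidean_space \<Rightarrow> real" and p lam :: real
  assumes p: "1 \<le> p" and lam: "0 < lam" and convex: "convex_on UNIV H"
    and diff: "\<And>\<xi>. H differentiable (at \<xi>)"
    and lower: "\<And>\<xi>. lam * norm \<xi> powr p \<le> H \<xi>" and upper: "\<And>\<xi>. H \<xi> \<le> inverse lam * norm \<xi> powr p"
begin

lemma nonneg: "0 \<le> H \<xi>"
  using lower[of \<xi>] lam by (meson mult_nonneg_nonneg less_imp_le order_trans powr_ge_zero)

lemma zero: "H 0 = 0"
  using nonneg[of 0] upper[of 0] by simp

lemma quotient_tendsto:
  assumes "t \<longlonglongrightarrow> 0" "\<And>k::nat. t k \<noteq> 0"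
  shows "(\<lambda>k. (H (\<xi> + t k *\<^sub>R \<zeta>) - H \<xi>) / t k) \<longlonglongrightarrow> gradient H \<xi> \<bullet> \<zeta>"
proof -
  have "(H has_derivative (\<lambda>h. h \<bullet> gradient H \<xi>)) (at \<xi>)"
    using gradient_differentiable[OF diff] by (simp add: gderiv_def)
  then have "((\<lambda>s. H (\<xi> + s *\<^sub>R \<zeta>)) has_derivative (\<lambda>s. (s *\<^sub>R \<zeta>) \<bullet> gradient H \<xi>)) (at 0)"
    by (intro has_derivative_compose[where g=H and f="\<lambda>s. \<xi> + s *\<^sub>R \<zeta>"]) (auto intro!: derivative_eq_intros)
  then have "((\<lambda>s. H (\<xi> + s *\<^sub>R \<zeta>)) has_field_derivative (gradient H \<xi> \<bullet> \<zeta>)) (at 0)"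
    by (simp add: has_field_derivative_def inner_commute mult_commute_abs)
  then have "((\<lambda>s. (H (\<xi> + s *\<^sub>R \<zeta>) - H \<xi>) / s) \<longlongrightarrow> gradient H \<xi> \<bullet> \<zeta>) (at 0)"
    by (simp add: DERIV_def)
  moreover have "filterlim t (at 0) sequentially"
    using assms by (auto simp: filterlim_at)
  ultimately show ?thesis by (rule filterlim_compose)
qed

lemma quotient_le:
  assumes "0 < t" "t \<le> 1" shows "(H (\<xi> + t *\<^sub>R \<zeta>) - H \<xi>) / t \<le> H (\<xi> + \<zeta>) - H \<xi>"
proof -
  have "H ((1 - t) *\<^sub>R \<xi> + t *\<^sub>R (\<xi> + \<zeta>)) \<le> (1 - t) * H \<xi> + t * H (\<xi> + \<zeta>)"
    using convex_onD[OF convex, of t \<xi> "\<xi> + \<zeta>"] assms by simp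
  moreover have "(1 - t) *\<^sub>R \<xi> + t *\<^sub>R (\<xi> + \<zeta>) = \<xi> + t *\<^sub>R \<zeta>" by (simp add: algebra_simps)
  ultimately have "H (\<xi> + t *\<^sub>R \<zeta>) - H \<xi> \<le> (H (\<xi> + \<zeta>) - H \<xi>) * t" by (simp add: algebra_simps)
  then show ?thesis using assms by (subst pos_divide_le_eq)
qed

lemma tangent_le: "gradient H \<xi> \<bullet> \<zeta> \<le> H (\<xi> + \<zeta>) - H \<xi>"
proof (rule LIMSEQ_le_const2[OF quotient_tendsto[OF LIMSEQ_inverse_real_of_nat]])
  show "\<exists>N. \<forall>n\<ge>N. (H (\<xi> + inverse (real (Suc n)) *\<^sub>R \<zeta>) - H \<xi>) / inverse (real (Suc n)) \<le> H (\<xi> + \<zeta>) - H \<xi>"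
    by (intro exI allI impI quotient_le) (auto simp: inverse_le_1_iff simp del: of_nat_Suc)
qed auto

lemma abs_gradient_inner_le: "\<bar>gradient H \<xi> \<bullet> \<zeta>\<bar> \<le> H (\<xi> + \<zeta>) + H (\<xi> - \<zeta>)"
  using tangent_le[of \<xi> \<zeta>] tangent_le[of \<xi> "- \<zeta>"] nonneg[of \<xi>] nonneg[of "\<xi> + \<zeta>"] nonneg[of "\<xi> - \<zeta>"] by auto

lemma abs_quotient_le:
  assumes "0 < t" "t \<le> 1" shows "\<bar>(H (\<xi> + t *\<^sub>R \<zeta>) - H \<xi>) / t\<bar> \<le> H (\<xi> + \<zeta>) + H (\<xi> - \<zeta>)"
proof -
  have "(gradient H \<xi> \<bullet> (t *\<^sub>R \<zeta>)) / t \<le> (H (\<xi> + t *\<^sub>R \<zeta>) - H \<xi>) / t"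
    using tangent_le[of \<xi> "t *\<^sub>R \<zeta>"] assms by (intro divide_right_mono) auto
  then have "gradient H \<xi> \<bullet> \<zeta> \<le> (H (\<xi> + t *\<^sub>R \<zeta>) - H \<xi>) / t" using assms by simp
  then show ?thesis using abs_gradient_inner_le[of \<xi> \<zeta>] quotient_le[OF assms, of \<xi> \<zeta>]
      nonneg[of \<xi>] nonneg[of "\<xi> - \<zeta>"] by linarith
qed

lemma gradient_inner_self_nonneg: "0 \<le> gradient H \<xi> \<bullet> \<xi>"
  using tangent_le[of \<xi> "- \<xi>"] nonneg[of \<xi>] zero by simp

lemma gradient_0: "gradient H 0 = 0"
proof (rule gradient_eqI)
  have d: "(H has_derivative (\<lambda>h. h \<bullet> gradient H 0)) (at 0)"
    using gradient_differentiable[OF diff] by (simp add: gderiv_def)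
  have "(\<lambda>h. h \<bullet> gradient H 0) = (\<lambda>h. 0)"
    by (rule differential_zero_maxmin[of 0 UNIV H]) (use d zero nonneg in auto)
  then show "GDERIV H 0 :> 0" using d by (simp add: gderiv_def)
qed

lemma norm_gradient_le: "norm (gradient H \<xi>) \<le> inverse lam * 2 powr p * (norm \<xi> powr p + 1)"
proof (cases "gradient H \<xi> = 0")
  case True then show ?thesis using lam by simp
next
  case False
  let ?e = "gradient H \<xi> /\<^sub>R norm (gradient H \<xi>)"
  have "norm (gradient H \<xi>) = gradient H \<xi> \<bullet> ?e"
    using False by (simp add: dot_square_norm power2_eq_square)
  also have "\<dots> \<le> H (\<xi> + ?e)" using tangent_le[of \<xi> ?e] nonneg[of \<xi>] by simp
  also have "\<dots> \<le> inverse lam * norm (\<xi> + ?e) powr p" by (rule upper)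
  also have "\<dots> \<le> inverse lam * (2 powr p * (norm \<xi> powr p + norm ?e powr p))"
    using lam p by (intro mult_left_mono norm_add_powr_le) auto
  also have "norm ?e = 1" using False by simp
  finally show ?thesis by (simp add: mult.assoc)
qed

end

lemma strictly_convex_imp_convex_on: "strictly_convex_on UNIV f \<Longrightarrow> convex_on UNIV f"
  unfolding strictly_convex_on_def convex_on_def
proof (intro conjI ballI allI impI convex_UNIV)
  fix x y and a b :: real
  assume f: "convex UNIV \<and> (\<forall>x\<in>UNIV. \<forall>y\<in>UNIV. \<forall>t. x \<noteq> y \<and> 0 < t \<and> t < 1 \<longrightarrow> f ((1 - t) *\<^sub>R x + t *\<^sub>R y) < (1 - t) * f x + t * f y)"
    and ab: "0 \<le> a" "0 \<le> b" "a + b = 1"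
  have a: "a = 1 - b" using ab by simp
  show "f (a *\<^sub>R x + b *\<^sub>R y) \<le> a * f x + b * f y"
  proof (cases "x = y \<or> b = 0 \<or> b = 1")
    case True
    have "(1 - b) *\<^sub>R y + b *\<^sub>R y = y" "(1 - b) * f y + b * f y = f y" by (simp_all add: algebra_simps)
    then show ?thesis using True a by auto
  next
    case False then show ?thesis using f ab unfolding a by (auto intro: less_imp_le)
  qed
qed

lemma powr_diff_le:
  fixes a b R m :: real
  assumes "1 \<le> m" "0 \<le> a" "a \<le> R" "0 \<le> b" "b \<le> R"
  shows "\<bar>a powr m - b powr m\<bar> \<le> m * R powr (m - 1) * \<bar>a - b\<bar>"
proof -
  have *: "\<bar>a powr m - b powr m\<bar> \<le> m * R powr (m - 1) * \<bar>a - b\<bar>" if ab: "0 \<le> b" "b < a" "a \<le> R" for a b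
  proof -
    have "\<exists>l z. b < z \<and> z < a \<and> DERIV (\<lambda>s. s powr m) z :> l \<and> a powr m - b powr m = (a - b) * l"
    proof (rule MVT[OF ab(2)])
      show "continuous_on {b..a} (\<lambda>s. s powr m)"
        using ab assms by (intro continuous_on_powr' continuous_intros) auto
      show "(\<lambda>s. s powr m) differentiable (at x)" if "b < x" "x < a" for x
        using has_real_derivative_powr[of x m] that ab unfolding real_differentiable_def by fastforce
    qed
    then obtain l z where z: "b < z" "z < a" "((\<lambda>s. s powr m) has_field_derivative l) (at z)" "a powr m - b powr m = (a - b) * l"
      by blast
    have "0 < z" using z that by simp
    then have "l = m * z powr (m - 1)" using DERIV_unique[OF z(3) has_real_derivative_powr] by simp
    moreover have "z powr (m - 1) \<le> R powr (m - 1)" using z that assms by (intro powr_mono2) auto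
    ultimately have "0 \<le> l" "l \<le> m * R powr (m - 1)" using assms by (auto intro: mult_left_mono)
    then show ?thesis unfolding z(4) using that by (simp add: abs_mult mult.commute mult_left_mono)
  qed
  consider "b < a" | "a < b" | "a = b" by linarith
  then show ?thesis using *[of b a] *[of a b] assms by cases (auto simp: abs_minus_commute)
qed

section \<open>The variational inequality\<close>

text \<open>The hypotheses in the form in which the variational argument uses them.\<close>

locale minimizer_setting =
  fixes \<Omega> :: "'a::euclidean_space set" and p m lam K q :: real
    and \<phi> f Q u :: "'a \<Rightarrow> real" and F :: "'a \<Rightarrow> real \<Rightarrow> 'a \<Rightarrow> real"
    and G :: "'a \<Rightarrow> 'a \<Rightarrow> real"
  assumes open_\<Omega>: "open \<Omega>" and bounded_\<Omega>: "bounded \<Omega>" and m: "1 \<le> m" "m < p"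
    and F: "\<And>X s \<xi>. X \<in> \<Omega> \<Longrightarrow> F X s \<xi> = G X \<xi> + (f X * (max s 0) powr m + Q X * indicator {0<..} s)"
    and G_measurable: "\<And>\<xi>. (\<lambda>X. G X \<xi>) \<in> borel_measurable (lebesgue_on \<Omega>)"
    and G_density: "AE X in lebesgue_on \<Omega>. convex_density (G X) p lam"
    and f: "f \<in> borel_measurable (lebesgue_on \<Omega>)" "\<And>X. X \<in> \<Omega> \<Longrightarrow> \<bar>f X\<bar> \<le> K"
    and Q: "Q \<in> borel_measurable (lebesgue_on \<Omega>)" "\<And>X. X \<in> \<Omega> \<Longrightarrow> 0 \<le> Q X \<and> Q X \<le> q"
    and minimizer: "is_minimizer \<Omega> p \<phi> F u"
    and continuous_u: "continuous_on \<Omega> u"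
begin

abbreviation M where "M \<equiv> lebesgue_on \<Omega>"
abbreviation Du where "Du \<equiv> weak_gradient \<Omega> u"

definition flux :: "'a \<Rightarrow> 'a" where "flux X = gradient (G X) (Du X)"

definition source :: "'a \<Rightarrow> real" where "source X = m * f X * u X powr (m - 1) * indicator {X. 0 < u X} X"

lemma p: "1 \<le> p" "0 < p" "0 \<le> p" using m by auto

lemma u_bdry: "u \<in> W1p_bdry \<Omega> p \<phi>" using minimizer by (simp add: is_minimizer_def)

lemma finite_M: "emeasure M (space M) < \<infinity>" by (rule emeasure_lebesgue_on_space(1)[OF open_\<Omega> bounded_\<Omega>])

lemma integrable_const_M: "integrable M (\<lambda>X. c :: real)"
  using finite_M by (intro finite_measure.integrable_const finite_measureI) (simp add: less_top)

lemma Du_Lp: "Lp_on p M u" "Lp_on p M Du"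
  using W1p_bdry_sobolev_approx[OF u_bdry p(1) open_\<Omega> bounded_\<Omega>] by (auto simp: sobolev_approx_def)

lemma u_measurable [measurable]: "u \<in> borel_measurable M" and Du_measurable [measurable]: "Du \<in> borel_measurable M"
  using Du_Lp by (auto simp: Lp_on_def)

lemma G_comp_measurable: "V \<in> borel_measurable M \<Longrightarrow> (\<lambda>X. G X (V X)) \<in> borel_measurable M"
proof (rule caratheodory_composition_measurable[OF open_\<Omega> G_measurable])
  show "AE X in M. continuous_on UNIV (G X)" using G_density
  proof eventually_elim
    case (elim X)
    interpret convex_density "G X" p lam by fact
    show ?case using diff by (auto intro!: differentiable_imp_continuous_on simp: differentiable_on_def)
  qed
qed

lemma G_comp_integrable:
  assumes V: "Lp_on p M V" shows "integrable M (\<lambda>X. G X (V X))"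
proof (rule Bochner_Integration.integrable_bound)
  show "integrable M (\<lambda>X. inverse lam * norm (V X) powr p)" using V by (simp add: Lp_on_def)
  show "(\<lambda>X. G X (V X)) \<in> borel_measurable M" using V by (intro G_comp_measurable) (simp add: Lp_on_def)
  show "AE X in M. norm (G X (V X)) \<le> norm (inverse lam * norm (V X) powr p)" using G_density
  proof eventually_elim
    case (elim X)
    interpret convex_density "G X" p lam by fact
    show ?case using upper[of "V X"] nonneg[of "V X"] by simp
  qed
qed

text \<open>Step sizes of the variations; a sequence is needed for dominated convergence.\<close>

definition step :: "nat \<Rightarrow> real" where "step k = inverse (real (Suc k))"

lemma step: "0 < step k" "step k \<le> 1" "step \<longlonglongrightarrow> 0" "step k \<noteq> 0"
  using LIMSEQ_inverse_real_of_nat by (auto simp: step_def[abs_def] inverse_le_1_iff simp del: of_nat_Suc)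

lemma
  assumes W: "Lp_on p M W"
  shows flux_inner_integrable: "integrable M (\<lambda>X. flux X \<bullet> W X)"
    and G_first_variation: "0 < \<tau> \<Longrightarrow> \<tau> \<le> 1 \<Longrightarrow>
      (\<lambda>k. LINT X|M. (G X (Du X + (\<tau> * step k) *\<^sub>R W X) - G X (Du X)) / (\<tau> * step k)) \<longlonglongrightarrow> (LINT X|M. flux X \<bullet> W X)"
proof -
  have Wm [measurable]: "W \<in> borel_measurable M" using W by (simp add: Lp_on_def)
  have Lp: "Lp_on p M (\<lambda>X. Du X + s *\<^sub>R W X)" for s
    using Du_Lp(2) W p by (intro Lp_on_add Lp_on_scaleR) auto
  have int: "integrable M (\<lambda>X. G X (Du X + s *\<^sub>R W X))" for s by (rule G_comp_integrable[OF Lp])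
  \<comment> \<open>By convexity this bounds the difference quotients for all step sizes up to \<open>1\<close>.\<close>
  let ?b = "\<lambda>X. G X (Du X + W X) + G X (Du X - W X)"
  have intb: "integrable M ?b" using int[of 1] int[of "-1"] by simp
  have mq: "(\<lambda>X. (G X (Du X + s *\<^sub>R W X) - G X (Du X)) / s) \<in> borel_measurable M" for s
    using int[of s] int[of 0] by (intro borel_measurable_divide borel_measurable_diff) auto
  have lim: "AE X in M. (\<lambda>k. (G X (Du X + (\<tau> * step k) *\<^sub>R W X) - G X (Du X)) / (\<tau> * step k)) \<longlonglongrightarrow> flux X \<bullet> W X"
    if "0 < \<tau>" "\<tau> \<le> 1" for \<tau>
    using G_density
  proof eventually_elim
    case (elim X)
    interpret convex_density "G X" p lam by fact
    show ?case unfolding flux_def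
    proof (rule quotient_tendsto)
      show "(\<lambda>k. \<tau> * step k) \<longlonglongrightarrow> 0" using tendsto_mult_right_zero[OF step(3)] .
      show "\<tau> * step k \<noteq> 0" for k using that step(4) by simp
    qed
  qed
  have \<tau>step: "0 < \<tau> * step k" "\<tau> * step k \<le> 1" if "0 < \<tau>" "\<tau> \<le> 1" for k \<tau>
    using that step(1,2)[of k] by (auto intro: mult_le_one)
  have bound: "AE X in M. norm ((G X (Du X + (\<tau> * step k) *\<^sub>R W X) - G X (Du X)) / (\<tau> * step k)) \<le> ?b X"
    if "0 < \<tau>" "\<tau> \<le> 1" for k \<tau>
    using G_density
  proof eventually_elim
    case (elim X)
    interpret convex_density "G X" p lam by fact
    show ?case using abs_quotient_le[OF \<tau>step[OF that]] by simp
  qed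
  have "(\<lambda>X. lim (\<lambda>k. (G X (Du X + (1 * step k) *\<^sub>R W X) - G X (Du X)) / (1 * step k))) \<in> borel_measurable M"
    by (intro borel_measurable_lim_metric mq)
  moreover have "AE X in M. lim (\<lambda>k. (G X (Du X + (1 * step k) *\<^sub>R W X) - G X (Du X)) / (1 * step k)) = flux X \<bullet> W X"
    using lim[of 1, simplified] by (auto elim!: eventually_mono simp: limI)
  ultimately have mA: "(\<lambda>X. flux X \<bullet> W X) \<in> borel_measurable M"
    by (rule borel_measurable_lebesgue_on_AE[OF _ _ open_\<Omega>])
  show "integrable M (\<lambda>X. flux X \<bullet> W X)"
    by (rule integrable_dominated_convergence[OF mA mq intb lim bound]) auto
  show "(\<lambda>k. LINT X|M. (G X (Du X + (\<tau> * step k) *\<^sub>R W X) - G X (Du X)) / (\<tau> * step k)) \<longlonglongrightarrow> (LINT X|M. flux X \<bullet> W X)"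
    if "0 < \<tau>" "\<tau> \<le> 1"
    by (rule integral_dominated_convergence[OF mA mq intb lim[OF that] bound[OF that]])
qed

text \<open>The components of the flux are limits of difference quotients, which have been integrated in
  every direction of class \<open>L\<^sup>p\<close> above; constant directions belong to this class.\<close>

lemma flux_measurable [measurable]: "flux \<in> borel_measurable M"
proof (rule borel_measurable_euclidean_space[THEN iffD2], rule ballI)
  fix b :: 'a assume "b \<in> Basis"
  have "Lp_on p M (\<lambda>X. b)" using integrable_const_M by (simp add: Lp_on_def)
  from flux_inner_integrable[OF this] show "(\<lambda>X. flux X \<bullet> b) \<in> borel_measurable M" by simp
qed

lemma flux_integrable: "integrable M flux"
proof (rule Bochner_Integration.integrable_bound)
  show "integrable M (\<lambda>X. inverse lam * 2 powr p * (norm (Du X) powr p + 1))"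
    using Du_Lp(2) integrable_const_M by (intro integrable_mult_right Bochner_Integration.integrable_add) (auto simp: Lp_on_def)
  show "AE X in M. norm (flux X) \<le> norm (inverse lam * 2 powr p * (norm (Du X) powr p + 1))" using G_density
  proof eventually_elim
    case (elim X)
    interpret convex_density "G X" p lam by fact
    show ?case unfolding flux_def using norm_gradient_le[of "Du X"] by (rule order_trans) simp
  qed
qed measurable

lemma flux_locally_integrable: "locally_integrable \<Omega> flux"
  by (rule integrable_imp_locally_integrable[OF flux_integrable open_\<Omega>])

lemma source_measurable [measurable]: "source \<in> borel_measurable M"
proof -
  have [measurable]: "f \<in> borel_measurable M" by (rule f)
  have "source = (\<lambda>X. m * f X * u X powr (m - 1) * (if 0 < u X then 1 else 0))" by (auto simp: source_def indicator_def)
  also have "\<dots> \<in> borel_measurable M" by measurable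
  finally show ?thesis .
qed

lemma source_locally_integrable: "locally_integrable \<Omega> source"
  unfolding locally_integrable_def
proof (intro conjI allI impI source_measurable)
  fix C assume C: "compact C \<and> C \<subseteq> \<Omega>"
  have "bounded (u ` C)"
    using C continuous_u by (auto intro!: compact_imp_bounded compact_continuous_image intro: continuous_on_subset)
  then obtain B where B: "\<And>X. X \<in> C \<Longrightarrow> \<bar>u X\<bar> \<le> B" unfolding bounded_iff by auto
  have Cl: "C \<in> lmeasurable" using C lmeasurable_compact by blast
  show "integrable (lebesgue_on C) source"
  proof (rule finite_measure.integrable_const_bound[where B="m * K * B powr (m - 1)"])
    show "finite_measure (lebesgue_on C)" using Cl by (rule finite_measure_lebesgue_on)
    have "M = lebesgue_on \<Omega>" ..
    have "lebesgue_on C = restrict_space M C"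
      using C by (subst restrict_restrict_space) (auto intro: fmeasurableD[OF Cl] simp: Int_absorb1 open_\<Omega>)
    then show "source \<in> borel_measurable (lebesgue_on C)" using source_measurable measurable_restrict_space1 by metis
    show "AE X in lebesgue_on C. norm (source X) \<le> m * K * B powr (m - 1)"
    proof (rule AE_I2)
      fix X assume "X \<in> space (lebesgue_on C)"
      then have X: "X \<in> C" by simp
      then have fK: "\<bar>f X\<bar> \<le> K" using f(2) C by blast
      then have K: "0 \<le> K" by linarith
      show "norm (source X) \<le> m * K * B powr (m - 1)"
      proof (cases "0 < u X")
        case True
        then have "u X powr (m - 1) \<le> B powr (m - 1)" using B[OF X] m by (intro powr_mono2) auto
        then show ?thesis using True fK m K unfolding source_def by (auto simp: abs_mult intro!: mult_mono)
      next
        case False then show ?thesis using m K by (simp add: source_def)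
      qed
    qed
  qed
qed

text \<open>The difference quotient of the zeroth-order term of the energy, without the part that involves
  \<open>Q\<close>.\<close>

definition source_quotient :: "('a \<Rightarrow> real) \<Rightarrow> real \<Rightarrow> 'a \<Rightarrow> real" where
  "source_quotient \<eta> s X = f X * ((max (u X + s * \<eta> X) 0) powr m - (max (u X) 0) powr m) / s"

text \<open>At a point with \<open>u X \<le> 0\<close> the assumption on the sign makes the quotient vanish identically, so
  the kink of \<open>max s 0 powr m\<close> at \<open>0\<close> is never seen from the positive side.\<close>

lemma source_quotient_tendsto_pointwise:
  assumes s: "s \<longlonglongrightarrow> 0" "\<And>k. 0 < s k" and neg: "u X \<le> 0 \<Longrightarrow> (\<And>k. u X + s k * \<eta> X \<le> 0)"
  shows "(\<lambda>k. source_quotient \<eta> (s k) X) \<longlonglongrightarrow> source X * \<eta> X"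
proof (cases "0 < u X")
  case False
  then have "source_quotient \<eta> (s k) X = 0" for k using neg[of k] by (simp add: source_quotient_def max_def)
  then show ?thesis using False by (simp add: source_def)
next
  case True
  have "((\<lambda>s. (u X + s * \<eta> X) powr m) has_field_derivative m * (u X + 0 * \<eta> X) powr (m - 1) * \<eta> X) (at 0)"
    using True by (auto intro!: derivative_eq_intros DERIV_powr simp: divide_simps powr_diff)
  moreover have "eventually (\<lambda>s. 0 < u X + s * \<eta> X) (at 0)"
  proof (rule order_tendstoD(1)[OF _ True])
    have "((\<lambda>s. u X + s * \<eta> X) \<longlongrightarrow> u X + 0 * \<eta> X) (at 0)" by (intro tendsto_intros)
    then show "((\<lambda>s. u X + s * \<eta> X) \<longlongrightarrow> u X) (at 0)" by simp
  qed
  ultimately have "((\<lambda>s. ((max (u X + s * \<eta> X) 0) powr m - (max (u X) 0) powr m) / s) \<longlongrightarrow> m * u X powr (m - 1) * \<eta> X) (at 0)"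
    using True unfolding DERIV_def by (auto elim!: Lim_transform_eventually eventually_mono simp: max_def)
  moreover have "filterlim s (at 0) sequentially" using s by (auto simp: filterlim_at intro!: eventuallyI less_imp_neq[symmetric])
  ultimately have "(\<lambda>k. ((max (u X + s k * \<eta> X) 0) powr m - (max (u X) 0) powr m) / s k) \<longlonglongrightarrow> m * u X powr (m - 1) * \<eta> X"
    by (rule filterlim_compose)
  then have "(\<lambda>k. f X * (((max (u X + s k * \<eta> X) 0) powr m - (max (u X) 0) powr m) / s k)) \<longlonglongrightarrow> f X * (m * u X powr (m - 1) * \<eta> X)"
    by (intro tendsto_intros)
  then show ?thesis using True by (simp add: source_quotient_def source_def mult_ac)
qed

text \<open>On the compact set \<open>C\<close> the minimizer is bounded, so \<open>s \<mapsto> max s 0 powr m\<close> is Lipschitz on the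
  relevant range and yields the dominating function.\<close>

lemma source_quotient_integral_tendsto:
  assumes \<eta>: "\<eta> \<in> borel_measurable M" "\<And>X. X \<in> \<Omega> \<Longrightarrow> \<bar>\<eta> X\<bar> \<le> B" "compact C" "C \<subseteq> \<Omega>" "\<And>X. X \<notin> C \<Longrightarrow> \<eta> X = 0"
    and s: "s \<longlonglongrightarrow> 0" "\<And>k. 0 < s k" "\<And>k. s k \<le> 1" and neg: "\<And>X k. X \<in> \<Omega> \<Longrightarrow> u X \<le> 0 \<Longrightarrow> u X + s k * \<eta> X \<le> 0"
  shows "(\<lambda>k. LINT X|M. source_quotient \<eta> (s k) X) \<longlonglongrightarrow> (LINT X|M. source X * \<eta> X)" "\<And>k. integrable M (source_quotient \<eta> (s k))"
proof -
  have [measurable]: "\<eta> \<in> borel_measurable M" "f \<in> borel_measurable M" by (rule \<eta> f)+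
  have mR: "source_quotient \<eta> r \<in> borel_measurable M" for r unfolding source_quotient_def[abs_def] by measurable
  have "bounded (u ` C)"
    using \<eta> continuous_u by (auto intro!: compact_imp_bounded compact_continuous_image intro: continuous_on_subset)
  then obtain b where b: "\<And>X. X \<in> C \<Longrightarrow> \<bar>u X\<bar> \<le> b" unfolding bounded_iff by auto
  \<comment> \<open>Both \<open>u\<close> and the perturbed function have absolute value at most \<open>b + B\<close> on \<open>C\<close>.\<close>
  let ?R = "b + B"
  let ?w = "\<lambda>X. K * (m * ?R powr (m - 1) * B) * indicator C X"
  have intw: "integrable M ?w"
  proof (intro integrable_mult_right integrable_real_indicator)
    have "C \<in> lmeasurable" using \<eta> lmeasurable_compact by blast
    then show "C \<in> sets M" using \<eta>(4) open_\<Omega> by (auto simp: sets_restrict_space_iff fmeasurableD)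
    then show "emeasure M C < \<infinity>"
      using emeasure_mono[of C "space M" M] finite_M \<eta>(4) by (auto intro: order_le_less_trans)
  qed
  have bound: "norm (source_quotient \<eta> (s k) X) \<le> ?w X" if X: "X \<in> \<Omega>" for k X
  proof (cases "X \<in> C")
    case True
    have B: "\<bar>\<eta> X\<bar> \<le> B" "0 \<le> B" and f': "\<bar>f X\<bar> \<le> K" "0 \<le> K" using \<eta>(2)[OF X] f(2)[OF X] by auto
    have "\<bar>s k * \<eta> X\<bar> \<le> 1 * B" unfolding abs_mult using s(2,3)[of k] B by (intro mult_mono) auto
    then have r: "max (u X + s k * \<eta> X) 0 \<le> ?R" "max (u X) 0 \<le> ?R" using b[OF True] B by auto
    have "\<bar>(max (u X + s k * \<eta> X) 0) powr m - (max (u X) 0) powr m\<bar> \<le> m * ?R powr (m - 1) * \<bar>max (u X + s k * \<eta> X) 0 - max (u X) 0\<bar>"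
      by (rule powr_diff_le[OF m(1) _ r(1) _ r(2)]) auto
    also have "\<dots> \<le> m * ?R powr (m - 1) * (s k * B)"
    proof (rule mult_left_mono)
      have "\<bar>max (u X + s k * \<eta> X) 0 - max (u X) 0\<bar> \<le> \<bar>s k * \<eta> X\<bar>" by (auto simp: max_def)
      also have "\<dots> \<le> s k * B" unfolding abs_mult using s(2)[of k] B by (auto intro: mult_left_mono)
      finally show "\<bar>max (u X + s k * \<eta> X) 0 - max (u X) 0\<bar> \<le> s k * B" .
    qed (use m in simp)
    finally have "\<bar>f X\<bar> * \<bar>(max (u X + s k * \<eta> X) 0) powr m - (max (u X) 0) powr m\<bar> \<le> K * (m * ?R powr (m - 1) * (s k * B))"
      using f' by (intro mult_mono) auto
    then have "\<bar>f X\<bar> * \<bar>(max (u X + s k * \<eta> X) 0) powr m - (max (u X) 0) powr m\<bar> / s k \<le> K * (m * ?R powr (m - 1) * B)"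
      using s(2)[of k] by (subst pos_divide_le_eq) (auto simp: mult_ac)
    then show ?thesis using True s(2)[of k] by (simp add: source_quotient_def abs_mult abs_divide)
  next
    case False then show ?thesis using \<eta>(5)[OF False] by (simp add: source_quotient_def)
  qed
  have lim: "AE X in M. (\<lambda>k. source_quotient \<eta> (s k) X) \<longlonglongrightarrow> source X * \<eta> X"
    by (intro AE_I2 source_quotient_tendsto_pointwise s) (use neg in auto)
  have bound': "AE X in M. norm (source_quotient \<eta> (s k) X) \<le> ?w X" for k by (intro AE_I2 bound) simp
  have mh: "(\<lambda>X. source X * \<eta> X) \<in> borel_measurable M" by measurable
  show "(\<lambda>k. LINT X|M. source_quotient \<eta> (s k) X) \<longlonglongrightarrow> (LINT X|M. source X * \<eta> X)"
    by (rule integral_dominated_convergence[OF mh mR intw lim bound'])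
  show "integrable M (source_quotient \<eta> (s k))" for k
    by (rule Bochner_Integration.integrable_bound[OF intw mR]) (use bound in \<open>auto intro!: AE_I2 intro: order_trans[OF _ abs_ge_self]\<close>)
qed

lemma g_integrable:
  assumes v: "Lp_on p M v"
  shows "integrable M (\<lambda>X. f X * (max (v X) 0) powr m)" "integrable M (\<lambda>X. Q X * indicator {0<..} (v X))"
proof -
  have [measurable]: "v \<in> borel_measurable M" "f \<in> borel_measurable M" "Q \<in> borel_measurable M"
    using v f Q by (auto simp: Lp_on_def)
  show "integrable M (\<lambda>X. f X * (max (v X) 0) powr m)"
  proof (rule Bochner_Integration.integrable_bound)
    show "integrable M (\<lambda>X. K * (1 + norm (v X) powr p))"
      using v integrable_const_M by (intro integrable_mult_right Bochner_Integration.integrable_add) (auto simp: Lp_on_def)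
    show "AE X in M. norm (f X * (max (v X) 0) powr m) \<le> norm (K * (1 + norm (v X) powr p))"
    proof (rule AE_I2)
      fix X assume "X \<in> space M"
      then have fK: "\<bar>f X\<bar> \<le> K" using f(2) by simp
      have "(max (v X) 0) powr m \<le> 1 + norm (v X) powr p"
      proof (cases "norm (v X) \<le> 1")
        case True
        then have "(max (v X) 0) powr m \<le> 1 powr m" using m by (intro powr_mono2) auto
        then show ?thesis by (simp add: add_increasing2)
      next
        case False
        then have "(max (v X) 0) powr m \<le> norm (v X) powr m" using m by (intro powr_mono2) auto
        also have "\<dots> \<le> norm (v X) powr p" using False m by (intro powr_mono) auto
        finally show ?thesis by simp
      qed
      then have "\<bar>f X\<bar> * (max (v X) 0) powr m \<le> K * (1 + norm (v X) powr p)" using fK by (intro mult_mono) auto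
      also have "\<dots> \<le> norm (K * (1 + norm (v X) powr p))" by simp
      finally show "norm (f X * (max (v X) 0) powr m) \<le> norm (K * (1 + norm (v X) powr p))" by (simp add: abs_mult)
    qed
  qed measurable
  show "integrable M (\<lambda>X. Q X * indicator {0<..} (v X))"
  proof (rule Bochner_Integration.integrable_bound[OF integrable_const_M[of q]])
    show "AE X in M. norm (Q X * indicator {0<..} (v X)) \<le> norm q"
      using Q(2) by (intro AE_I2) (fastforce simp: indicator_def)
  qed measurable
qed

lemma energy_eq:
  assumes v: "Lp_on p M v" and V: "Lp_on p M V" and Dv: "AE X in M. weak_gradient \<Omega> v X = V X"
    and wm: "weak_gradient \<Omega> v \<in> borel_measurable M"
  shows "energy \<Omega> F v = (LINT X|M. G X (V X)) + (LINT X|M. f X * (max (v X) 0) powr m) + (LINT X|M. Q X * indicator {0<..} (v X))"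
proof -
  have "energy \<Omega> F v = (LINT X|M. G X (weak_gradient \<Omega> v X) + (f X * (max (v X) 0) powr m + Q X * indicator {0<..} (v X)))"
    unfolding energy_def by (rule Bochner_Integration.integral_cong) (auto simp: F)
  also have "\<dots> = (LINT X|M. G X (V X) + (f X * (max (v X) 0) powr m + Q X * indicator {0<..} (v X)))"
    using Dv G_comp_integrable[OF V] g_integrable[OF v] G_comp_measurable[OF wm]
    by (intro integral_cong_AE) (auto elim!: eventually_mono intro!: borel_measurable_add)
  also have "\<dots> = (LINT X|M. G X (V X)) + ((LINT X|M. f X * (max (v X) 0) powr m) + (LINT X|M. Q X * indicator {0<..} (v X)))"
    using G_comp_integrable[OF V] g_integrable[OF v] by simp
  finally show ?thesis by simp
qed

text \<open>First-order minimality along \<open>u + r * \<psi> * \<theta>(u)\<close>. The hypothesis that nonpositive values of \<open>u\<close>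
  stay nonpositive makes the discontinuous term with \<open>Q\<close> decrease, so it can be discarded; the
  other two terms are differentiable in \<open>r\<close>.\<close>

lemma variational_inequality:
  assumes \<psi>: "\<psi> \<in> test_functions \<Omega>" and \<theta>: "smooth_bounded \<theta> \<theta>' B" and \<tau>: "0 < \<tau>" "\<tau> \<le> 1"
    and neg: "\<And>X r. X \<in> \<Omega> \<Longrightarrow> u X \<le> 0 \<Longrightarrow> 0 < r \<Longrightarrow> r \<le> \<tau> \<Longrightarrow> u X + r * (\<psi> X * \<theta> (u X)) \<le> 0"
  shows "0 \<le> (LINT X|M. \<theta> (u X) * (flux X \<bullet> gradient \<psi> X)) + (LINT X|M. \<psi> X * \<theta>' (u X) * (flux X \<bullet> Du X))
    + (LINT X|M. source X * (\<psi> X * \<theta> (u X)))"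
    "integrable M (\<lambda>X. \<theta> (u X) * (flux X \<bullet> gradient \<psi> X))" "integrable M (\<lambda>X. \<psi> X * \<theta>' (u X) * (flux X \<bullet> Du X))"
proof -
  define W where "W X = \<theta> (u X) *\<^sub>R gradient \<psi> X + (\<psi> X * \<theta>' (u X)) *\<^sub>R Du X" for X
  define \<eta> where "\<eta> X = \<psi> X * \<theta> (u X)" for X
  define s where "s k = \<tau> * step k" for k
  have s: "s \<longlonglongrightarrow> 0" "0 < s k" "s k \<le> 1" "s k \<le> \<tau>" for k
    using tendsto_mult_right_zero[OF step(3), of \<tau>] \<tau> step(1,2)[of k] mult_left_mono[of "step k" 1 \<tau>]
    by (auto simp: s_def[abs_def] intro: mult_le_one)
  note pert = W1p_bdry_perturbation[OF u_bdry p(1) open_\<Omega> bounded_\<Omega> \<psi> \<theta>, folded W_def \<eta>_def]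
  have [measurable]: "\<theta> \<in> borel_measurable borel" "\<theta>' \<in> borel_measurable borel"
    using \<theta> by (auto simp: smooth_bounded_def intro: smooth_borel borel_measurable_continuous_onI)
  note [measurable] = lebesgue_on_smooth_measurable[OF test_smooth[OF \<psi>], of \<Omega>]
  obtain C b where C: "compact C" "C \<subseteq> \<Omega>" "\<And>x. x \<notin> C \<Longrightarrow> \<psi> x = 0" "0 \<le> b" "\<And>x. \<bar>\<psi> x\<bar> \<le> b" "\<And>x. norm (gradient \<psi> x) \<le> b"
    using test_functionE[OF \<psi>] by metis
  have B: "\<bar>\<theta> s\<bar> \<le> B" "\<bar>\<theta>' s\<bar> \<le> B" "0 \<le> B" for s using \<theta> abs_ge_zero order_trans unfolding smooth_bounded_def by blast+
  have \<eta>m: "\<eta> \<in> borel_measurable M" unfolding \<eta>_def[abs_def] by measurable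
  have \<eta>b: "\<bar>\<eta> X\<bar> \<le> b * B" for X unfolding \<eta>_def abs_mult using C B by (intro mult_mono) auto
  have W: "Lp_on p M W" by (rule pert(3))
  have W1: "Lp_on p M (\<lambda>X. \<theta> (u X) *\<^sub>R gradient \<psi> X)"
  proof (rule Lp_on_bound[where f="\<lambda>X. 1::real" and C="B * b"])
    show "Lp_on p M (\<lambda>X. 1::real)" using integrable_const_M by (simp add: Lp_on_def)
    show "AE X in M. norm (\<theta> (u X) *\<^sub>R gradient \<psi> X) \<le> B * b * norm (1::real)"
      using B C by (intro AE_I2) (auto intro!: mult_mono)
  qed (use p B C in auto)
  have W2: "Lp_on p M (\<lambda>X. (\<psi> X * \<theta>' (u X)) *\<^sub>R Du X)"
  proof (rule Lp_on_bound[OF Du_Lp(2)])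
    show "AE X in M. norm ((\<psi> X * \<theta>' (u X)) *\<^sub>R Du X) \<le> (b * B) * norm (Du X)"
      using B C by (intro AE_I2) (auto simp: abs_mult intro!: mult_mono mult_right_mono)
  qed (use p B C in auto)
  show i1: "integrable M (\<lambda>X. \<theta> (u X) * (flux X \<bullet> gradient \<psi> X))" and i2: "integrable M (\<lambda>X. \<psi> X * \<theta>' (u X) * (flux X \<bullet> Du X))"
    using flux_inner_integrable[OF W1] flux_inner_integrable[OF W2] by simp_all
  have AW: "(LINT X|M. flux X \<bullet> W X) = (LINT X|M. \<theta> (u X) * (flux X \<bullet> gradient \<psi> X)) + (LINT X|M. \<psi> X * \<theta>' (u X) * (flux X \<bullet> Du X))"
    unfolding W_def inner_add_right inner_scaleR_right using i1 i2 by simp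
  have neg': "u X + s k * \<eta> X \<le> 0" if "X \<in> \<Omega>" "u X \<le> 0" for X k
    using neg[OF that s(2) s(4)] by (simp add: \<eta>_def)
  have Rlim: "(\<lambda>k. LINT X|M. source_quotient \<eta> (s k) X) \<longlonglongrightarrow> (LINT X|M. source X * \<eta> X)" and Rint: "\<And>k. integrable M (source_quotient \<eta> (s k))"
    using source_quotient_integral_tendsto[OF \<eta>m \<eta>b C(1,2) _ s(1-3) neg'] C(3) by (auto simp: \<eta>_def[abs_def])
  have Glim: "(\<lambda>k. LINT X|M. (G X (Du X + s k *\<^sub>R W X) - G X (Du X)) / s k) \<longlonglongrightarrow> (LINT X|M. flux X \<bullet> W X)"
    unfolding s_def by (rule G_first_variation[OF W \<tau>])
  have "0 \<le> (LINT X|M. (G X (Du X + s k *\<^sub>R W X) - G X (Du X)) / s k) + (LINT X|M. source_quotient \<eta> (s k) X)" for k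
  proof -
    let ?v = "\<lambda>X. u X + s k * \<eta> X"
    have vb: "?v \<in> W1p_bdry \<Omega> p \<phi>" by (rule pert(1))
    have v: "Lp_on p M ?v" and wm: "weak_gradient \<Omega> ?v \<in> borel_measurable M"
      using W1p_bdry_sobolev_approx[OF vb p(1) open_\<Omega> bounded_\<Omega>] by (auto simp: sobolev_approx_def Lp_on_def)
    have V: "Lp_on p M (\<lambda>X. Du X + s k *\<^sub>R W X)" using Du_Lp(2) W p by (intro Lp_on_add Lp_on_scaleR) auto
    have ev: "energy \<Omega> F ?v = (LINT X|M. G X (Du X + s k *\<^sub>R W X)) + (LINT X|M. f X * (max (?v X) 0) powr m) + (LINT X|M. Q X * indicator {0<..} (?v X))"
      by (rule energy_eq[OF v V pert(2) wm])
    have eu: "energy \<Omega> F u = (LINT X|M. G X (Du X)) + (LINT X|M. f X * (max (u X) 0) powr m) + (LINT X|M. Q X * indicator {0<..} (u X))"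
      by (rule energy_eq[OF Du_Lp]) auto
    have "energy \<Omega> F u \<le> energy \<Omega> F ?v" using minimizer vb by (auto simp: is_minimizer_def)
    moreover have "(LINT X|M. Q X * indicator {0<..} (?v X)) \<le> (LINT X|M. Q X * indicator {0<..} (u X))"
    proof (rule integral_mono)
      fix X assume "X \<in> space M"
      then have X: "X \<in> \<Omega>" by simp
      show "Q X * indicator {0<..} (?v X) \<le> Q X * indicator {0<..} (u X)"
        using neg'[OF X, of k] Q(2)[OF X] by (cases "u X \<le> 0") (auto simp: indicator_def)
    qed (use g_integrable v Du_Lp in auto)
    ultimately have le: "0 \<le> ((LINT X|M. G X (Du X + s k *\<^sub>R W X)) - (LINT X|M. G X (Du X)))
        + ((LINT X|M. f X * (max (?v X) 0) powr m) - (LINT X|M. f X * (max (u X) 0) powr m))"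
      using ev eu by linarith
    have 1: "(LINT X|M. (G X (Du X + s k *\<^sub>R W X) - G X (Du X)) / s k) = ((LINT X|M. G X (Du X + s k *\<^sub>R W X)) - (LINT X|M. G X (Du X))) / s k"
      using G_comp_integrable[OF V] G_comp_integrable[OF Du_Lp(2)] by simp
    have "(LINT X|M. source_quotient \<eta> (s k) X) = (LINT X|M. (f X * (max (?v X) 0) powr m - f X * (max (u X) 0) powr m) / s k)"
      by (simp add: source_quotient_def right_diff_distrib)
    also have "\<dots> = ((LINT X|M. f X * (max (?v X) 0) powr m) - (LINT X|M. f X * (max (u X) 0) powr m)) / s k"
      using g_integrable(1)[OF v] g_integrable(1)[OF Du_Lp(1)] by simp
    finally show ?thesis unfolding 1 add_divide_distrib[symmetric] using le s(2)[of k] by (simp only: add_divide_distrib[symmetric]) simp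
  qed
  moreover have "(\<lambda>k. (LINT X|M. (G X (Du X + s k *\<^sub>R W X) - G X (Du X)) / s k) + (LINT X|M. source_quotient \<eta> (s k) X))
      \<longlonglongrightarrow> (LINT X|M. flux X \<bullet> W X) + (LINT X|M. source X * \<eta> X)"
    by (rule tendsto_add[OF Glim Rlim])
  ultimately have "0 \<le> (LINT X|M. flux X \<bullet> W X) + (LINT X|M. source X * \<eta> X)"
    by (intro LIMSEQ_le_const) auto
  then show "0 \<le> (LINT X|M. \<theta> (u X) * (flux X \<bullet> gradient \<psi> X)) + (LINT X|M. \<psi> X * \<theta>' (u X) * (flux X \<bullet> Du X))
    + (LINT X|M. source X * (\<psi> X * \<theta> (u X)))" unfolding AW by (simp add: \<eta>_def)
qed

end

context minimizer_setting begin

section \<open>The Euler-Lagrange distribution\<close>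

definition euler_lagrange :: "('a \<Rightarrow> real) \<Rightarrow> real" where
  "euler_lagrange \<psi> = distr_div \<Omega> flux \<psi> - distr_of_fun \<Omega> source \<psi>"

lemma euler_lagrange_eq: "euler_lagrange \<psi> = - (LINT X|M. flux X \<bullet> gradient \<psi> X) - (LINT X|M. source X * \<psi> X)"
  by (simp add: euler_lagrange_def distr_div_def distr_of_fun_def)

lemma flux_gradient_integrable:
  assumes \<psi>: "\<psi> \<in> test_functions \<Omega>"
  shows "integrable M (\<lambda>X. flux X \<bullet> gradient \<psi> X)"
proof (rule flux_inner_integrable)
  obtain b where b: "0 \<le> b" "\<And>x. norm (gradient \<psi> x) \<le> b" using test_functionE[OF \<psi>] by metis
  show "Lp_on p M (gradient \<psi>)"
  proof (rule Lp_on_bound[where f="\<lambda>X. 1::real" and C=b])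
    show "Lp_on p M (\<lambda>X. 1::real)" using integrable_const_M by (simp add: Lp_on_def)
  qed (use p b lebesgue_on_smooth_measurable[OF test_smooth[OF \<psi>]] in auto)
qed

lemma source_test_integrable: "\<psi> \<in> test_functions \<Omega> \<Longrightarrow> integrable M (\<lambda>X. source X * \<psi> X)"
  by (rule integrable_test_mult(1)[OF source_locally_integrable open_\<Omega>])

text \<open>The direction \<open>- \<psi>\<close> is always admissible.\<close>

lemma euler_lagrange_nonneg:
  assumes \<psi>: "\<psi> \<in> test_functions \<Omega>" "\<And>X. 0 \<le> \<psi> X"
  shows "0 \<le> euler_lagrange \<psi>"
proof -
  have neg: "u X + r * (\<psi> X * (- 1)) \<le> 0" if "u X \<le> 0" "0 < r" for X r
  proof -
    have "0 \<le> r * \<psi> X" using that \<psi>(2) by (intro mult_nonneg_nonneg) auto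
    then show ?thesis using that by simp
  qed
  have "0 \<le> (LINT X|M. (- 1) * (flux X \<bullet> gradient \<psi> X)) + (LINT X|M. \<psi> X * 0 * (flux X \<bullet> Du X)) + (LINT X|M. source X * (\<psi> X * (- 1)))"
    by (rule variational_inequality(1)[OF \<psi>(1) smooth_bounded_const, of 1]) (use neg in auto)
  then show ?thesis by (simp add: euler_lagrange_eq)
qed

lemma positive_distribution_T: "positive_distribution \<Omega> euler_lagrange"
proof
  show "open \<Omega>" by (rule open_\<Omega>)
  fix \<psi> assume \<psi>: "\<psi> \<in> test_functions \<Omega>"
  show "euler_lagrange (\<lambda>x. c * \<psi> x) = c * euler_lagrange \<psi>" for c
    by (simp add: euler_lagrange_eq gradient_cmult[OF test_smooth[OF \<psi>]] mult.left_commute[of _ c] right_diff_distrib)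
  show "0 \<le> euler_lagrange \<psi>" if "\<And>x. 0 \<le> \<psi> x" using euler_lagrange_nonneg[OF \<psi> that] .
  fix \<eta> assume \<eta>: "\<eta> \<in> test_functions \<Omega>"
  show "euler_lagrange (\<lambda>x. \<psi> x + \<eta> x) = euler_lagrange \<psi> + euler_lagrange \<eta>"
    using flux_gradient_integrable[OF \<psi>] flux_gradient_integrable[OF \<eta>] source_test_integrable[OF \<psi>] source_test_integrable[OF \<eta>]
    by (simp add: euler_lagrange_eq gradient_add[OF test_smooth[OF \<psi>] test_smooth[OF \<eta>]] inner_add_right distrib_left)
qed

text \<open>Where \<open>\<psi>\<close> is supported, \<open>u\<close> is positive already, so the direction \<open>\<psi>\<close> is admissible too.\<close>

lemma euler_lagrange_le_0_on_positive_set: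
  assumes \<psi>: "\<psi> \<in> test_functions \<Omega>" and pos: "\<And>X. \<psi> X \<noteq> 0 \<Longrightarrow> 0 < u X"
  shows "euler_lagrange \<psi> \<le> 0"
proof -
  have neg: "u X + r * (\<psi> X * 1) \<le> 0" if "u X \<le> 0" for X r
    using that pos[of X] by (cases "\<psi> X = 0") auto
  have "0 \<le> (LINT X|M. 1 * (flux X \<bullet> gradient \<psi> X)) + (LINT X|M. \<psi> X * 0 * (flux X \<bullet> Du X)) + (LINT X|M. source X * (\<psi> X * 1))"
    by (rule variational_inequality(1)[OF \<psi> smooth_bounded_const, of 1]) (use neg in auto)
  then show ?thesis by (simp add: euler_lagrange_eq)
qed

lemma flux_AE: "AE X in M. (u X = 0 \<longrightarrow> flux X = 0) \<and> 0 \<le> flux X \<bullet> Du X"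
proof -
  obtain w c where "sobolev_approx \<Omega> p w u Du" "AE x in M. (\<lambda>k. w k x) \<longlonglongrightarrow> u x"
    by (rule W1p_bdry_sobolev_approx[OF u_bdry p(1) open_\<Omega> bounded_\<Omega>])
  then have "AE X in M. u X = 0 \<longrightarrow> Du X = 0"
    by (intro weak_gradient_AE_0_on_zero_set[OF _ p(1) open_\<Omega> bounded_\<Omega>])
  then show ?thesis using G_density
  proof eventually_elim
    case (elim X)
    interpret convex_density "G X" p lam by fact
    show ?case using elim gradient_0 gradient_inner_self_nonneg by (simp add: flux_def)
  qed
qed

text \<open>The direction \<open>\<psi>\<close> itself could make \<open>u\<close> positive. The cut-off direction \<open>\<psi> * \<theta> n (u)\<close> does not,
  since \<open>\<theta> n (u)\<close> is at most \<open>\<bar>u\<bar>\<close> divided by \<open>step n\<close>. The additional term with \<open>\<theta>' n\<close>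
  has a favourable sign, and the flux vanishes almost everywhere on the zero set, where \<open>\<theta> n (u)\<close>
  does not tend to \<open>1\<close>.\<close>

lemma euler_lagrange_le_0_on_nonpositive_set:
  assumes \<psi>: "\<psi> \<in> test_functions \<Omega>" "\<And>X. 0 \<le> \<psi> X" and np: "\<And>X. \<psi> X \<noteq> 0 \<Longrightarrow> u X \<le> 0"
  shows "euler_lagrange \<psi> \<le> 0"
proof -
  obtain b where b: "0 \<le> b" "\<And>x. \<bar>\<psi> x\<bar> \<le> b" using test_functionE[OF \<psi>(1)] by metis
  define \<theta> where "\<theta> n s = s\<^sup>2 / (s\<^sup>2 + (step n)\<^sup>2)" for n s
  define \<theta>' where "\<theta>' n s = 2 * s * (step n)\<^sup>2 / (s\<^sup>2 + (step n)\<^sup>2)\<^sup>2" for n s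
  have sb: "smooth_bounded (\<theta> n) (\<theta>' n) (1 + 1 / step n)" for n
    unfolding \<theta>_def[abs_def] \<theta>'_def[abs_def] by (rule smooth_bounded_zero_cutoff[OF step(1)])
  have \<theta>1: "0 \<le> \<theta> n s" "\<theta> n s \<le> 1" for n s
    using step(1)[of n] by (auto simp: \<theta>_def divide_le_eq add_nonneg_pos)
  have h0: "source X * (\<psi> X * c) = 0" "source X * \<psi> X = 0" for X c
    using np[of X] by (cases "\<psi> X = 0"; simp add: source_def)+
  note [measurable] = lebesgue_on_smooth_measurable[OF test_smooth[OF \<psi>(1)], of \<Omega>]
  have cut_nonneg: "0 \<le> (LINT X|M. \<theta> n (u X) * (flux X \<bullet> gradient \<psi> X))" for n
  proof -
    \<comment> \<open>For \<open>r \<le> \<tau>\<close> the product \<open>r * \<psi>\<close> is at most \<open>d = step n\<close>, and \<open>2 * \<bar>u\<bar> * d \<le> u\<^sup>2 + d\<^sup>2\<close>.\<close>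
    define \<tau> where "\<tau> = min 1 (step n / (b + 1))"
    have \<tau>: "0 < \<tau>" "\<tau> \<le> 1" using step(1)[of n] b(1) by (auto simp: \<tau>_def)
    have neg: "u X + r * (\<psi> X * \<theta> n (u X)) \<le> 0" if "u X \<le> 0" "0 < r" "r \<le> \<tau>" for X r
    proof -
      have d: "0 < step n" by (rule step)
      have "r * \<psi> X \<le> (step n / (b + 1)) * b"
        using that b(2)[of X] \<psi>(2)[of X] by (intro mult_mono) (auto simp: \<tau>_def)
      also have "\<dots> \<le> step n" using d b(1) by (simp add: field_simps)
      finally have r: "r * \<psi> X \<le> step n" .
      have "0 \<le> (- u X - step n)\<^sup>2" by simp
      then have "2 * (- u X * step n) \<le> (u X)\<^sup>2 + (step n)\<^sup>2" by (simp add: power2_diff power2_sum algebra_simps)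
      moreover have "0 \<le> - u X * step n" using that d by (intro mult_nonneg_nonneg) auto
      ultimately have "- u X * step n \<le> (u X)\<^sup>2 + (step n)\<^sup>2" by linarith
      moreover have "- u X * (r * \<psi> X) \<le> - u X * step n" using r that by (intro mult_left_mono) auto
      ultimately have "- u X * (r * \<psi> X) \<le> (u X)\<^sup>2 + (step n)\<^sup>2" by linarith
      then have "- u X * (- u X * (r * \<psi> X)) \<le> - u X * ((u X)\<^sup>2 + (step n)\<^sup>2)" using that by (intro mult_left_mono) auto
      then have "(r * \<psi> X) * (u X)\<^sup>2 \<le> - u X * ((u X)\<^sup>2 + (step n)\<^sup>2)" by (simp add: power2_eq_square mult_ac)
      moreover have "0 < (u X)\<^sup>2 + (step n)\<^sup>2" using d by (simp add: add_nonneg_pos)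
      ultimately have "(r * \<psi> X) * (u X)\<^sup>2 / ((u X)\<^sup>2 + (step n)\<^sup>2) \<le> - u X" by (subst pos_divide_le_eq)
      then show ?thesis by (simp add: \<theta>_def mult.assoc)
    qed
    have "0 \<le> (LINT X|M. \<theta> n (u X) * (flux X \<bullet> gradient \<psi> X)) + (LINT X|M. \<psi> X * \<theta>' n (u X) * (flux X \<bullet> Du X)) + (LINT X|M. source X * (\<psi> X * \<theta> n (u X)))"
      by (rule variational_inequality(1)[OF \<psi>(1) sb \<tau>]) (use neg in auto)
    moreover have "(LINT X|M. \<psi> X * \<theta>' n (u X) * (flux X \<bullet> Du X)) \<le> 0"
    proof -
      have "AE X in M. 0 \<le> - (\<psi> X * \<theta>' n (u X) * (flux X \<bullet> Du X))" using flux_AE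
      proof eventually_elim
        case (elim X)
        have "\<psi> X * \<theta>' n (u X) \<le> 0"
        proof (cases "\<psi> X = 0")
          case False
          then have "2 * u X * (step n)\<^sup>2 \<le> 0" using np[OF False] by (intro mult_nonpos_nonneg[of "2 * u X"]) auto
          then have "\<theta>' n (u X) \<le> 0" unfolding \<theta>'_def by (intro divide_nonpos_nonneg) auto
          then show ?thesis using \<psi>(2) by (intro mult_nonneg_nonpos)
        qed simp
        then show ?case using elim mult_nonpos_nonneg by force
      qed
      from integral_nonneg_AE[OF this] show ?thesis by simp
    qed
    ultimately show ?thesis by (simp add: h0)
  qed
  have "(\<lambda>n. LINT X|M. \<theta> n (u X) * (flux X \<bullet> gradient \<psi> X)) \<longlonglongrightarrow> (LINT X|M. flux X \<bullet> gradient \<psi> X)"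
  proof (rule integral_dominated_convergence[where w="\<lambda>X. \<bar>flux X \<bullet> gradient \<psi> X\<bar>"])
    show "integrable M (\<lambda>X. \<bar>flux X \<bullet> gradient \<psi> X\<bar>)" using flux_gradient_integrable[OF \<psi>(1)] by simp
    have [measurable]: "\<theta> n \<in> borel_measurable borel" for n
      using sb[of n] by (auto simp: smooth_bounded_def intro: smooth_borel)
    show "(\<lambda>X. \<theta> n (u X) * (flux X \<bullet> gradient \<psi> X)) \<in> borel_measurable M" for n by measurable
    show "AE X in M. (\<lambda>n. \<theta> n (u X) * (flux X \<bullet> gradient \<psi> X)) \<longlonglongrightarrow> flux X \<bullet> gradient \<psi> X"
      using flux_AE
    proof eventually_elim
      case (elim X)
      show ?case
      proof (cases "u X = 0")
        case True then show ?thesis using elim by simp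
      next
        case False
        then have "(\<lambda>n. (u X)\<^sup>2 / ((u X)\<^sup>2 + (step n)\<^sup>2) * (flux X \<bullet> gradient \<psi> X)) \<longlonglongrightarrow> (u X)\<^sup>2 / ((u X)\<^sup>2 + 0\<^sup>2) * (flux X \<bullet> gradient \<psi> X)"
          by (intro tendsto_intros step(3)) simp
        then show ?thesis using False by (simp add: \<theta>_def)
      qed
    qed
    show "AE X in M. norm (\<theta> n (u X) * (flux X \<bullet> gradient \<psi> X)) \<le> \<bar>flux X \<bullet> gradient \<psi> X\<bar>" for n
      using \<theta>1 by (intro AE_I2) (auto simp: abs_mult intro!: mult_left_le_one_le)
  qed measurable
  then have "0 \<le> (LINT X|M. flux X \<bullet> gradient \<psi> X)" using cut_nonneg by (intro LIMSEQ_le_const) auto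
  then show ?thesis by (simp add: euler_lagrange_eq h0)
qed

text \<open>The bump is positive on the whole ball and its integral vanishes.\<close>

lemma measure_ball_eq_0:
  assumes \<mu>: "radon_measure_on \<Omega> \<mu>" "distr_is_measure \<Omega> euler_lagrange \<mu>" and r: "0 < r" "cball c r \<subseteq> \<Omega>"
    and le: "euler_lagrange (bump c r) \<le> 0"
  shows "emeasure \<mu> (ball c r) = 0"
proof -
  have step: "bump c r \<in> test_functions \<Omega>" by (rule bump_test[OF r])
  have sets: "sets \<mu> = sets (restrict_space borel \<Omega>)" and sp: "space \<mu> = \<Omega>" using \<mu> by (auto simp: radon_measure_on_def)
  have "integrable \<mu> (bump c r)"
    by (rule test_function_integrable[OF step sets _ open_\<Omega>]) (use \<mu> in \<open>auto simp: radon_measure_on_def\<close>)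
  moreover have "(LINT X|\<mu>. bump c r X) = 0"
    using \<mu>(2) step le euler_lagrange_nonneg[OF step bump_bounds(1)] by (simp add: distr_is_measure_def)
  ultimately have "AE X in \<mu>. bump c r X = 0"
    using integral_nonneg_eq_0_iff_AE[of \<mu> "bump c r"] by (simp add: bump_bounds)
  then have "AE X in \<mu>. X \<notin> ball c r"
    by eventually_elim (metis bump_pos_iff[OF r(1)] less_irrefl)
  moreover have "ball c r \<in> sets \<mu>"
    using r ball_subset_cball[of c r] open_\<Omega> by (auto simp: sets sets_restrict_space_iff)
  ultimately show ?thesis
    using AE_iff_measurable[of "ball c r" \<mu> "\<lambda>X. X \<notin> ball c r"] sets.sets_into_space by (fastforce simp: sp)
qed

lemma measure_support_subset:
  assumes \<mu>: "radon_measure_on \<Omega> \<mu>" "distr_is_measure \<Omega> euler_lagrange \<mu>"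
  shows "measure_support \<mu> \<subseteq> frontier {X \<in> \<Omega>. 0 < u X}"
proof
  let ?P = "{X \<in> \<Omega>. 0 < u X}"
  have "open ?P"
  proof -
    have "?P = \<Omega> \<inter> u -` {0<..}" by auto
    then show ?thesis using continuous_open_preimage[OF continuous_u open_\<Omega> open_greaterThan] by simp
  qed
  have sp: "space \<mu> = \<Omega>" using \<mu> by (auto simp: radon_measure_on_def)
  fix x assume x: "x \<in> measure_support \<mu>"
  then have x\<Omega>: "x \<in> \<Omega>" by (simp add: measure_support_def sp)
  show "x \<in> frontier ?P"
  proof (rule ccontr)
    assume "x \<notin> frontier ?P"
    then have *: "x \<in> ?P \<or> x \<in> \<Omega> \<inter> - closure ?P"
      using x\<Omega> \<open>open ?P\<close> by (auto simp: frontier_def interior_open)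
    have "\<exists>r>0. cball x r \<subseteq> \<Omega> \<and> euler_lagrange (bump x r) \<le> 0"
    proof (cases "x \<in> ?P")
      case True
      then obtain r where r: "r > 0" "cball x r \<subseteq> ?P" using \<open>open ?P\<close> open_contains_cball by blast
      have "euler_lagrange (bump x r) \<le> 0"
      proof (rule euler_lagrange_le_0_on_positive_set)
        show "bump x r \<in> test_functions \<Omega>" using r by (intro bump_test) auto
        fix X assume "bump x r X \<noteq> 0"
        then have "X \<in> ball x r" using bump_pos_iff[OF r(1), of x X] bump_bounds(1)[of x r X] by linarith
        then show "0 < u X" using r(2) ball_subset_cball by blast
      qed
      then show ?thesis using r by auto
    next
      case False
      have "open (\<Omega> \<inter> - closure ?P)" using open_\<Omega> by (intro open_Int open_Compl) auto
      then obtain r where r: "r > 0" "cball x r \<subseteq> \<Omega> \<inter> - closure ?P" using False * open_contains_cball by blast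
      have "euler_lagrange (bump x r) \<le> 0"
      proof (rule euler_lagrange_le_0_on_nonpositive_set)
        show "bump x r \<in> test_functions \<Omega>" using r by (intro bump_test) auto
        fix X assume "bump x r X \<noteq> 0"
        then have "X \<in> ball x r" using bump_pos_iff[OF r(1), of x X] bump_bounds(1)[of x r X] by linarith
        then have "X \<in> \<Omega>" "X \<notin> ?P" using r(2) ball_subset_cball closure_subset[of ?P] by blast+
        then show "u X \<le> 0" by simp
      qed (rule bump_bounds)
      then show ?thesis using r by auto
    qed
    then obtain r where r: "r > 0" "cball x r \<subseteq> \<Omega>" "euler_lagrange (bump x r) \<le> 0" by blast
    then have "emeasure \<mu> (ball x r) = 0" by (intro measure_ball_eq_0 \<mu>)
    moreover have "emeasure \<mu> (ball x r \<inter> space \<mu>) > 0" using x r(1) by (auto simp: measure_support_def)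
    moreover have "ball x r \<inter> space \<mu> = ball x r" using r(2) ball_subset_cball[of x r] by (auto simp: sp)
    ultimately show False by simp
  qed
qed

end

lemma holder_continuous_imp_continuous_on:
  assumes Q: "holder_continuous_on \<beta> S Q" and \<beta>: "0 < \<beta>"
  shows "continuous_on S Q"
  unfolding continuous_on_def
proof
  fix x assume x: "x \<in> S"
  obtain C where C: "\<And>x y. x \<in> S \<Longrightarrow> y \<in> S \<Longrightarrow> \<bar>Q x - Q y\<bar> \<le> C * dist x y powr \<beta>"
    using Q by (auto simp: holder_continuous_on_def)
  have "((\<lambda>y. C * dist x y powr \<beta>) \<longlongrightarrow> C * dist x x powr \<beta>) (at x within S)"
    using \<beta> by (intro tendsto_intros tendsto_powr2) auto
  then have "((\<lambda>y. C * dist x y powr \<beta>) \<longlongrightarrow> 0) (at x within S)" by simp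
  then have "((\<lambda>y. Q y - Q x) \<longlongrightarrow> 0) (at x within S)"
    by (rule Lim_null_comparison[rotated]) (use C[OF x] in \<open>auto simp: eventually_at_filter abs_minus_commute\<close>)
  then show "(Q \<longlongrightarrow> Q x) (at x within S)" by (simp add: LIM_zero_iff)
qed

theorem lemma4p2:
  fixes \<Omega> :: "(real ^ 'n) set"
    and p m lam K \<beta> \<epsilon> :: real
    and \<phi> f Q u :: "real ^ 'n \<Rightarrow> real"
    and F :: "real ^ 'n \<Rightarrow> real \<Rightarrow> real ^ 'n \<Rightarrow> real"
    and G :: "real ^ 'n \<Rightarrow> real ^ 'n \<Rightarrow> real"
    and g :: "real ^ 'n \<Rightarrow> real \<Rightarrow> real"
    and \<A> :: "real ^ 'n \<Rightarrow> real ^ 'n \<Rightarrow> real ^ 'n"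
    and \<Lambda> :: "(real ^ 'n \<Rightarrow> real) \<Rightarrow> real"
  assumes domain: "bounded_smooth_domain \<Omega>"
    and p: "2 \<le> p" "p < real CARD('n)"
    and phi: "\<phi> \<in> W1p \<Omega> p" "AE X in lebesgue_on \<Omega>. 0 \<le> \<phi> X"
      "\<exists>B. AE X in lebesgue_on \<Omega>. \<bar>\<phi> X\<bar> \<le> B"
    and F: "\<And>X s \<xi>. X \<in> \<Omega> \<Longrightarrow> F X s \<xi> = G X \<xi> + g X s"
    and G_cont: "\<And>\<xi>. continuous_on \<Omega> (\<lambda>X. G X \<xi>)"
    and G_growth: "0 < lam"
      "\<And>X \<xi>. X \<in> \<Omega> \<Longrightarrow> lam * norm \<xi> powr p \<le> G X \<xi>"
      "\<And>X \<xi>. X \<in> \<Omega> \<Longrightarrow> G X \<xi> \<le> inverse lam * norm \<xi> powr p"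
    and G_structure: "AE X in lebesgue_on \<Omega>. strictly_convex_on UNIV (G X) \<and>
      (\<forall>\<xi>. G X differentiable (at \<xi>)) \<and> (\<forall>t \<xi>. G X (t *\<^sub>R \<xi>) = \<bar>t\<bar> powr p * G X \<xi>)"
    and g: "\<And>X s. X \<in> \<Omega> \<Longrightarrow> g X s = f X * (max s 0) powr m + Q X * indicator {0<..} s"
    and m: "1 \<le> m" "m < p"
    and f: "f \<in> borel_measurable (lebesgue_on \<Omega>)" "0 < K"
      "\<And>X. X \<in> \<Omega> \<Longrightarrow> - K \<le> f X \<and> f X \<le> K"
    and Q_holder: "0 < \<beta>" "\<beta> \<le> 1" "holder_continuous_on \<beta> \<Omega> Q"
    and Q_bounds: "0 < \<epsilon>" "\<And>X. X \<in> \<Omega> \<Longrightarrow> \<epsilon> < Q X \<and> Q X < inverse \<epsilon>"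
    and minimizer: "is_minimizer \<Omega> p \<phi> F u"
    and continuous_representative: "continuous_on \<Omega> u"
    and \<A>: "\<A> = (\<lambda>X \<xi>. gradient (G X) \<xi>)"
    and \<Lambda>: "\<Lambda> = (\<lambda>\<psi>. distr_div \<Omega> (\<lambda>X. \<A> X (weak_gradient \<Omega> u X)) \<psi>
      - distr_of_fun \<Omega> (\<lambda>X. m * f X * u X powr (m - 1) * indicator {X. 0 < u X} X) \<psi>)"
  shows "locally_integrable \<Omega> (\<lambda>X. \<A> X (weak_gradient \<Omega> u X)) \<and>
    locally_integrable \<Omega> (\<lambda>X. m * f X * u X powr (m - 1) * indicator {X. 0 < u X} X) \<and>
    distr_nonneg \<Omega> \<Lambda> \<and>
    (\<exists>!\<mu>. radon_measure_on \<Omega> \<mu> \<and> distr_is_measure \<Omega> \<Lambda> \<mu>) \<and>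
    (\<forall>\<mu>. radon_measure_on \<Omega> \<mu> \<and> distr_is_measure \<Omega> \<Lambda> \<mu> \<longrightarrow>
      measure_support \<mu> \<subseteq> frontier {X \<in> \<Omega>. 0 < u X})"
proof -
  have \<Omega>: "open \<Omega>" "bounded \<Omega>" using domain by (auto simp: bounded_smooth_domain_def)
  interpret minimizer_setting \<Omega> p m lam K "inverse \<epsilon>" \<phi> f Q u F G
  proof
    show "F X s \<xi> = G X \<xi> + (f X * max s 0 powr m + Q X * indicator {0<..} s)" if "X \<in> \<Omega>" for X s \<xi>
      using F[OF that] g[OF that] by simp
    show "(\<lambda>X. G X \<xi>) \<in> borel_measurable (lebesgue_on \<Omega>)" for \<xi>
      using G_cont \<Omega>(1) by (intro continuous_imp_measurable_on_sets_lebesgue) auto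
    have "AE X in lebesgue_on \<Omega>. X \<in> \<Omega>" using AE_space[of "lebesgue_on \<Omega>"] by simp
    with G_structure show "AE X in lebesgue_on \<Omega>. convex_density (G X) p lam"
    proof eventually_elim
      case (elim X)
      then show ?case
        using p(1) G_growth strictly_convex_imp_convex_on by unfold_locales auto
    qed
    show "\<bar>f X\<bar> \<le> K" if "X \<in> \<Omega>" for X using f(3)[OF that] by auto
    show "Q \<in> borel_measurable (lebesgue_on \<Omega>)"
      using holder_continuous_imp_continuous_on[OF Q_holder(3,1)] \<Omega>(1)
      by (intro continuous_imp_measurable_on_sets_lebesgue) auto
    show "0 \<le> Q X \<and> Q X \<le> inverse \<epsilon>" if "X \<in> \<Omega>" for X using Q_bounds(1) Q_bounds(2)[OF that] by auto
  qed (use \<Omega> m f minimizer continuous_representative in auto)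
  have flux_eq: "(\<lambda>X. \<A> X (weak_gradient \<Omega> u X)) = flux" by (simp add: \<A> flux_def fun_eq_iff)
  have source_eq: "(\<lambda>X. m * f X * u X powr (m - 1) * indicator {X. 0 < u X} X) = source" by (simp add: source_def fun_eq_iff)
  have euler_lagrange: "\<Lambda> = euler_lagrange" unfolding \<Lambda> flux_eq source_eq by (simp add: euler_lagrange_def fun_eq_iff)
  show ?thesis
    unfolding flux_eq source_eq euler_lagrange
  proof (intro conjI allI impI)
    show "distr_nonneg \<Omega> euler_lagrange" using euler_lagrange_nonneg by (auto simp: distr_nonneg_def)
    show "\<exists>!\<mu>. radon_measure_on \<Omega> \<mu> \<and> distr_is_measure \<Omega> euler_lagrange \<mu>"
      by (rule positive_distribution_representation[OF positive_distribution_T])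
  qed (use flux_locally_integrable source_locally_integrable measure_support_subset in auto)
qed

end
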